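(* Let $E:=\{e^n\}_{n\in\mathbb{Z}}$. For a bijection $f:E\to E$, the following conditions are quantitatively equivalent: (1) $f$ is $\eta$-quasisymmetric for some homeomorphism $\eta:[0,+\infty)\to[0,+\infty)$. (2) $b_n:=f(e^n)\to0$ as $n\to-\infty$, and $\{b_n\}_{n\in\mathbb{Z}}$ satisfies the $\lambda$-three point condition for some $\lambda\ge1$, that is, for any integers $n<m<k$, $$\left|\frac{b_n-b_m}{b_n-b_k}\right|=\left|\frac{f(e^n)-f(e^m)}{f(e^n)-f(e^k)}\right|\le\lambda.$$ (3) $f$ admits a $K$-quasiconformal extension $\widetilde f:\mathbb{C}\to\mathbb{C}$ for some $K\ge1$ (i.e. $\widetilde f|_E=f$).
   Context: "Quantitatively equivalent" means that the conditions are equivalent and, for each implication, the data ($\eta$, $\lambda$, or $K$) of the conclusion can be chosen depending only on the data of the hypothesis (and not on $f$). Let $\eta:[0,+\infty)\to[0,+\infty)$ be a homeomorphism and $X\subset\mathbb{C}$. An injection $f:X\to\mathbb{C}$ is $\eta$-quasisymmetric if $\left|\frac{f(x)-f(y)}{f(x)-f(z)}\right|\le\eta\left(\left|\frac{x-y}{x-z}\right|\right)$ for all $x,y,z\in X$ with $x\ne z$. For $K\ge1$ and a domain $\Omega\subset\mathbb{C}$, an orientation preserving homeomorphism $F$ of $\Omega$ into $\mathbb{C}$ is $K$-quasiconformal if its distributional derivatives $F_z,F_{\bar z}$ are locally integrable and $\operatorname{ess\,sup}_{z\in\Omega}\frac{|F_z(z)|+|F_{\bar z}(z)|}{|F_z(z)|-|F_{\bar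 z}(z)|}\le K$. *)

theory Defs
  imports "HOL-Complex_Analysis.Complex_Analysis" "HOL-Probability.Essential_Supremum"
begin

section \<open>Quasisymmetric maps\<close>

text \<open>Only the values of \<open>\<eta>\<close> on \<open>[0,\<infinity>)\<close> matter.\<close>

definition half_line_homeomorphism :: "(real \<Rightarrow> real) \<Rightarrow> bool" where
  "half_line_homeomorphism \<eta> \<longleftrightarrow> (\<exists>\<zeta>. homeomorphism {0..} {0..} \<eta> \<zeta>)"

definition quasisymmetric_on :: "(real \<Rightarrow> real) \<Rightarrow> complex set \<Rightarrow> (complex \<Rightarrow> complex) \<Rightarrow> bool" where
  "quasisymmetric_on \<eta> X f \<longleftrightarrow> inj_on f X \<and>
     (\<forall>x\<in>X. \<forall>y\<in>X. \<forall>z\<in>X. x \<noteq> z \<longrightarrow>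
        cmod ((f x - f y) / (f x - f z)) \<le> \<eta> (cmod ((x - y) / (x - z))))"


section \<open>Distributional derivatives\<close>

text \<open>\<open>C_k k \<phi>\<close>: \<open>\<phi>\<close> is \<open>k\<close> times continuously differentiable on the whole space.\<close>

primrec C_k :: "nat \<Rightarrow> ('a::real_normed_vector \<Rightarrow> 'b::real_normed_vector) \<Rightarrow> bool" where
  "C_k 0 \<phi> \<longleftrightarrow> continuous_on UNIV \<phi>"
| "C_k (Suc k) \<phi> \<longleftrightarrow> \<phi> differentiable_on UNIV \<and>
     (\<forall>v. C_k k (\<lambda>x. frechet_derivative \<phi> (at x) v))"

definition test_function :: "complex set \<Rightarrow> (complex \<Rightarrow> complex) \<Rightarrow> bool" where
  "test_function \<Omega> \<phi> \<longleftrightarrow> (\<forall>k. C_k k \<phi>) \<and>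
     compact (closure {z. \<phi> z \<noteq> 0}) \<and> closure {z. \<phi> z \<noteq> 0} \<subseteq> \<Omega>"

text \<open>The classical Wirtinger derivatives; the derivative is the real one.\<close>

definition wirtinger_dz :: "(complex \<Rightarrow> complex) \<Rightarrow> complex \<Rightarrow> complex" where
  "wirtinger_dz \<phi> z =
     (frechet_derivative \<phi> (at z) 1 - \<i> * frechet_derivative \<phi> (at z) \<i>) / 2"

definition wirtinger_dzbar :: "(complex \<Rightarrow> complex) \<Rightarrow> complex \<Rightarrow> complex" where
  "wirtinger_dzbar \<phi> z =
     (frechet_derivative \<phi> (at z) 1 + \<i> * frechet_derivative \<phi> (at z) \<i>) / 2"

definition locally_integrable_on :: "(complex \<Rightarrow> complex) \<Rightarrow> complex set \<Rightarrow> bool" where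
  "locally_integrable_on g \<Omega> \<longleftrightarrow>
     (\<forall>C. compact C \<and> C \<subseteq> \<Omega> \<longrightarrow> set_integrable lebesgue C g)"

text \<open>\<open>g\<close> is (a representative of) the distributional derivative \<open>F\<^sub>z\<close> in \<open>\<Omega>\<close>, and it is
  locally integrable.  Used for continuous \<open>F\<close> only, so both integrals exist.\<close>

definition distrib_dz_on :: "complex set \<Rightarrow> (complex \<Rightarrow> complex) \<Rightarrow> (complex \<Rightarrow> complex) \<Rightarrow> bool" where
  "distrib_dz_on \<Omega> F g \<longleftrightarrow> locally_integrable_on g \<Omega> \<and>
     (\<forall>\<phi>. test_function \<Omega> \<phi> \<longrightarrow>
        (LINT z:\<Omega>|lebesgue. g z * \<phi> z) = - (LINT z:\<Omega>|lebesgue. F z * wirtinger_dz \<phi> z))"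

definition distrib_dzbar_on :: "complex set \<Rightarrow> (complex \<Rightarrow> complex) \<Rightarrow> (complex \<Rightarrow> complex) \<Rightarrow> bool" where
  "distrib_dzbar_on \<Omega> F g \<longleftrightarrow> locally_integrable_on g \<Omega> \<and>
     (\<forall>\<phi>. test_function \<Omega> \<phi> \<longrightarrow>
        (LINT z:\<Omega>|lebesgue. g z * \<phi> z) = - (LINT z:\<Omega>|lebesgue. F z * wirtinger_dzbar \<phi> z))"


section \<open>Quasiconformal maps\<close>

text \<open>Positively oriented circles bounding a disc in \<open>\<Omega>\<close> are mapped to curves that wind
  exactly once, in the positive sense, around the image of the centre (local degree \<open>1\<close>).\<close>

definition orientation_preserving_on :: "complex set \<Rightarrow> (complex \<Rightarrow> complex) \<Rightarrow> bool" where
  "orientation_preserving_on \<Omega> F \<longleftrightarrow>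
     (\<forall>z r. 0 < r \<and> cball z r \<subseteq> \<Omega> \<longrightarrow> winding_number (F \<circ> circlepath z r) (F z) = 1)"

text \<open>The quotient \<open>(\<bar>p\<bar> + \<bar>q\<bar>) / (\<bar>p\<bar> - \<bar>q\<bar>)\<close>.  Division by zero is total in HOL, and a negative
  quotient would satisfy every upper bound, so the value \<open>\<infinity>\<close> is given where the
  denominator is not positive.\<close>

definition dilatation :: "complex \<Rightarrow> complex \<Rightarrow> ereal" where
  "dilatation p q =
     (if cmod q < cmod p then ereal ((cmod p + cmod q) / (cmod p - cmod q)) else \<infinity>)"

definition quasiconformal_on :: "real \<Rightarrow> complex set \<Rightarrow> (complex \<Rightarrow> complex) \<Rightarrow> bool" where
  "quasiconformal_on K \<Omega> F \<longleftrightarrow>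
     1 \<le> K \<and> open \<Omega> \<and> connected \<Omega> \<and> \<Omega> \<noteq> {} \<and>
     (\<exists>G. homeomorphism \<Omega> (F ` \<Omega>) F G) \<and> orientation_preserving_on \<Omega> F \<and>
     (\<exists>Fz Fzbar. distrib_dz_on \<Omega> F Fz \<and> distrib_dzbar_on \<Omega> F Fzbar \<and>
        esssup (lebesgue_on \<Omega>) (\<lambda>z. dilatation (Fz z) (Fzbar z)) \<le> ereal K)"


section \<open>The conditions and their quantitative equivalence\<close>

definition E :: "complex set" where
  "E = range (\<lambda>n::int. exp (of_int n))"

definition three_point_condition :: "real \<Rightarrow> (int \<Rightarrow> complex) \<Rightarrow> bool" where
  "three_point_condition L b \<longleftrightarrow>
     (\<forall>n m k. n < m \<and> m < k \<longrightarrow> cmod ((b n - b m) / (b n - b k)) \<le> L)"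

text \<open>\<open>P a f\<close> is a condition on \<open>f\<close> with data \<open>a\<close> from a set \<open>A\<close> of admissible data, and
  likewise \<open>Q b f\<close>.  The data \<open>b\<close> is chosen before \<open>f\<close>, hence depends on \<open>a\<close> only.
  In particular \<open>\<exists>a\<in>A. P a f\<close> implies \<open>\<exists>b\<in>B. Q b f\<close> for each \<open>f\<in>S\<close>.\<close>

definition quantitatively_implies ::
    "'f set \<Rightarrow> 'a set \<Rightarrow> ('a \<Rightarrow> 'f \<Rightarrow> bool) \<Rightarrow> 'b set \<Rightarrow> ('b \<Rightarrow> 'f \<Rightarrow> bool) \<Rightarrow> bool" where
  "quantitatively_implies S A P B Q \<longleftrightarrow> (\<forall>a\<in>A. \<exists>b\<in>B. \<forall>f\<in>S. P a f \<longrightarrow> Q b f)"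

definition quantitatively_equivalent ::
    "'f set \<Rightarrow> 'a set \<Rightarrow> ('a \<Rightarrow> 'f \<Rightarrow> bool) \<Rightarrow> 'b set \<Rightarrow> ('b \<Rightarrow> 'f \<Rightarrow> bool) \<Rightarrow> bool" where
  "quantitatively_equivalent S A P B Q \<longleftrightarrow>
     quantitatively_implies S A P B Q \<and> quantitatively_implies S B Q A P"

definition vanishing_three_point :: "real \<Rightarrow> (complex \<Rightarrow> complex) \<Rightarrow> bool" where
  "vanishing_three_point L f \<longleftrightarrow>
     ((\<lambda>n::int. f (exp (of_int n))) \<longlongrightarrow> 0) at_bot \<and>
     three_point_condition L (\<lambda>n. f (exp (of_int n)))"

definition quasiconformal_extension :: "real \<Rightarrow> (complex \<Rightarrow> complex) \<Rightarrow> bool" where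
  "quasiconformal_extension K f \<longleftrightarrow> (\<exists>F. quasiconformal_on K UNIV F \<and> (\<forall>z\<in>E. F z = f z))"

end

theory Submission
  imports Defs
begin

text \<open>
  Write \<open>f(e\<^sup>n) = e\<^bsup>\<sigma>(n)\<^esup>\<close> with a permutation \<open>\<sigma>\<close> of the integers.  Each of the three conditions is equivalent to a bound
  \<open>\<sigma>(m) \<le> \<sigma>(k) + C\<close> for all \<open>m < k\<close>.  By counting, such a bound makes \<open>\<sigma>(n) - n\<close> vary by at most \<open>2 C + 2\<close>, so \<open>f\<close> is
  bi-Lipschitz up to a scaling, hence quasisymmetric with a linear \<open>\<eta>\<close>.

  An extension of such an \<open>f\<close> is a composition of two logarithmic twists and a radial stretching, all of the form \<open>z exp (\<psi>(z))\<close>.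
  Their derivatives off the origin are bounded, so integration by parts (differentiation of a translation-invariant
  integral) identifies them with the distributional derivatives; the isotopy \<open>z exp (t \<psi>(z))\<close> gives the orientation.

  Conversely let \<open>F\<close> be a quasiconformal extension.  Testing with products of cutoff functions shows that \<open>F\<close> is absolutely
  continuous on almost all horizontal and vertical lines.  At a common Lebesgue point of the partial derivatives, \<open>F\<close> is close to
  an affine map on a fine grid of good lines, and, \<open>F\<close> being open, by the maximum principle also between them; so \<open>F\<close> is
  differentiable almost everywhere and the Jacobian integrates to at most the area of the image.  If \<open>m < k\<close> and
  \<open>\<sigma>(k) \<le> j < \<sigma>(m)\<close>, then the image of every square centred at 0 with half side \<open>r\<close> between \<open>e\<^sup>m\<close> and \<open>e\<^bsup>m+1\<^esup>\<close> crosses the ring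
  \<open>e\<^sup>j < \<bar>w\<bar> < e\<^bsup>j+1\<^esup>\<close>.  The length-area method bounds from below, by a multiple of \<open>e\<^bsup>2m\<^esup> / K\<close>, the area that the preimage of each of these
  \<open>\<sigma>(m) - \<sigma>(k)\<close> disjoint rings occupies in the square of half side \<open>e\<^bsup>m+1\<^esup>\<close>; hence \<open>\<sigma>(m) - \<sigma>(k)\<close> is at most a multiple of \<open>K\<close>.
\<close>

section \<open>Permutations of the integers\<close>

text \<open>The definition of quasiconformality grants only locally integrable distributional
  derivatives, so neither differentiability nor square integrability of the derivative may be
  presupposed in (3) => (2). Area supplies the second: \<open>F\<close> is injective, so its
  Jacobian has finite integral over bounded images, and bounded dilatation makes the Jacobian
  control the squared derivative up to the factor \<open>K\<close>. Squares replace the circles of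
  the classical modulus argument because absolute continuity is available on horizontal and vertical
  lines. Squares about 0 are the right ones since the extension must fix 0: otherwise the integers
  \<open>\<sigma> n\<close> would converge as \<open>n\<close> tends to minus infinity. For (2) =>
  (3) the obstacle is that a radial homeomorphism keeps the order of points on a ray, whereas
  \<open>\<sigma>\<close> may exchange points of the positive half line. They have to be spread over
  several rays first, and the number of rays may depend on the displacement bound only. A shift of
  \<open>\<sigma>\<close> costs nothing: it is a scaling, of dilatation 1.\<close>

lemma exp_int_eq: "exp (of_int n :: complex) = complex_of_real (exp (real_of_int n))"
  by (simp add: exp_of_real[symmetric])

lemma exp_int_inj: "exp (of_int n :: complex) = exp (of_int m) \<longleftrightarrow> n = m"
  by (simp add: exp_int_eq)

lemma bij_E_permutation:
  assumes "bij_betw f E E"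
  obtains \<sigma> :: "int \<Rightarrow> int" where "bij \<sigma>" "\<And>n. f (exp (of_int n)) = exp (of_int (\<sigma> n))"
proof -
  let ?e = "\<lambda>n::int. exp (of_int n :: complex)"
  have e: "bij_betw ?e UNIV E"
    by (auto simp: bij_betw_def E_def inj_on_def exp_int_inj)
  let ?\<sigma> = "inv_into UNIV ?e \<circ> (f \<circ> ?e)"
  have "bij ?\<sigma>"
    using bij_betw_trans[OF bij_betw_trans[OF e assms] bij_betw_inv_into[OF e]] by simp
  moreover have "f (?e n) = ?e (?\<sigma> n)" for n
  proof -
    have "f (?e n) \<in> E"
      using assms by (auto simp: bij_betw_def E_def)
    then show ?thesis
      using bij_betw_inv_into_right[OF e] by simp
  qed
  ultimately show thesis
    using that by blast
qed

text \<open>Consecutive points of \<open>E\<close> have ratio \<open>e\<close>, so a distance is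
  comparable to the larger of its two points. Metric conditions on \<open>f\<close> thereby become
  inequalities between maxima of exponents.\<close>

lemma exp_int_dist:
  fixes n m :: int
  shows "cmod (exp (of_int n) - exp (of_int m)) \<le> exp (of_int (max n m))"
    and "n \<noteq> m \<Longrightarrow> (1 - exp (-1)) * exp (of_int (max n m)) \<le> cmod (exp (of_int n) - exp (of_int m))"
proof -
  have *: "cmod (exp (of_int n) - exp (of_int m)) = \<bar>exp (real_of_int n) - exp (real_of_int m)\<bar>"
    by (simp add: exp_int_eq flip: of_real_diff)
  show "cmod (exp (of_int n) - exp (of_int m)) \<le> exp (of_int (max n m))"
    unfolding * by (auto simp: max_def abs_if)
  have **: "(1 - exp (-1)) * exp (real_of_int b) \<le> exp (real_of_int b) - exp (real_of_int a)" if "a < b" for a b :: int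
  proof -
    have "exp (real_of_int a) \<le> exp (-1 + real_of_int b)"
      using that by simp
    then show ?thesis
      by (simp only: exp_add algebra_simps)
  qed
  show "(1 - exp (-1)) * exp (of_int (max n m)) \<le> cmod (exp (of_int n) - exp (of_int m))" if "n \<noteq> m"
    unfolding * using **[of n m] **[of m n] that by (cases "n < m") (auto simp: max_def abs_if)
qed

section \<open>Permutations that are increasing up to a bounded error\<close>

definition almost_increasing :: "int \<Rightarrow> (int \<Rightarrow> int) \<Rightarrow> bool" where
  "almost_increasing C \<sigma> \<longleftrightarrow> (\<forall>m k. m < k \<longrightarrow> \<sigma> m \<le> \<sigma> k + C)"

text \<open>As \<open>n\<close> tends to minus infinity, \<open>b n\<close> vanishes and the three
  point condition turns into a bound of the modulus of \<open>b m\<close> by \<open>L\<close> times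
  that of \<open>b k\<close>. The logarithm of this is the claim.\<close>

lemma three_point_imp_almost_increasing:
  assumes L: "1 \<le> L" and v: "vanishing_three_point L f"
    and \<sigma>: "bij \<sigma>" "\<And>n. f (exp (of_int n)) = exp (of_int (\<sigma> n))"
  shows "almost_increasing \<lceil>ln L\<rceil> \<sigma>"
  unfolding almost_increasing_def
proof (intro allI impI)
  fix m k :: int assume "m < k"
  define b where "b n = f (exp (of_int n))" for n :: int
  have b0: "(b \<longlongrightarrow> 0) at_bot" and tp: "three_point_condition L b"
    using v by (simp_all add: vanishing_three_point_def b_def[abs_def])
  have "cmod (b n - b m) \<le> L * cmod (b n - b k)" if "n < m" for n
  proof -
    have "cmod ((b n - b m) / (b n - b k)) \<le> L"
      using tp that \<open>m < k\<close> by (auto simp: three_point_condition_def)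
    moreover have "b n \<noteq> b k"
      using \<sigma> that \<open>m < k\<close> by (simp add: b_def exp_int_inj bij_def inj_eq)
    ultimately show ?thesis
      by (simp add: norm_divide divide_simps split: if_splits)
  qed
  then have ev: "\<forall>\<^sub>F n in at_bot. cmod (b n - b m) \<le> L * cmod (b n - b k)"
    unfolding eventually_at_bot_dense by blast
  have "cmod (0 - b m) \<le> L * cmod (0 - b k)"
    by (rule tendsto_le[OF _ _ _ ev]) (intro tendsto_intros b0 trivial_limit_at_bot_linorder)+
  then have "exp (real_of_int (\<sigma> m)) \<le> L * exp (real_of_int (\<sigma> k))"
    by (simp add: b_def \<sigma> norm_exp_eq_Re)
  also have "\<dots> = exp (ln L + real_of_int (\<sigma> k))"
    using L by (simp add: exp_add)
  finally have "real_of_int (\<sigma> m) \<le> ln L + real_of_int (\<sigma> k)"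
    by simp
  then show "\<sigma> m \<le> \<sigma> k + \<lceil>ln L\<rceil>"
    by linarith
qed

text \<open>Two counts. The image of \<open>{n..<k}\<close> lies between
  \<open>\<sigma> n - C\<close> and \<open>\<sigma> k + C\<close>, which bounds \<open>k - n\<close>
  from above; and every integer strictly between \<open>\<sigma> n + C\<close> and
  \<open>\<sigma> k - C\<close> has its preimage in \<open>{n..k}\<close>, which bounds
  \<open>k - n\<close> from below. One of the two points is then taken to be 0.\<close>

lemma almost_increasing_displacement:
  assumes \<sigma>: "bij \<sigma>" and C: "almost_increasing C \<sigma>" "0 \<le> C"
  shows "\<bar>\<sigma> n - n - \<sigma> 0\<bar> \<le> 2 * C + 2"
proof -
  have *: "\<bar>(\<sigma> k - \<sigma> n) - (k - n)\<bar> \<le> 2 * C + 2" if "n < k" for n k :: int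
  proof -
    have m: "\<sigma> i \<le> \<sigma> j + C" if "i \<le> j" for i j
      using C that unfolding almost_increasing_def by (cases "i = j") auto
    have "card (\<sigma> ` {n..<k}) \<le> card {\<sigma> n - C..\<sigma> k + C}"
      using m \<open>n < k\<close> by (intro card_mono) (auto simp: algebra_simps)
    then have "nat (k - n) \<le> nat (\<sigma> k + C - (\<sigma> n - C) + 1)"
      using \<sigma> by (subst (asm) card_image) (auto simp: bij_def intro: inj_on_subset)
    then have 1: "k - n \<le> \<sigma> k - \<sigma> n + 2 * C + 1"
      using \<open>n < k\<close> by linarith
    have "{\<sigma> n + C<..<\<sigma> k - C} \<subseteq> \<sigma> ` {n..k}"
    proof
      fix j assume j: "j \<in> {\<sigma> n + C<..<\<sigma> k - C}"
      obtain i where i: "j = \<sigma> i"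
        using \<sigma> by (metis bij_pointE)
      have "n \<le> i" "i \<le> k"
        using m[of i n] m[of k i] j i by force+
      then show "j \<in> \<sigma> ` {n..k}"
        using i by auto
    qed
    then have "card {\<sigma> n + C<..<\<sigma> k - C} \<le> card (\<sigma> ` {n..k})"
      by (intro card_mono) auto
    also have "\<dots> \<le> card {n..k}"
      by (rule card_image_le) auto
    finally have 2: "\<sigma> k - \<sigma> n - 2 * C - 1 \<le> k - n + 1"
      using \<open>n < k\<close> by simp
    from 1 2 show ?thesis
      by linarith
  qed
  show ?thesis
    using *[of 0 n] *[of n 0] C(2) by (cases n "0::int" rule: linorder_cases) simp_all
qed

lemma displacement_imp_quasisymmetric:
  fixes D t :: int
  assumes \<sigma>: "bij \<sigma>" "\<And>n. f (exp (of_int n)) = exp (of_int (\<sigma> n))"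
    and D: "\<And>n. \<bar>\<sigma> n - n - t\<bar> \<le> D"
  shows "quasisymmetric_on (\<lambda>s. exp (2 * of_int D) / (1 - exp (-1))^2 * s) E f"
proof -
  let ?b = "\<lambda>n::int. exp (of_int (\<sigma> n)) :: complex" and ?e = "\<lambda>n::int. exp (of_int n) :: complex"
  define c where "c = 1 - exp (-1::real)"
  have c: "c > 0"
    by (simp add: c_def)
  have inj: "?b n = ?b m \<longleftrightarrow> n = m" for n m
    using \<sigma> by (simp add: exp_int_inj bij_def inj_eq)
  have main: "cmod ((?b n - ?b m) / (?b n - ?b k)) \<le> exp (2 * of_int D) / c^2 * cmod ((?e n - ?e m) / (?e n - ?e k))"
    if "n \<noteq> k" for n m k
  proof (cases "n = m")
    case False
    let ?A = "cmod (?b n - ?b m)" and ?B = "cmod (?b n - ?b k)" and ?P = "cmod (?e n - ?e m)" and ?Q = "cmod (?e n - ?e k)"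
    have A: "?A \<le> exp (real_of_int (max (\<sigma> n) (\<sigma> m)))" "?Q \<le> exp (real_of_int (max n k))"
      by (rule exp_int_dist(1))+
    have B: "c * exp (real_of_int (max (\<sigma> n) (\<sigma> k))) \<le> ?B" "c * exp (real_of_int (max n m)) \<le> ?P"
      using exp_int_dist(2) \<open>n \<noteq> k\<close> False inj c_def \<sigma> by (metis bij_def inj_eq)+
    \<comment> \<open>Up to the common shift \<open>t\<close>, which cancels,
      \<open>\<sigma>\<close> changes a maximum by at most \<open>D\<close>. It is removed from one
      maximum and introduced into another, whence \<open>2 * D\<close>; the two lower distance
      bounds account for the square of \<open>1 - exp (-1)\<close>.\<close>
    have "real_of_int (max (\<sigma> n) (\<sigma> m)) + of_int (max n k) \<le> 2 * of_int D + of_int (max n m) + of_int (max (\<sigma> n) (\<sigma> k))"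
      using D[of n] D[of m] D[of k] by linarith
    then have x: "exp (real_of_int (max (\<sigma> n) (\<sigma> m))) * exp (of_int (max n k))
        \<le> exp (2 * of_int D) * (exp (of_int (max n m)) * exp (of_int (max (\<sigma> n) (\<sigma> k))))"
      by (simp add: mult_exp_exp add.assoc del: of_int_max)
    have "?A * ?Q \<le> exp (real_of_int (max (\<sigma> n) (\<sigma> m))) * exp (of_int (max n k))"
      by (intro mult_mono A) auto
    also note x
    also have "exp (2 * of_int D) * (exp (of_int (max n m)) * exp (of_int (max (\<sigma> n) (\<sigma> k))))
      \<le> exp (2 * of_int D) * ((?P / c) * (?B / c))"
      using B c by (intro mult_left_mono mult_mono) (auto simp: field_simps simp del: of_int_max)
    finally have "?A * ?Q \<le> exp (2 * of_int D) / c^2 * ?P * ?B"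
      by (simp add: power2_eq_square)
    moreover have "?B > 0" "?Q > 0"
      using that inj by (auto simp: exp_int_inj)
    moreover have "a / b \<le> r * (p / q)" if "a * q \<le> r * p * b" "b > 0" "q > 0" for a b r p q :: real
      using that by (simp add: field_simps)
    ultimately show ?thesis
      unfolding norm_divide by blast
  qed (use c in simp)
  have "inj_on f E"
    by (auto simp: inj_on_def E_def \<sigma> inj)
  moreover have "\<forall>x\<in>E. \<forall>y\<in>E. \<forall>z\<in>E. x \<noteq> z \<longrightarrow> cmod ((f x - f y) / (f x - f z)) \<le> exp (2 * of_int D) / c^2 * cmod ((x - y) / (x - z))"
    using main by (auto simp: E_def \<sigma> exp_int_inj)
  ultimately show ?thesis
    by (simp add: quasisymmetric_on_def c_def)
qed

section \<open>Quasisymmetry and the three point condition\<close>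

lemma linear_half_line_homeomorphism:
  assumes "c > 0" shows "half_line_homeomorphism (\<lambda>s. c * s)"
  unfolding half_line_homeomorphism_def homeomorphism_def
proof (intro exI conjI)
  show "(*) c ` {0..} = {0..}" "(\<lambda>s. s / c) ` {0..} = {0..}"
    using assms by (force intro: image_eqI[where x="_ / c"] image_eqI[where x="c * _"])+
qed (use assms in \<open>auto intro!: continuous_intros\<close>)

text \<open>A continuous injection of an interval is monotone, and a decreasing one would never
  exceed \<open>\<eta> 0\<close>, against surjectivity.\<close>

lemma half_line_homeomorphism_mono:
  assumes "half_line_homeomorphism \<eta>" "0 \<le> s" "s \<le> t"
  shows "\<eta> s \<le> \<eta> t"
proof -
  obtain \<zeta> where h: "homeomorphism {0..} {0..} \<eta> \<zeta>"
    using assms by (auto simp: half_line_homeomorphism_def)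
  have "monotone_on {0..} (\<le>) (\<le>) \<eta> \<or> monotone_on {0..} (\<le>) (\<ge>) \<eta>"
  proof -
    have "inj_on \<eta> {0..}" "continuous_on {0..} \<eta>"
      using h unfolding homeomorphism_def by (metis inj_on_inverseI)+
    then have "strict_mono_on {0..} \<eta> \<or> strict_antimono_on {0..} \<eta>"
      using injective_eq_monotone_map[of "{0..}" \<eta>] is_interval_ci by blast
    then show ?thesis
      using strict_mono_iff_mono strict_antimono_iff_antimono by blast
  qed
  moreover have "\<not> monotone_on {0..} (\<le>) (\<ge>) \<eta>"
  proof
    assume m: "monotone_on {0..} (\<le>) (\<ge>) \<eta>"
    have im: "\<eta> ` {0..} = {0..}"
      using h by (auto simp: homeomorphism_def)
    then have "\<eta> 0 + 1 \<in> \<eta> ` {0..}"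
      by (metis add_nonneg_nonneg atLeast_iff image_eqI order_refl zero_le_one)
    then obtain u where "u \<ge> 0" "\<eta> u = \<eta> 0 + 1"
      by auto
    then show False
      using m by (force simp: monotone_on_def)
  qed
  ultimately show ?thesis
    using assms by (auto simp: monotone_on_def)
qed

text \<open>By injectivity only finitely many arguments are sent into \<open>{Z..B}\<close>; to the
  left of these and of 0, the upper bound \<open>B\<close> leaves only values below
  \<open>Z\<close>.\<close>

lemma int_tendsto_at_bot_unbounded_below:
  fixes \<sigma> :: "int \<Rightarrow> int"
  assumes "\<And>n. n < 0 \<Longrightarrow> \<sigma> n \<le> B" "inj \<sigma>"
  shows "filterlim \<sigma> at_bot at_bot"
  unfolding filterlim_at_bot
proof
  fix Z :: int
  have "finite (\<sigma> -` {Z..B})"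
    using assms by (intro finite_vimageI) auto
  then obtain N where N: "\<And>n. n \<in> \<sigma> -` {Z..B} \<Longrightarrow> N \<le> n"
    by (meson bdd_below_finite bdd_below.unfold)
  show "\<forall>\<^sub>F x in at_bot. \<sigma> x \<le> Z"
    unfolding eventually_at_bot_dense
  proof (intro exI allI impI)
    fix n assume "n < min N 0"
    then show "\<sigma> n \<le> Z"
      using N[of n] assms(1)[of n] by force
  qed
qed

lemma exp_int_tendsto_0:
  assumes "filterlim \<sigma> at_bot F"
  shows "((\<lambda>n. exp (of_int (\<sigma> n :: int)) :: complex) \<longlongrightarrow> 0) F"
proof -
  have "filterlim (\<lambda>n. real_of_int (\<sigma> n)) at_bot F"
    unfolding filterlim_at_bot
  proof
    fix Z :: real
    have "\<forall>\<^sub>F n in F. \<sigma> n \<le> \<lfloor>Z\<rfloor>"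
      using assms by (simp add: filterlim_at_bot)
    then show "\<forall>\<^sub>F n in F. real_of_int (\<sigma> n) \<le> Z"
      by eventually_elim linarith
  qed
  then have "((\<lambda>n. exp (real_of_int (\<sigma> n))) \<longlongrightarrow> 0) F"
    by (rule filterlim_compose[OF exp_at_bot])
  then show ?thesis
    unfolding exp_int_eq using tendsto_of_real by force
qed

text \<open>Quasisymmetry is used only for triples with \<open>y\<close> at most as far from
  \<open>x\<close> as \<open>z\<close> is, where monotonicity bounds the distortion by
  \<open>\<eta> 1\<close>. Triples \<open>n < m < k\<close> are of this kind. The limit 0 follows
  once the values at negative exponents are bounded.\<close>

lemma quasisymmetric_imp_vanishing_three_point:
  assumes f: "bij_betw f E E" and \<eta>: "half_line_homeomorphism \<eta>" and q: "quasisymmetric_on \<eta> E f"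
  shows "vanishing_three_point (max 1 (\<eta> 1)) f"
proof -
  obtain \<sigma> where \<sigma>: "bij \<sigma>" "\<And>n. f (exp (of_int n)) = exp (of_int (\<sigma> n))"
    using bij_E_permutation[OF f] by blast
  let ?e = "\<lambda>n::int. exp (of_int n) :: complex"
  have *: "cmod (f (?e n) - f (?e m)) \<le> \<eta> 1 * cmod (f (?e n) - f (?e k))"
    and **: "cmod ((f (?e n) - f (?e m)) / (f (?e n) - f (?e k))) \<le> \<eta> 1"
    if "n \<noteq> k" "cmod (?e n - ?e m) \<le> cmod (?e n - ?e k)" for n m k
  proof -
    have "cmod ((f (?e n) - f (?e m)) / (f (?e n) - f (?e k))) \<le> \<eta> (cmod ((?e n - ?e m) / (?e n - ?e k)))"
      using q that unfolding quasisymmetric_on_def by (simp add: E_def exp_int_inj)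
    also have "\<dots> \<le> \<eta> 1"
      using that by (intro half_line_homeomorphism_mono[OF \<eta>]) (auto simp: norm_divide divide_simps)
    finally show "cmod ((f (?e n) - f (?e m)) / (f (?e n) - f (?e k))) \<le> \<eta> 1" .
    moreover have "f (?e n) \<noteq> f (?e k)"
      using \<sigma> that by (simp add: exp_int_inj bij_def inj_eq)
    ultimately show "cmod (f (?e n) - f (?e m)) \<le> \<eta> 1 * cmod (f (?e n) - f (?e k))"
      by (simp add: norm_divide divide_simps split: if_splits)
  qed
  have dist: "cmod (?e n - ?e m) = \<bar>exp (real_of_int n) - exp (real_of_int m)\<bar>" for n m
    by (simp add: exp_int_eq flip: of_real_diff)
  have "three_point_condition (max 1 (\<eta> 1)) (\<lambda>n. f (?e n))"
    unfolding three_point_condition_def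
  proof (intro allI impI)
    fix n m k :: int assume "n < m \<and> m < k"
    then have "cmod ((f (?e n) - f (?e m)) / (f (?e n) - f (?e k))) \<le> \<eta> 1"
      by (intro **) (auto simp: dist abs_if)
    then show "cmod ((f (?e n) - f (?e m)) / (f (?e n) - f (?e k))) \<le> max 1 (\<eta> 1)"
      by simp
  qed
  moreover have "filterlim \<sigma> at_bot at_bot"
  proof (rule int_tendsto_at_bot_unbounded_below)
    define R where "R = \<eta> 1 * cmod (f (?e 0) - f (?e 1)) + cmod (f (?e 0))"
    fix n :: int assume "n < 0"
    \<comment> \<open>Since \<open>exp 1\<close> is at least 2, the point 1 is no farther from
      \<open>exp n\<close> than from \<open>exp 1\<close>; so \<open>f (exp n)\<close> stays in a
      fixed disc around \<open>f 1\<close>.\<close>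
    have "1 - exp (real_of_int n) \<le> exp 1 - 1"
      using exp_ge_add_one_self[of 1] exp_gt_zero[of "real_of_int n"] by linarith
    then have "cmod (f (?e 0) - f (?e n)) \<le> \<eta> 1 * cmod (f (?e 0) - f (?e 1))"
      using \<open>n < 0\<close> by (intro *) (simp_all add: dist abs_if del: of_int_0 of_int_1, simp)
    moreover have "cmod (f (?e n)) \<le> cmod (f (?e 0) - f (?e n)) + cmod (f (?e 0))"
      using norm_triangle_ineq4[of "f (?e 0)" "f (?e 0) - f (?e n)"] by simp
    ultimately have "exp (real_of_int (\<sigma> n)) \<le> R"
      unfolding R_def by (simp add: \<sigma> norm_exp_eq_Re)
    then have "real_of_int (\<sigma> n) + 1 \<le> R"
      using exp_ge_add_one_self[of "real_of_int (\<sigma> n)"] by linarith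
    then show "\<sigma> n \<le> \<lceil>R\<rceil>"
      by linarith
  qed (use \<sigma> in \<open>simp add: bij_def\<close>)
  then have "((\<lambda>n. f (?e n)) \<longlongrightarrow> 0) at_bot"
    using exp_int_tendsto_0[of \<sigma>] by (simp add: \<sigma>)
  ultimately show ?thesis
    by (simp add: vanishing_three_point_def)
qed

lemma vanishing_three_point_imp_quasisymmetric:
  assumes "1 \<le> L" "bij_betw f E E" "vanishing_three_point L f"
  shows "quasisymmetric_on (\<lambda>s. exp (2 * of_int (2 * \<lceil>ln L\<rceil> + 2)) / (1 - exp (-1))^2 * s) E f"
proof -
  obtain \<sigma> where \<sigma>: "bij \<sigma>" "\<And>n. f (exp (of_int n)) = exp (of_int (\<sigma> n))"
    using bij_E_permutation[OF assms(2)] by blast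
  have "almost_increasing \<lceil>ln L\<rceil> \<sigma>"
    using three_point_imp_almost_increasing[OF assms(1,3) \<sigma>] .
  then show ?thesis
    using assms(1) ln_ge_zero[of L] \<sigma>(1)
    by (intro displacement_imp_quasisymmetric[OF \<sigma>, where t="\<sigma> 0"] almost_increasing_displacement) linarith+
qed

text \<open>The exponents \<open>\<sigma> n\<close> with \<open>n < 0\<close> are bounded by
  \<open>\<sigma> 0 + C\<close> and pairwise distinct, which forces the limit 0. In the quotient,
  \<open>exp C\<close> pays for passing from \<open>\<sigma> m\<close> to \<open>\<sigma> k\<close>,
  and \<open>1 - exp (-1)\<close> is the loss in the lower bound for the denominator.\<close>

lemma almost_increasing_imp_vanishing_three_point:
  assumes \<sigma>: "bij \<sigma>" "\<And>n. f (exp (of_int n)) = exp (of_int (\<sigma> n))"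
    and C: "almost_increasing C \<sigma>" "0 \<le> C"
  shows "vanishing_three_point (exp (of_int C) / (1 - exp (-1))) f"
proof -
  let ?b = "\<lambda>n::int. exp (of_int (\<sigma> n)) :: complex"
  have "filterlim \<sigma> at_bot at_bot"
    using C \<sigma> by (intro int_tendsto_at_bot_unbounded_below[where B="\<sigma> 0 + C"]) (auto simp: almost_increasing_def bij_def)
  then have "((\<lambda>n. f (exp (of_int n))) \<longlongrightarrow> 0) at_bot"
    using exp_int_tendsto_0[of \<sigma>] by (simp add: \<sigma>)
  moreover have "cmod ((?b n - ?b m) / (?b n - ?b k)) \<le> exp (of_int C) / (1 - exp (-1))"
    if "n < m" "m < k" for n m k
  proof -
    have "\<sigma> n \<noteq> \<sigma> k"
      using that \<sigma> by (auto simp: bij_def inj_eq)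
    then have 1: "(1 - exp (-1)) * exp (of_int (max (\<sigma> n) (\<sigma> k))) \<le> cmod (?b n - ?b k)"
      by (rule exp_int_dist)
    have "\<sigma> m \<le> \<sigma> k + C"
      using C that by (simp add: almost_increasing_def)
    then have "max (\<sigma> n) (\<sigma> m) \<le> C + max (\<sigma> n) (\<sigma> k)"
      using C by auto
    then have "exp (real_of_int (max (\<sigma> n) (\<sigma> m))) \<le> exp (of_int C) * exp (of_int (max (\<sigma> n) (\<sigma> k)))"
      by (simp add: mult_exp_exp del: of_int_max of_int_add flip: of_int_add)
    then have 2: "cmod (?b n - ?b m) \<le> exp (of_int C) * exp (of_int (max (\<sigma> n) (\<sigma> k)))"
      using exp_int_dist(1)[of "\<sigma> n" "\<sigma> m"] by linarith
    have "cmod ((?b n - ?b m) / (?b n - ?b k))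
      \<le> exp (of_int C) * exp (of_int (max (\<sigma> n) (\<sigma> k))) / ((1 - exp (-1)) * exp (of_int (max (\<sigma> n) (\<sigma> k))))"
      unfolding norm_divide by (intro frac_le 1 2) auto
    then show ?thesis
      by simp
  qed
  ultimately show ?thesis
    by (simp add: vanishing_three_point_def three_point_condition_def \<sigma>)
qed

section \<open>Twists and radial stretchings\<close>

text \<open>The cubic Hermite step. Its slope vanishes at 0 and 1, so pieces glued there stay
  differentiable, and the slope is at most 2 in between.\<close>

definition smoothstep :: "real \<Rightarrow> real" where
  "smoothstep t = (if t \<le> 0 then 0 else if t \<le> 1 then 3 * t^2 - 2 * t^3 else 1)"

lemma smoothstep_simps [simp]: "t \<le> 0 \<Longrightarrow> smoothstep t = 0" "1 \<le> t \<Longrightarrow> smoothstep t = 1"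
  by (auto simp: smoothstep_def)

lemma smoothstep_bounds: "0 \<le> smoothstep t" "smoothstep t \<le> 1"
proof -
  have *: "3 * t^2 - 2 * t^3 = t^2 * (3 - 2 * t)" "1 - (3 * t^2 - 2 * t^3) = (1 - t)^2 * (1 + 2 * t)"
    by algebra+
  then have "0 \<le> 3 * t^2 - 2 * t^3 \<and> 0 \<le> 1 - (3 * t^2 - 2 * t^3)" if "0 \<le> t" "t \<le> 1"
    unfolding * using that by auto
  then show "0 \<le> smoothstep t" "smoothstep t \<le> 1"
    by (auto simp: smoothstep_def)
qed

lemma smoothstep_has_derivative:
  "(smoothstep has_real_derivative (if t \<in> {0..1} then 6 * t - 6 * t^2 else 0)) (at t)"
proof -
  have un: "UNIV = {..a} \<union> {a..}" "UNIV = {a..} \<union> {..a}" for a :: real by auto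
  note vec = has_real_derivative_iff_has_vector_derivative
  have poly: "((\<lambda>t. 3 * t^2 - 2 * t^3) has_real_derivative 6 * t - 6 * t^2) (at t within A)" for t :: real and A
    by (auto intro!: derivative_eq_intros simp: power2_eq_square)
  have 1: "((\<lambda>t. if t \<in> {..1} then 3 * t^2 - 2 * t^3 else 1) has_real_derivative (if t \<in> {..1} then 6 * t - 6 * t^2 else 0)) (at t)" for t :: real
    using has_vector_derivative_If_within_closures[where S="{..1::real}" and T="{1..}" and u=UNIV and x=t
        and f="\<lambda>t. 3 * t^2 - 2 * t^3" and f'="\<lambda>t. 6 * t - 6 * t^2" and g="\<lambda>t. 1" and g'="\<lambda>t. 0"] poly[of t]
    unfolding vec by (auto simp: Un_absorb2 un[symmetric])
  have eq: "smoothstep = (\<lambda>t. if t \<in> {0..} then (if t \<in> {..1} then 3 * t^2 - 2 * t^3 else 1) else 0)"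
    by (auto simp: smoothstep_def fun_eq_iff)
  have "(smoothstep has_real_derivative (if t \<in> {0..} then (if t \<in> {..1} then 6 * t - 6 * t^2 else 0) else 0)) (at t)"
    using has_vector_derivative_If_within_closures[where S="{0::real..}" and T="{..0}" and u=UNIV and x=t
        and f="\<lambda>t. if t \<in> {..1} then 3 * t^2 - 2 * t^3 else 1" and f'="\<lambda>t. if t \<in> {..1} then 6 * t - 6 * t^2 else 0" and g="\<lambda>t. 0" and g'="\<lambda>t. 0"]
      has_vector_derivative_at_within[OF 1[of t, unfolded vec]]
    unfolding vec eq by (auto simp: Un_absorb2 un[symmetric])
  then show ?thesis
    by (auto split: if_splits)
qed

lemma smoothstep_derivative:
  obtains D where "(smoothstep has_real_derivative D) (at t)" "\<bar>D\<bar> \<le> 2" "t \<le> 0 \<or> 1 \<le> t \<Longrightarrow> D = 0"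
proof
  show "\<bar>if t \<in> {0..1} then 6 * t - 6 * t^2 else 0\<bar> \<le> 2"
  proof -
    have "6 * t - 6 * t^2 = 3/2 - 6 * (t - 1/2)^2"
      by (simp add: power2_eq_square algebra_simps)
    then have 1: "6 * t - 6 * t^2 \<le> 3/2"
      by (simp only: diff_le_eq le_add_same_cancel1) simp
    have "6 * t - 6 * t^2 = 6 * (t * (1 - t))"
      by (simp add: power2_eq_square algebra_simps)
    then have "0 \<le> 6 * t - 6 * t^2" if "t \<in> {0..1}"
      using that by (simp only: atLeastAtMost_iff) simp
    with 1 show ?thesis by auto
  qed
  show "(if t \<in> {0..1} then 6 * t - 6 * t^2 else 0) = 0" if "t \<le> 0 \<or> 1 \<le> t"
    using that by (cases "t = 0"; cases "t = 1") auto
qed (rule smoothstep_has_derivative)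

definition interpolate :: "(int \<Rightarrow> real) \<Rightarrow> real \<Rightarrow> real" where
  "interpolate v x = v \<lfloor>x\<rfloor> + (v (\<lfloor>x\<rfloor> + 1) - v \<lfloor>x\<rfloor>) * smoothstep (x - of_int \<lfloor>x\<rfloor>)"

lemma interpolate_of_int [simp]: "interpolate v (of_int n) = v n"
  by (simp add: interpolate_def)

lemma interpolate_bound:
  assumes "\<And>n. \<bar>v n\<bar> \<le> B" shows "\<bar>interpolate v x\<bar> \<le> B"
proof -
  define s where "s = smoothstep (x - of_int \<lfloor>x\<rfloor>)"
  have "\<bar>interpolate v x\<bar> = \<bar>(1 - s) * v \<lfloor>x\<rfloor> + s * v (\<lfloor>x\<rfloor> + 1)\<bar>"
    by (simp add: interpolate_def s_def algebra_simps)
  also have "\<dots> \<le> (1 - s) * \<bar>v \<lfloor>x\<rfloor>\<bar> + s * \<bar>v (\<lfloor>x\<rfloor> + 1)\<bar>"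
    using abs_triangle_ineq[of "(1 - s) * v \<lfloor>x\<rfloor>" "s * v (\<lfloor>x\<rfloor> + 1)"] smoothstep_bounds by (simp add: abs_mult s_def)
  also have "\<dots> \<le> (1 - s) * B + s * B"
    using smoothstep_bounds assms by (intro add_mono mult_left_mono) (auto simp: s_def)
  finally show ?thesis by (simp add: algebra_simps)
qed

lemma interpolate_derivative:
  assumes v: "\<And>n. \<bar>v (n + 1) - v n\<bar> \<le> L"
  obtains D where "(interpolate v has_real_derivative D) (at x)" "\<bar>D\<bar> \<le> 2 * L"
proof -
  define k where "k = \<lfloor>x\<rfloor>"
  \<comment> \<open>The formula of \<open>interpolate\<close> changes at the integer
    \<open>k\<close>, which may be \<open>x\<close> itself. \<open>P\<close> is a single
    differentiable expression that agrees with it on both sides of \<open>k\<close>; at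
    \<open>x\<close> its first step is already complete and contributes slope 0.\<close>
  define P where "P y = v (k - 1) + (v k - v (k - 1)) * smoothstep (y - of_int (k - 1))
    + (v (k + 1) - v k) * smoothstep (y - of_int k)" for y
  have k: "of_int k \<le> x" "x < of_int k + 1"
    by (auto simp: k_def)
  have eq: "interpolate v y = P y" if "y \<in> {of_int (k - 1)<..<of_int (k + 1)}" for y
  proof -
    have "\<lfloor>y\<rfloor> = k - 1 \<and> y \<le> of_int k \<or> \<lfloor>y\<rfloor> = k \<and> of_int k \<le> y"
      using that by (simp add: floor_eq_iff) linarith
    then show ?thesis
      by (auto simp: interpolate_def P_def)
  qed
  obtain D1 where D1: "(smoothstep has_real_derivative D1) (at (x - of_int (k - 1)))" "D1 = 0"
    using smoothstep_derivative[of "x - of_int (k - 1)"] k by force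
  obtain D2 where D2: "(smoothstep has_real_derivative D2) (at (x - of_int k))" "\<bar>D2\<bar> \<le> 2"
    using smoothstep_derivative by metis
  have sh: "((\<lambda>y. smoothstep (y - c)) has_real_derivative D) (at x)"
    if "(smoothstep has_real_derivative D) (at (x - c))" for c D
  proof -
    have "((\<lambda>y. y - c) has_real_derivative 1) (at x)"
      by (auto intro!: derivative_eq_intros)
    from DERIV_chain2[where g="\<lambda>y. y - c" and x=x and s=UNIV, OF that this] show ?thesis
      by simp
  qed
  have "(P has_real_derivative (v (k + 1) - v k) * D2) (at x)"
    unfolding P_def using D1 D2 by (auto intro!: derivative_eq_intros sh)
  then have "(interpolate v has_real_derivative (v (k + 1) - v k) * D2) (at x)"
    by (rule has_field_derivative_transform_within_open[of _ _ _ "{of_int (k - 1)<..<of_int (k + 1)}"])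
       (use k eq in auto)
  moreover have "\<bar>(v (k + 1) - v k) * D2\<bar> \<le> L * 2"
    unfolding abs_mult by (intro mult_mono v D2) (use v[of k] in auto)
  ultimately show thesis
    using that by simp
qed

text \<open>\<open>K\<close> bounds the dilatation of the derivative at \<open>z\<close>, and \<open>M\<close> its operator norm.\<close>

definition qc_differentiable :: "real \<Rightarrow> real \<Rightarrow> (complex \<Rightarrow> complex) \<Rightarrow> complex \<Rightarrow> bool" where
  "qc_differentiable K M F z \<longleftrightarrow> (\<exists>p q. (F has_derivative (\<lambda>h. p * h + q * cnj h)) (at z) \<and>
     cmod q < cmod p \<and> cmod p + cmod q \<le> K * (cmod p - cmod q) \<and> cmod p + cmod q \<le> M)"

section \<open>Dilatation under composition and in logarithmic coordinates\<close>

text \<open>The quotient \<open>(p + q) / (p - q)\<close> equals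
  \<open>(p + q)^2 / (p^2 - q^2)\<close>, squared operator norm over Jacobian. So an upper bound
  \<open>S\<close> of the former and a lower bound \<open>d\<close> of the latter suffice.\<close>

lemma qc_dilatation_bound:
  fixes p q d S :: real
  assumes "0 \<le> p" "0 \<le> q" "d \<le> p^2 - q^2" "0 < d" "p + q \<le> S"
  shows "q < p" "p + q \<le> (S^2 / d) * (p - q)"
proof -
  have e: "p^2 - q^2 = (p + q) * (p - q)"
    by (simp add: power2_eq_square algebra_simps)
  have pos: "(p + q) * (p - q) > 0"
    using assms e by simp
  then show "q < p"
    using assms by (simp add: zero_less_mult_iff)
  then have "p + q > 0"
    using assms by linarith
  have "d * (p + q) \<le> (p + q) * (p - q) * (p + q)"
    using assms e \<open>p + q > 0\<close> by (intro mult_right_mono) auto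
  also have "\<dots> = (p + q)^2 * (p - q)"
    by (simp add: power2_eq_square)
  also have "\<dots> \<le> S^2 * (p - q)"
    using assms \<open>q < p\<close> by (intro mult_right_mono power_mono) auto
  finally show "p + q \<le> (S^2 / d) * (p - q)"
    using assms by (simp add: field_simps)
qed

text \<open>Operator norms are submultiplicative and Jacobians multiplicative, hence the dilatation,
  their quotient in the sense of \<open>qc_dilatation_bound\<close>, is submultiplicative.\<close>

lemma qc_differentiable_compose:
  assumes F: "qc_differentiable K M F z" and G: "qc_differentiable K' M' G (F z)"
  shows "qc_differentiable (K' * K) (M' * M) (\<lambda>z. G (F z)) z"
proof -
  obtain p q where F: "(F has_derivative (\<lambda>h. p * h + q * cnj h)) (at z)"
    and pq: "cmod q < cmod p" "cmod p + cmod q \<le> K * (cmod p - cmod q)" "cmod p + cmod q \<le> M"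
    using F by (auto simp: qc_differentiable_def)
  obtain p' q' where G: "(G has_derivative (\<lambda>h. p' * h + q' * cnj h)) (at (F z))"
    and pq': "cmod q' < cmod p'" "cmod p' + cmod q' \<le> K' * (cmod p' - cmod q')" "cmod p' + cmod q' \<le> M'"
    using G by (auto simp: qc_differentiable_def)
  define P where "P = p' * p + q' * cnj q"
  define Q where "Q = p' * q + q' * cnj p"
  have "((\<lambda>z. G (F z)) has_derivative (\<lambda>h. p' * (p * h + q * cnj h) + q' * cnj (p * h + q * cnj h))) (at z)"
    by (rule has_derivative_compose[OF F G])
  also have "(\<lambda>h. p' * (p * h + q * cnj h) + q' * cnj (p * h + q * cnj h)) = (\<lambda>h. P * h + Q * cnj h)"
    by (simp add: P_def Q_def algebra_simps)
  finally have D: "((\<lambda>z. G (F z)) has_derivative (\<lambda>h. P * h + Q * cnj h)) (at z)" .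
  have sum: "cmod P + cmod Q \<le> (cmod p' + cmod q') * (cmod p + cmod q)"
  proof -
    have "cmod P \<le> cmod p' * cmod p + cmod q' * cmod q" "cmod Q \<le> cmod p' * cmod q + cmod q' * cmod p"
      using norm_triangle_ineq[of "p' * p" "q' * cnj q"] norm_triangle_ineq[of "p' * q" "q' * cnj p"]
      by (auto simp: P_def Q_def norm_mult)
    then show ?thesis by (simp add: algebra_simps)
  qed
  have det: "(cmod P)^2 - (cmod Q)^2 = ((cmod p')^2 - (cmod q')^2) * ((cmod p)^2 - (cmod q)^2)"
    unfolding P_def Q_def cmod_power2 by (simp add: power2_eq_square algebra_simps)
  define s t where "s = cmod p + cmod q" and "t = cmod p' + cmod q'"
  define s1 t1 where "s1 = cmod p - cmod q" and "t1 = cmod p' - cmod q'"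
  have st: "s \<le> K * s1" "t \<le> K' * t1" "s1 > 0" "t1 > 0" "s > 0" "t > 0" "s \<le> M" "t \<le> M'"
    using pq pq' norm_ge_zero[of q] norm_ge_zero[of q'] unfolding s_def s1_def t_def t1_def by linarith+
  have det': "(cmod P)^2 - (cmod Q)^2 = (t * t1) * (s * s1)"
    unfolding det s_def t_def s1_def t1_def by (simp add: power2_eq_square algebra_simps)
  have "cmod P + cmod Q \<le> t * s"
    using sum by (simp add: s_def t_def)
  from qc_dilatation_bound[OF norm_ge_zero norm_ge_zero eq_refl[OF det'[symmetric]] _ this]
  have "cmod Q < cmod P" and le: "cmod P + cmod Q \<le> ((t * s)^2 / ((t * t1) * (s * s1))) * (cmod P - cmod Q)"
    using st by auto
  note le
  also have "(t * s)^2 / ((t * t1) * (s * s1)) = (t / t1) * (s / s1)"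
    using st by (simp add: power2_eq_square field_simps)
  also have "(t / t1) * (s / s1) * (cmod P - cmod Q) \<le> K' * K * (cmod P - cmod Q)"
  proof (intro mult_right_mono mult_mono)
    show "t / t1 \<le> K'" "s / s1 \<le> K"
      using st by (auto simp: pos_divide_le_eq)
    then show "0 \<le> K'"
      using st divide_nonneg_pos[of t t1] by linarith
  qed (use st \<open>cmod Q < cmod P\<close> in auto)
  finally have "cmod P + cmod Q \<le> K' * K * (cmod P - cmod Q)" .
  moreover have "cmod P + cmod Q \<le> M' * M"
    using sum st mult_mono[of t M' s M] by (simp add: s_def t_def)
  ultimately show ?thesis
    using D \<open>cmod Q < cmod P\<close> unfolding qc_differentiable_def by blast
qed

text \<open>In the coordinate log z the map is translation by \<open>\<psi>\<close>, and
  \<open>\<alpha>\<close>, \<open>\<beta>\<close> are the partial derivatives of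
  \<open>\<psi>\<close> along the real and the imaginary part of log z. The two Wirtinger
  derivatives there are the numbers \<open>p\<close> and \<open>q\<close> of the proof, and
  \<open>d\<close> bounds the Jacobian from below. Returning to z multiplies them by factors of
  equal modulus and leaves their ratio alone.\<close>

lemma qc_differentiable_mult_exp:
  assumes z: "z \<noteq> 0" and \<psi>: "(\<psi> has_derivative (\<lambda>h. \<alpha> * of_real (Re (h / z)) + \<beta> * of_real (Im (h / z)))) (at z)"
    and B: "Re (\<psi> z) \<le> B" "cmod \<alpha> + cmod \<beta> \<le> A"
    and d: "d \<le> (cmod (1 + (\<alpha> - \<i> * \<beta>) / 2))^2 - (cmod ((\<alpha> + \<i> * \<beta>) / 2))^2" "0 < d"
  shows "qc_differentiable ((1 + A)^2 / d) (exp B * (1 + A)) (\<lambda>z. z * exp (\<psi> z)) z"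
proof -
  define p where "p = 1 + (\<alpha> - \<i> * \<beta>) / 2"
  define q where "q = (\<alpha> + \<i> * \<beta>) / 2"
  have "((\<lambda>z. z * exp (\<psi> z)) has_derivative (\<lambda>h. z * (exp (\<psi> z) * (\<alpha> * of_real (Re (h / z)) + \<beta> * of_real (Im (h / z)))) + h * exp (\<psi> z))) (at z)"
    by (intro has_derivative_mult has_derivative_ident has_derivative_compose[OF \<psi>] has_derivative_compose[OF \<psi>]) 
       (metis DERIV_exp has_field_derivative_def)
  moreover have "z * (exp (\<psi> z) * (\<alpha> * of_real (Re (h / z)) + \<beta> * of_real (Im (h / z)))) + h * exp (\<psi> z)
     = exp (\<psi> z) * p * h + exp (\<psi> z) * (z / cnj z) * q * cnj h" for h
  proof -
    define k where "k = h / z"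
    have h: "h = z * k" "cnj h = cnj z * cnj k"
      using z by (simp_all add: k_def)
    have re: "of_real (Re k) = (k + cnj k) / 2" "of_real (Im k) = - \<i> * (k - cnj k) / 2"
      by (simp_all add: complex_eq_iff)
    have "z / cnj z * (cnj z * cnj k) = z * cnj k"
      using z by simp
    moreover have "z * (exp (\<psi> z) * (\<alpha> * of_real (Re k) + \<beta> * of_real (Im k))) + z * k * exp (\<psi> z)
      = exp (\<psi> z) * p * (z * k) + exp (\<psi> z) * q * (z * cnj k)"
      unfolding re p_def q_def by (simp add: field_simps)
    ultimately show ?thesis
      unfolding k_def[symmetric] unfolding h by (simp only: mult.assoc) (simp add: algebra_simps)
  qed
  ultimately have D: "((\<lambda>z. z * exp (\<psi> z)) has_derivative (\<lambda>h. exp (\<psi> z) * p * h + exp (\<psi> z) * (z / cnj z) * q * cnj h)) (at z)"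
    by simp
  define e where "e = cmod (exp (\<psi> z))"
  have e: "e > 0" "e \<le> exp B"
    using B by (auto simp: e_def norm_exp_eq_Re)
  have n: "cmod (exp (\<psi> z) * p) = e * cmod p" "cmod (exp (\<psi> z) * (z / cnj z) * q) = e * cmod q"
    using z by (auto simp: e_def norm_mult norm_divide)
  have "2 * cmod p \<le> 2 + (cmod \<alpha> + cmod \<beta>)" "2 * cmod q \<le> cmod \<alpha> + cmod \<beta>"
    using norm_triangle_ineq[of 1 "(\<alpha> - \<i> * \<beta>) / 2"] norm_triangle_ineq4[of \<alpha> "\<i> * \<beta>"] norm_triangle_ineq[of \<alpha> "\<i> * \<beta>"]
    unfolding p_def q_def norm_divide norm_mult by simp_all
  then have S: "cmod p + cmod q \<le> 1 + A"
    using B by linarith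
  have pq: "cmod q < cmod p" "cmod p + cmod q \<le> ((1 + A)^2 / d) * (cmod p - cmod q)"
    using qc_dilatation_bound[OF norm_ge_zero norm_ge_zero d[folded p_def q_def] S] by auto
  have "e * cmod p + e * cmod q \<le> ((1 + A)^2 / d) * (e * cmod p - e * cmod q)"
    using mult_left_mono[OF pq(2), of e] e by (simp add: algebra_simps)
  moreover have "e * cmod p + e * cmod q \<le> exp B * (1 + A)"
    using mult_mono[OF e(2) S] e by (simp add: algebra_simps)
  moreover have "e * cmod q < e * cmod p"
    using e pq by simp
  ultimately show ?thesis
    unfolding qc_differentiable_def using D unfolding n[symmetric] by blast
qed

lemma has_derivative_ln_cmod:
  assumes "z \<noteq> 0" shows "((\<lambda>z. ln (cmod z)) has_derivative (\<lambda>h. Re (h / z))) (at z)"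
proof -
  have "((\<lambda>z. ln (cmod z)) has_derivative (\<lambda>h. inverse (cmod z) * (h \<bullet> sgn z))) (at z)"
    using assms has_derivative_compose[OF has_derivative_norm[OF assms], of ln "(*) (inverse (cmod z))"]
      DERIV_ln[of "cmod z"] by (simp add: has_field_derivative_def)
  moreover have "inverse (cmod z) * (h \<bullet> sgn z) = Re (h / z)" for h
  proof -
    have "inverse (cmod z) * (h \<bullet> sgn z) = (Re h * Re z + Im h * Im z) / (cmod z)^2"
      using assms by (simp add: inner_complex_def sgn_eq power2_eq_square divide_simps)
    then show ?thesis
      by (simp add: Re_divide cmod_power2)
  qed
  ultimately show ?thesis by simp
qed

text \<open>The direction is the exponential of i times the argument, whose derivative is the
  imaginary part of \<open>h / z\<close>. Writing it as \<open>z * exp (- ln (cmod z))\<close>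
  avoids a choice of branch.\<close>

lemma has_derivative_sgn_complex:
  assumes "z \<noteq> 0" shows "((\<lambda>z::complex. sgn z) has_derivative (\<lambda>h. \<i> * sgn z * of_real (Im (h / z)))) (at z)"
proof -
  have eq: "sgn w = w * exp (- of_real (ln (cmod w)))" if "w \<in> - {0}" for w :: complex
    using that by (simp add: sgn_eq exp_minus exp_of_real divide_inverse)
  have "((\<lambda>z. exp (- complex_of_real (ln (cmod z)))) has_derivative (\<lambda>h. exp (- of_real (ln (cmod z))) * (- of_real (Re (h / z))))) (at z)"
    by (rule has_derivative_compose[of _ "\<lambda>h. - complex_of_real (Re (h / z))"])
       (auto intro!: has_derivative_minus has_derivative_of_real has_derivative_ln_cmod assms simp flip: has_field_derivative_def)
  from has_derivative_mult[OF has_derivative_ident this]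
  have "((\<lambda>z. z * exp (- complex_of_real (ln (cmod z)))) has_derivative (\<lambda>h. z * (exp (- of_real (ln (cmod z))) * (- of_real (Re (h / z)))) + h * exp (- of_real (ln (cmod z))))) (at z)" .
  moreover have "z * (exp (- of_real (ln (cmod z))) * (- of_real (Re (h / z)))) + h * exp (- of_real (ln (cmod z))) = \<i> * sgn z * of_real (Im (h / z))" for h
  proof -
    have "h = z * (of_real (Re (h / z)) + \<i> * of_real (Im (h / z)))"
      using assms by (simp flip: complex_eq)
    then have "z * (exp (- of_real (ln (cmod z))) * (- of_real (Re (h / z)))) + h * exp (- of_real (ln (cmod z)))
      = z * (exp (- of_real (ln (cmod z))) * (- of_real (Re (h / z)))) + z * (of_real (Re (h / z)) + \<i> * of_real (Im (h / z))) * exp (- of_real (ln (cmod z)))"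
      by simp
    also have "\<dots> = \<i> * (z * exp (- of_real (ln (cmod z)))) * of_real (Im (h / z))"
      by (simp add: algebra_simps)
    finally show ?thesis
      using eq[of z] assms by simp
  qed
  ultimately have "((\<lambda>z. z * exp (- complex_of_real (ln (cmod z)))) has_derivative (\<lambda>h. \<i> * sgn z * of_real (Im (h / z)))) (at z)"
    by simp
  then show ?thesis
    by (rule has_derivative_transform_within_open[of _ _ _ _ "- {0}"]) (use assms eq in auto)
qed

section \<open>Integration by parts for maps differentiable off the origin\<close>

text \<open>A nondegenerate segment meets the origin at most once, and the fundamental theorem of
  calculus tolerates finitely many exceptional parameters for a continuous function.\<close>

lemma lipschitz_off_origin:
  fixes f :: "'a::real_normed_vector \<Rightarrow> 'b::banach"
  assumes cont: "continuous_on UNIV f" and M: "0 \<le> M"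
    and der: "\<And>z. z \<noteq> 0 \<Longrightarrow> (f has_derivative D z) (at z)" "\<And>z h. z \<noteq> 0 \<Longrightarrow> norm (D z h) \<le> M * norm h"
  shows "norm (f a - f b) \<le> M * norm (a - b)"
proof (cases "a = b")
  case False
  define p where "p t = b + t *\<^sub>R (a - b)" for t :: real
  define S where "S = {t. p t = 0}"
  have "s = t" if "s \<in> S" "t \<in> S" for s t
  proof -
    have "(s - t) *\<^sub>R (a - b) = 0"
      using that unfolding S_def p_def mem_Collect_eq scaleR_left_diff_distrib by (metis add_left_cancel eq_iff_diff_eq_0)
    then show ?thesis using False by simp
  qed
  then have "S \<subseteq> {SOME t. t \<in> S}"
    by (metis singletonI someI subsetI)
  then have fin: "finite S"
    using finite_subset by blast
  define f' where "f' t = (if t \<in> S then 0 else D (p t) (a - b))" for t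
  have "((\<lambda>t. f (p t)) has_vector_derivative f' t) (at t)" if "t \<in> {0<..<1} - S" for t
  proof -
    have "p t \<noteq> 0" "t \<notin> S"
      using that by (auto simp: S_def)
    moreover have "(p has_vector_derivative (a - b)) (at t)"
      unfolding p_def by (auto intro!: derivative_eq_intros)
    ultimately show ?thesis
      using vector_derivative_diff_chain_within[of p "a - b" t UNIV f "D (p t)"] der(1)[of "p t"]
      by (auto simp: f'_def o_def intro: has_derivative_at_withinI)
  qed
  moreover have "continuous_on {0..1} (\<lambda>t. f (p t))"
    by (rule continuous_on_compose2[OF cont]) (auto simp: p_def intro!: continuous_intros)
  ultimately have "(f' has_integral (f (p 1) - f (p 0))) {0..1}"
    by (intro fundamental_theorem_of_calculus_interior_strong[OF fin]) auto
  then have "norm (f (p 1) - f (p 0)) \<le> (M * norm (a - b)) * measure lborel (cbox (0::real) 1)"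
    using M by (intro has_integral_bound[where f=f']) (auto simp: f'_def S_def der)
  then show ?thesis
    by (simp add: p_def)
qed simp

lemma integrable_bounded_support:
  fixes g :: "'a::euclidean_space \<Rightarrow> 'b::{banach, second_countable_topology}"
  assumes "g \<in> borel_measurable lborel" "\<And>z. norm (g z) \<le> B" "\<And>z. z \<notin> cball 0 R \<Longrightarrow> g z = 0"
  shows "integrable lborel g"
proof (rule Bochner_Integration.integrable_bound)
  show "integrable lborel (\<lambda>z. indicator (cball (0::'a) R) z * B)"
    using emeasure_compact_finite[of "cball (0::'a) R"] by (simp add: integrable_indicator_iff top.not_eq_extremum)
  show "AE z in lborel. norm (g z) \<le> norm (indicator (cball 0 R) z * B)"
  proof (rule AE_I2)
    show "norm (g z) \<le> norm (indicator (cball 0 R) z * B)" for z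
      using assms(2,3)[of z] by (cases "z \<in> cball 0 R") auto
  qed
qed fact

lemma integral_translate:
  fixes u :: "'a::euclidean_space \<Rightarrow> 'b::{banach, second_countable_topology}"
  assumes "u \<in> borel_measurable borel"
  shows "(\<integral>z. u (c + z) \<partial>lborel) = (\<integral>z. u z \<partial>lborel)"
proof -
  have "(\<integral>z. u z \<partial>lborel) = (\<integral>z. u z \<partial>distr lborel borel ((+) c))"
    by (simp add: lborel_distr_plus)
  also have "\<dots> = (\<integral>z. u (c + z) \<partial>lborel)"
    by (rule integral_distr) (use assms in auto)
  finally show ?thesis by simp
qed

lemma measurable_derivative_off_origin:
  fixes u :: "'a::euclidean_space \<Rightarrow> 'b::euclidean_space"
  assumes cont: "continuous_on UNIV u"
    and der: "\<And>z. z \<noteq> 0 \<Longrightarrow> (u has_derivative D z) (at z)"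
  shows "(\<lambda>z. if z = 0 then 0 else D z v) \<in> borel_measurable borel"
    and "z \<noteq> 0 \<Longrightarrow> (\<lambda>n. real (Suc n) *\<^sub>R (u ((1 / real (Suc n)) *\<^sub>R v + z) - u z)) \<longlonglongrightarrow> D z v"
proof -
  let ?s = "\<lambda>n z. real (Suc n) *\<^sub>R (u ((1 / real (Suc n)) *\<^sub>R v + z) - u z)"
  show lim: "(\<lambda>n. ?s n z) \<longlonglongrightarrow> D z v" if "z \<noteq> 0" for z
  proof -
    have "((\<lambda>t. u (z + t *\<^sub>R v)) has_vector_derivative D z v) (at 0)"
    proof -
      have "((\<lambda>t. z + t *\<^sub>R v) has_vector_derivative v) (at 0)"
        by (auto intro!: derivative_eq_intros)
      moreover have "(u has_derivative D z) (at (z + 0 *\<^sub>R v) within range (\<lambda>t. z + t *\<^sub>R v))"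
        using der[OF that] by (simp add: has_derivative_at_withinI)
      ultimately show ?thesis
        using vector_derivative_diff_chain_within[of "\<lambda>t. z + t *\<^sub>R v" v 0 UNIV u "D z"] by (simp add: o_def)
    qed
    then have "((\<lambda>t. norm (u (z + t *\<^sub>R v) - u z - t *\<^sub>R D z v) / norm t) \<longlongrightarrow> 0) (at 0)"
      by (simp add: has_vector_derivative_def has_derivative_at)
    moreover have "\<forall>\<^sub>F t in at 0. norm (u (z + t *\<^sub>R v) - u z - t *\<^sub>R D z v) / norm t = norm ((u (z + t *\<^sub>R v) - u z) /\<^sub>R t - D z v)"
    proof (simp add: eventually_at_filter, rule always_eventually, intro allI impI)
      fix t :: real assume "t \<noteq> 0"
      then have "(u (z + t *\<^sub>R v) - u z) /\<^sub>R t - D z v = (1 / t) *\<^sub>R (u (z + t *\<^sub>R v) - u z - t *\<^sub>R D z v)"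
        by (simp add: scaleR_diff_right divide_inverse)
      then show "norm (u (z + t *\<^sub>R v) - u z - t *\<^sub>R D z v) / \<bar>t\<bar> = norm ((u (z + t *\<^sub>R v) - u z) /\<^sub>R t - D z v)"
        by (simp only: norm_scaleR) simp
    qed
    ultimately have "((\<lambda>t. norm ((u (z + t *\<^sub>R v) - u z) /\<^sub>R t - D z v)) \<longlongrightarrow> 0) (at 0)"
      by (rule Lim_transform_eventually)
    then have "((\<lambda>t. (u (z + t *\<^sub>R v) - u z) /\<^sub>R t) \<longlongrightarrow> D z v) (at 0)"
      by (rule LIM_zero_cancel[OF tendsto_norm_zero_cancel])
    moreover have "filterlim (\<lambda>n. 1 / real (Suc n)) (at 0) sequentially"
      using LIMSEQ_inverse_real_of_nat by (auto simp: filterlim_at divide_inverse)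
    ultimately have "(\<lambda>n. (u (z + (1 / real (Suc n)) *\<^sub>R v) - u z) /\<^sub>R (1 / real (Suc n))) \<longlonglongrightarrow> D z v"
      by (rule filterlim_compose)
    then show ?thesis
      by (simp add: add.commute)
  qed
  have "(\<lambda>z. if z = 0 then 0 else ?s n z) \<in> borel_measurable borel" for n
    by (intro measurable_If borel_measurable_continuous_onI continuous_intros continuous_on_compose2[OF cont]) auto
  then show "(\<lambda>z. if z = 0 then 0 else D z v) \<in> borel_measurable borel"
    by (rule borel_measurable_LIMSEQ_metric) (use lim in auto)
qed

text \<open>Difference quotients in direction \<open>v\<close> have integral 0 by translation
  invariance. The Lipschitz estimate bounds them by \<open>M * norm v\<close>, so dominated
  convergence passes this to the directional derivative; the origin is a null set.\<close>

lemma integral_derivative_eq_0: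
  fixes u :: "'a::euclidean_space \<Rightarrow> 'b::euclidean_space"
  assumes cont: "continuous_on UNIV u" and M: "0 \<le> M"
    and supp: "\<And>z. z \<notin> cball 0 R \<Longrightarrow> u z = 0"
    and der: "\<And>z. z \<noteq> 0 \<Longrightarrow> (u has_derivative D z) (at z)" "\<And>z h. z \<noteq> 0 \<Longrightarrow> norm (D z h) \<le> M * norm h"
  shows "(\<integral>z. (if z = 0 then 0 else D z v) \<partial>lborel) = 0"
proof -
  let ?s = "\<lambda>n z. real (Suc n) *\<^sub>R (u ((1 / real (Suc n)) *\<^sub>R v + z) - u z)"
  let ?g = "\<lambda>z. if z = 0 then 0 else D z v"
  have bor: "u \<in> borel_measurable borel"
    by (rule borel_measurable_continuous_onI[OF cont])
  have lip: "norm (u a - u b) \<le> M * norm (a - b)" for a b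
    by (rule lipschitz_off_origin[OF cont M der])
  have "compact (u ` cball 0 R)"
    by (rule compact_continuous_image[OF continuous_on_subset[OF cont]]) auto
  then obtain B where B: "\<And>z. z \<in> cball 0 R \<Longrightarrow> norm (u z) \<le> B"
    using compact_imp_bounded by (metis bounded_iff imageI)
  have int: "integrable lborel (\<lambda>z. u (c + z))" for c
  proof (rule integrable_bounded_support)
    show "norm (u (c + z)) \<le> max B 0" for z
      using B supp by (cases "c + z \<in> cball 0 R") (auto simp: le_max_iff_disj)
    show "u (c + z) = 0" if "z \<notin> cball 0 (R + norm c)" for z
      using that norm_triangle_ineq4[of "c + z" c] by (intro supp) auto
    show "(\<lambda>z. u (c + z)) \<in> borel_measurable lborel"
      using bor by simp
  qed
  have zero: "(\<integral>z. ?s n z \<partial>lborel) = 0" for n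
    using int[of "(1 / real (Suc n)) *\<^sub>R v"] int[of 0] by (simp add: integral_translate[OF bor])
  \<comment> \<open>Every step is at most \<open>norm v\<close> long, so all quotients vanish
    outside the ball enlarged by \<open>norm v\<close>.\<close>
  have "(\<lambda>n. \<integral>z. ?s n z \<partial>lborel) \<longlonglongrightarrow> (\<integral>z. ?g z \<partial>lborel)"
  proof (rule integral_dominated_convergence[where w="\<lambda>z. indicator (cball 0 (R + norm v)) z * (M * norm v)"])
    show "?g \<in> borel_measurable lborel"
      using measurable_derivative_off_origin(1)[OF cont der(1)] by simp
    show "?s n \<in> borel_measurable lborel" for n
      using bor by simp
    show "integrable lborel (\<lambda>z. indicator (cball (0::'a) (R + norm v)) z * (M * norm v))"
      using emeasure_compact_finite[of "cball (0::'a) (R + norm v)"] by (simp add: integrable_indicator_iff top.not_eq_extremum)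
    have "AE z in lborel. z \<noteq> (0::'a)"
      by (rule AE_lborel_singleton)
    then show "AE z in lborel. (\<lambda>n. ?s n z) \<longlonglongrightarrow> ?g z"
      by eventually_elim (use measurable_derivative_off_origin(2)[OF cont der(1)] in simp)
    show "AE z in lborel. norm (?s n z) \<le> indicator (cball 0 (R + norm v)) z * (M * norm v)" for n
    proof (rule AE_I2)
      fix z
      have le1: "norm ((1 / real (Suc n)) *\<^sub>R v) \<le> norm v"
        using mult_right_mono[of "1 / real (Suc n)" 1 "norm v"] by (simp add: divide_le_eq)
      have "norm (?s n z) = real (Suc n) * norm (u ((1 / real (Suc n)) *\<^sub>R v + z) - u z)"
        by simp
      also have "\<dots> \<le> real (Suc n) * (M * norm ((1 / real (Suc n)) *\<^sub>R v + z - z))"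
        by (intro mult_left_mono lip) auto
      also have "\<dots> = M * norm v"
        by simp
      finally have 1: "norm (?s n z) \<le> M * norm v" .
      have 2: "?s n z = 0" if "z \<notin> cball 0 (R + norm v)"
      proof -
        have "norm z > R + norm v"
          using that by simp
        moreover have "norm z \<le> norm ((1 / real (Suc n)) *\<^sub>R v + z) + norm ((1 / real (Suc n)) *\<^sub>R v)"
          using norm_triangle_ineq4[of "(1 / real (Suc n)) *\<^sub>R v + z" "(1 / real (Suc n)) *\<^sub>R v"] by simp
        ultimately have "norm ((1 / real (Suc n)) *\<^sub>R v + z) > R" "norm z > R"
          using le1 norm_ge_zero[of v] by linarith+
        then have "u ((1 / real (Suc n)) *\<^sub>R v + z) = 0" "u z = 0"
          by (auto intro!: supp)
        then show ?thesis by simp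
      qed
      show "norm (?s n z) \<le> indicator (cball 0 (R + norm v)) z * (M * norm v)"
      proof (cases "z \<in> cball 0 (R + norm v)")
        case True
        then show ?thesis using 1 by (simp only: indicator_simps mult_1)
      next
        case False
        show ?thesis unfolding 2[OF False] using False by simp
      qed
    qed
  qed
  then show ?thesis
    unfolding zero using LIMSEQ_unique tendsto_const by blast
qed

lemma test_functionE:
  assumes "test_function \<Omega> \<phi>"
  obtains R B where "continuous_on UNIV \<phi>" "\<And>z. z \<notin> cball 0 R \<Longrightarrow> \<phi> z = 0"
    "\<And>z. (\<phi> has_derivative frechet_derivative \<phi> (at z)) (at z)"
    "\<And>v. continuous_on UNIV (\<lambda>z. frechet_derivative \<phi> (at z) v)"
    "\<And>z v. z \<notin> cball 0 R \<Longrightarrow> frechet_derivative \<phi> (at z) v = 0"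
    "\<And>z. cmod (\<phi> z) \<le> B" "\<And>z v. cmod (frechet_derivative \<phi> (at z) v) \<le> B * cmod v" "0 \<le> B"
proof -
  have C: "C_k k \<phi>" for k
    using assms by (simp add: test_function_def)
  have cont: "continuous_on UNIV \<phi>"
    using C[of 0] by simp
  have diff: "(\<phi> has_derivative frechet_derivative \<phi> (at z)) (at z)" for z
    using C[of 1] by (simp add: differentiable_on_def frechet_derivative_works)
  have cont': "continuous_on UNIV (\<lambda>z. frechet_derivative \<phi> (at z) v)" for v
    using C[of 1] by simp
  have "bounded (closure {z. \<phi> z \<noteq> 0})"
    using assms by (auto simp: test_function_def compact_imp_bounded)
  then obtain R where R: "\<And>z. z \<in> closure {z. \<phi> z \<noteq> 0} \<Longrightarrow> cmod z \<le> R"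
    by (auto simp: bounded_iff)
  have zero: "\<phi> z = 0" if "z \<notin> cball 0 R" for z
    using that R[of z] closure_subset[of "{z. \<phi> z \<noteq> 0}"] by auto
  have zero': "frechet_derivative \<phi> (at z) v = 0" if "z \<notin> cball 0 R" for z v
  proof -
    have "((\<lambda>z. 0) has_derivative frechet_derivative \<phi> (at z)) (at z)"
      by (rule has_derivative_transform_within_open[OF diff, where s="- cball 0 R"]) (use that zero in auto)
    from has_derivative_unique[OF this has_derivative_const] show ?thesis
      by simp
  qed
  have bdd: "\<exists>B. \<forall>z. cmod (g z) \<le> B" if "continuous_on UNIV g" "\<And>z. z \<notin> cball 0 R \<Longrightarrow> g z = 0" for g :: "complex \<Rightarrow> complex"
  proof -
    have "compact (g ` cball 0 R)"
      by (rule compact_continuous_image[OF continuous_on_subset[OF that(1)]]) auto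
    then obtain B where B: "\<And>z. z \<in> cball 0 R \<Longrightarrow> norm (g z) \<le> B"
      using compact_imp_bounded by (metis bounded_iff imageI)
    have "cmod (g z) \<le> max B 0" for z
      using B[of z] that(2)[of z] by (cases "z \<in> cball 0 R") auto
    then show ?thesis by blast
  qed
  obtain B0 where B0: "\<And>z. cmod (\<phi> z) \<le> B0"
    using bdd[OF cont zero] by blast
  obtain B1 where B1: "\<And>z. cmod (frechet_derivative \<phi> (at z) 1) \<le> B1"
    using bdd[OF cont' zero'] by blast
  obtain B2 where B2: "\<And>z. cmod (frechet_derivative \<phi> (at z) \<i>) \<le> B2"
    using bdd[OF cont' zero'] by blast
  have nn: "0 \<le> B0" "0 \<le> B1" "0 \<le> B2"
    using B0 B1 B2 norm_ge_zero order_trans by blast+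
  have "cmod (frechet_derivative \<phi> (at z) v) \<le> (B0 + B1 + B2) * cmod v" for z v
  proof -
    interpret D: bounded_linear "frechet_derivative \<phi> (at z)"
      using diff has_derivative_bounded_linear by blast
    have "v = Re v *\<^sub>R 1 + Im v *\<^sub>R \<i>"
      by (simp add: complex_eq_iff)
    then have "frechet_derivative \<phi> (at z) v = Re v *\<^sub>R frechet_derivative \<phi> (at z) 1 + Im v *\<^sub>R frechet_derivative \<phi> (at z) \<i>"
      by (metis D.add D.scaleR)
    then have "cmod (frechet_derivative \<phi> (at z) v) \<le> \<bar>Re v\<bar> * cmod (frechet_derivative \<phi> (at z) 1) + \<bar>Im v\<bar> * cmod (frechet_derivative \<phi> (at z) \<i>)"
      using norm_triangle_ineq[of "Re v *\<^sub>R frechet_derivative \<phi> (at z) 1" "Im v *\<^sub>R frechet_derivative \<phi> (at z) \<i>"] by simp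
    also have "\<dots> \<le> cmod v * B1 + cmod v * B2"
      by (intro add_mono mult_mono B1 B2 abs_Re_le_cmod abs_Im_le_cmod) auto
    also have "\<dots> \<le> (B0 + B1 + B2) * cmod v"
      using nn by (simp add: algebra_simps)
    finally show ?thesis .
  qed
  moreover have "cmod (\<phi> z) \<le> B0 + B1 + B2" for z
    using B0[of z] nn by linarith
  ultimately show thesis
    using that[of R "B0 + B1 + B2", OF cont zero diff cont' zero'] nn by auto
qed

section \<open>Isotopies to the identity and orientation\<close>

definition isotopic_to_id :: "(complex \<Rightarrow> complex) \<Rightarrow> bool" where
  "isotopic_to_id F \<longleftrightarrow> (\<exists>H. continuous_on ({0..1::real} \<times> UNIV) (\<lambda>(t, z). H t z) \<and>
     (\<forall>t\<in>{0..1}. inj (H t)) \<and> H 0 = id \<and> H 1 = F)"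

lemma isotopic_to_id_imp:
  assumes "isotopic_to_id F" shows "continuous_on UNIV F" "inj F"
proof -
  obtain H where H: "continuous_on ({0..1::real} \<times> UNIV) (\<lambda>(t, z). H t z)" "\<And>t. t \<in> {0..1} \<Longrightarrow> inj (H t)" "H 1 = F"
    using assms unfolding isotopic_to_id_def by metis
  show "inj F"
    using H(2)[of 1] H(3) by simp
  show "continuous_on UNIV F"
    using continuous_on_compose2[OF H(1) continuous_on_Pair[OF continuous_on_const continuous_on_id], of 1 UNIV] H(3)
    by (auto simp: image_subset_iff)
qed

lemma isotopic_to_id_compose:
  assumes "isotopic_to_id F" "isotopic_to_id G"
  shows "isotopic_to_id (\<lambda>z. G (F z))"
proof -
  obtain H where H: "continuous_on ({0..1::real} \<times> UNIV) (\<lambda>(t, z). H t z)" "\<And>t. t \<in> {0..1} \<Longrightarrow> inj (H t)" "H 0 = id" "H 1 = F"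
    using assms unfolding isotopic_to_id_def by metis
  obtain H' where H': "continuous_on ({0..1::real} \<times> UNIV) (\<lambda>(t, z). H' t z)" "\<And>t. t \<in> {0..1} \<Longrightarrow> inj (H' t)" "H' 0 = id" "H' 1 = G"
    using assms unfolding isotopic_to_id_def by metis
  have "continuous_on ({0..1} \<times> UNIV) (\<lambda>x. (\<lambda>(t, z). H' t z) (fst x, (\<lambda>(t, z). H t z) x))"
    by (rule continuous_on_compose2[OF H'(1)]) (auto intro!: continuous_intros H(1))
  also have "(\<lambda>x. (\<lambda>(t, z). H' t z) (fst x, (\<lambda>(t, z). H t z) x)) = (\<lambda>(t, z). H' t (H t z))"
    by auto
  finally show ?thesis
    unfolding isotopic_to_id_def using H H' inj_compose[of "H' _" "H _", unfolded o_def]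
    by (intro exI[of _ "\<lambda>t z. H' t (H t z)"]) (auto simp: fun_eq_iff)
qed

text \<open>Injectivity at each time keeps the image of the circle away from the image of its
  centre. After subtracting the latter, the isotopy is a homotopy of loops in the punctured plane
  that starts at the circle, so the winding number stays 1.\<close>

lemma isotopic_to_id_imp_orientation_preserving:
  assumes "isotopic_to_id F" shows "orientation_preserving_on \<Omega> F"
  unfolding orientation_preserving_on_def
proof (intro allI impI)
  fix z r assume "0 < r \<and> cball z r \<subseteq> \<Omega>"
  then have r: "r > 0" by simp
  obtain H where H: "continuous_on ({0..1::real} \<times> UNIV) (\<lambda>(t, z). H t z)" "\<And>t. t \<in> {0..1} \<Longrightarrow> inj (H t)" "H 0 = id" "H 1 = F"
    using assms unfolding isotopic_to_id_def by metis
  let ?c = "circlepath z r"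
  let ?h = "\<lambda>x. H (fst x) (?c (snd x)) - H (fst x) z"
  have ne: "?c s \<noteq> z" for s
    using r by (simp add: circlepath)
  have cc: "continuous_on UNIV ?c"
    unfolding circlepath by (intro continuous_intros)
  have c1: "continuous_on ({0..1} \<times> {0..1}) (\<lambda>x. (\<lambda>(t, z). H t z) (fst x, ?c (snd x)))"
    by (rule continuous_on_compose2[OF H(1)]) (auto intro!: continuous_intros continuous_on_compose2[OF cc])
  have c2: "continuous_on ({0..1} \<times> {0..1}) (\<lambda>x. (\<lambda>(t, z). H t z) (fst x, z))"
    by (rule continuous_on_compose2[OF H(1)]) (auto intro!: continuous_intros)
  have "homotopic_loops (- {0}) (\<lambda>s. ?c s - z) (\<lambda>s. (F \<circ> ?c) s - F z)"
    unfolding homotopic_loops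
  proof (intro exI conjI ballI)
    show "continuous_on ({0..1} \<times> {0..1}) ?h"
      using continuous_on_diff[OF c1 c2] by simp
    show "?h \<in> {0..1} \<times> {0..1} \<rightarrow> - {0}"
      using H(2) ne by (auto simp: inj_eq)
    show "pathfinish (?h \<circ> Pair t) = pathstart (?h \<circ> Pair t)" for t
      using pathfinish_circlepath[of z r] pathstart_circlepath[of z r] by (simp add: pathfinish_def pathstart_def)
  qed (use H in auto)
  then have "winding_number (\<lambda>s. ?c s - z) 0 = winding_number (\<lambda>s. (F \<circ> ?c) s - F z) 0"
    by (rule winding_number_homotopic_loops)
  then show "winding_number (F \<circ> ?c) (F z) = 1"
    using winding_number_circlepath[of z z r] r by (simp add: winding_number_offset[symmetric] o_def)
qed

lemma isotopic_to_id_scale: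
  "isotopic_to_id (\<lambda>z. of_real (exp c) * z)"
  unfolding isotopic_to_id_def
  by (intro exI[of _ "\<lambda>t z. of_real (exp (t * c)) * z"])
     (auto simp: split_def fun_eq_iff intro!: continuous_intros injI)

text \<open>The isotopy is \<open>z * exp (t * \<psi> z)\<close>. Its continuity at the origin,
  where \<open>\<psi>\<close> may have no limit, comes from the bound \<open>exp B * cmod z\<close>,
  uniform in the time.\<close>

lemma isotopic_to_id_mult_exp:
  assumes cont: "continuous_on (- {0}) \<psi>" and B: "\<And>z. z \<noteq> 0 \<Longrightarrow> \<bar>Re (\<psi> z)\<bar> \<le> B"
    and inj: "\<And>t z w. 0 \<le> t \<Longrightarrow> t \<le> 1 \<Longrightarrow> z \<noteq> 0 \<Longrightarrow> w \<noteq> 0 \<Longrightarrow>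
        z * exp (of_real t * \<psi> z) = w * exp (of_real t * \<psi> w) \<Longrightarrow> z = w"
  shows "isotopic_to_id (\<lambda>z. z * exp (\<psi> z))"
  unfolding isotopic_to_id_def
proof (intro exI[of _ "\<lambda>t z. z * exp (of_real t * \<psi> z)"] conjI ballI)
  show "inj (\<lambda>z. z * exp (of_real t * \<psi> z))" if "t \<in> {0..1}" for t
  proof (rule injI)
    fix z w assume "z * exp (of_real t * \<psi> z) = w * exp (of_real t * \<psi> w)"
    then show "z = w"
      using inj[of t z w] that by (cases "z = 0"; cases "w = 0") auto
  qed
  have bound: "cmod (z * exp (of_real t * \<psi> z)) \<le> exp B * cmod z" if "t \<in> {0..1}" for t z
  proof (cases "z = 0")
    case False
    have "t * Re (\<psi> z) \<le> \<bar>t * Re (\<psi> z)\<bar>" by simp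
    also have "\<dots> = t * \<bar>Re (\<psi> z)\<bar>" using that by (simp add: abs_mult)
    also have "\<dots> \<le> 1 * B"
      using that B[OF False] by (intro mult_mono) auto
    finally have "exp (t * Re (\<psi> z)) * cmod z \<le> exp B * cmod z"
      by (intro mult_right_mono) auto
    then show ?thesis
      by (simp add: norm_mult norm_exp_eq_Re mult.commute)
  qed simp
  let ?h = "\<lambda>(t::real, z). z * exp (of_real t * \<psi> z)"
  show "continuous_on ({0..1} \<times> UNIV) ?h"
    unfolding continuous_on_eq_continuous_within
  proof
    fix x :: "real \<times> complex" assume x: "x \<in> {0..1} \<times> UNIV"
    show "continuous (at x within {0..1} \<times> UNIV) ?h"
    proof (cases "snd x = 0")
      case False
      have o: "open (UNIV \<times> - {0} :: (real \<times> complex) set)"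
        by (intro open_Times) auto
      have "continuous_on (UNIV \<times> - {0}) ?h"
        unfolding split_def by (intro continuous_intros continuous_on_compose2[OF cont]) auto
      then have "continuous (at x) ?h"
        using continuous_on_eq_continuous_at[OF o] x False by (cases x) auto
      then show ?thesis
        by (rule continuous_at_imp_continuous_at_within)
    next
      case True
      have "((\<lambda>y. exp B * cmod (snd y)) \<longlongrightarrow> exp B * cmod (snd x)) (at x within {0..1} \<times> UNIV)"
        by (intro tendsto_intros)
      then have "((\<lambda>y. exp B * cmod (snd y)) \<longlongrightarrow> 0) (at x within {0..1} \<times> UNIV)"
        using True by simp
      then have "(?h \<longlongrightarrow> 0) (at x within {0..1} \<times> UNIV)"
        by (rule Lim_null_comparison[rotated]) (auto simp: eventually_at_filter bound intro!: always_eventually)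
      then show ?thesis
        using True by (cases x) (auto simp: continuous_within)
    qed
  qed
qed auto

section \<open>Classical derivatives as distributional derivatives\<close>

lemma wirtinger_eq:
  assumes "(F has_derivative (\<lambda>h. p * h + q * cnj h)) (at z)"
  shows "frechet_derivative F (at z) = (\<lambda>h. p * h + q * cnj h)" "wirtinger_dz F z = p" "wirtinger_dzbar F z = q"
proof -
  show *: "frechet_derivative F (at z) = (\<lambda>h. p * h + q * cnj h)"
    using frechet_derivative_at[OF assms] by simp
  show "wirtinger_dz F z = p" "wirtinger_dzbar F z = q"
    by (simp_all add: wirtinger_dz_def wirtinger_dzbar_def * algebra_simps)
qed

lemma qc_differentiable_frechet:
  assumes "qc_differentiable K M F z"
  shows "(F has_derivative frechet_derivative F (at z)) (at z)" "cmod (frechet_derivative F (at z) h) \<le> M * cmod h" 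
    "cmod (wirtinger_dz F z) \<le> M" "cmod (wirtinger_dzbar F z) \<le> M" "0 \<le> M"
    "cmod (wirtinger_dzbar F z) < cmod (wirtinger_dz F z)"
    "cmod (wirtinger_dz F z) + cmod (wirtinger_dzbar F z) \<le> K * (cmod (wirtinger_dz F z) - cmod (wirtinger_dzbar F z))"
proof -
  obtain p q where F: "(F has_derivative (\<lambda>h. p * h + q * cnj h)) (at z)"
    and pq: "cmod q < cmod p" "cmod p + cmod q \<le> K * (cmod p - cmod q)" "cmod p + cmod q \<le> M"
    using assms by (auto simp: qc_differentiable_def)
  note w = wirtinger_eq[OF F]
  show "(F has_derivative frechet_derivative F (at z)) (at z)"
    using F by (simp add: w)
  have "cmod (p * h + q * cnj h) \<le> (cmod p + cmod q) * cmod h"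
    using norm_triangle_ineq[of "p * h" "q * cnj h"] by (simp add: norm_mult algebra_simps)
  also have "\<dots> \<le> M * cmod h"
    using pq by (intro mult_right_mono) auto
  finally show "cmod (frechet_derivative F (at z) h) \<le> M * cmod h"
    by (simp add: w)
  show "cmod (wirtinger_dz F z) \<le> M" "cmod (wirtinger_dzbar F z) \<le> M" "0 \<le> M"
    "cmod (wirtinger_dzbar F z) < cmod (wirtinger_dz F z)"
    "cmod (wirtinger_dz F z) + cmod (wirtinger_dzbar F z) \<le> K * (cmod (wirtinger_dz F z) - cmod (wirtinger_dzbar F z))"
    using pq norm_ge_zero[of p] norm_ge_zero[of q] unfolding w by linarith+
qed

text \<open>This is \<open>integral_derivative_eq_0\<close> for the product of \<open>F\<close> and
  \<open>\<phi>\<close>, which vanishes outside the support of \<open>\<phi>\<close>.\<close>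

lemma integral_parts_off_origin:
  fixes F \<phi> :: "complex \<Rightarrow> complex"
  assumes cont: "continuous_on UNIV F" and M: "0 \<le> M"
    and der: "\<And>z. z \<noteq> 0 \<Longrightarrow> (F has_derivative F' z) (at z)" "\<And>z h. z \<noteq> 0 \<Longrightarrow> cmod (F' z h) \<le> M * cmod h"
    and \<phi>: "test_function UNIV \<phi>"
  shows "integrable lborel (\<lambda>z. (if z = 0 then 0 else F' z v) * \<phi> z)"
    and "integrable lborel (\<lambda>z. F z * frechet_derivative \<phi> (at z) v)"
    and "(\<integral>z. (if z = 0 then 0 else F' z v) * \<phi> z \<partial>lborel) = - (\<integral>z. F z * frechet_derivative \<phi> (at z) v \<partial>lborel)"
proof -
  obtain R B where t: "continuous_on UNIV \<phi>" "\<And>z. z \<notin> cball 0 R \<Longrightarrow> \<phi> z = 0"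
    "\<And>z. (\<phi> has_derivative frechet_derivative \<phi> (at z)) (at z)"
    "\<And>v. continuous_on UNIV (\<lambda>z. frechet_derivative \<phi> (at z) v)"
    "\<And>z v. z \<notin> cball 0 R \<Longrightarrow> frechet_derivative \<phi> (at z) v = 0"
    "\<And>z. cmod (\<phi> z) \<le> B" "\<And>z v. cmod (frechet_derivative \<phi> (at z) v) \<le> B * cmod v" "0 \<le> B"
    using test_functionE[OF \<phi>] by blast
  have "compact (F ` cball 0 R)"
    by (rule compact_continuous_image[OF continuous_on_subset[OF cont]]) auto
  then obtain A0 where "\<And>z. z \<in> cball 0 R \<Longrightarrow> cmod (F z) \<le> A0"
    using compact_imp_bounded by (metis bounded_iff imageI)
  then obtain A where A: "\<And>z. z \<in> cball 0 R \<Longrightarrow> cmod (F z) \<le> A" "0 \<le> A"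
    by (metis max.cobounded1 max.cobounded2 order_trans)
  define D where "D z h = F z * frechet_derivative \<phi> (at z) h + F' z h * \<phi> z" for z h
  have m: "(\<lambda>z. if z = 0 then 0 else F' z v) \<in> borel_measurable borel"
    by (rule measurable_derivative_off_origin(1)[OF cont der(1)])
  have m\<phi>: "\<phi> \<in> borel_measurable borel" "(\<lambda>z. frechet_derivative \<phi> (at z) v) \<in> borel_measurable borel" "F \<in> borel_measurable borel"
    using t cont by (auto intro!: borel_measurable_continuous_onI)
  show I1: "integrable lborel (\<lambda>z. (if z = 0 then 0 else F' z v) * \<phi> z)"
  proof (rule integrable_bounded_support[where R=R])
    show "cmod ((if z = 0 then 0 else F' z v) * \<phi> z) \<le> (M * cmod v) * B" for z
      unfolding norm_mult using M der by (intro mult_mono t) auto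
  qed (use t m m\<phi> in auto)
  show I2: "integrable lborel (\<lambda>z. F z * frechet_derivative \<phi> (at z) v)"
  proof (rule integrable_bounded_support[where R=R])
    show "cmod (F z * frechet_derivative \<phi> (at z) v) \<le> A * (B * cmod v)" for z
    proof (cases "z \<in> cball 0 R")
      case True
      then show ?thesis
        unfolding norm_mult by (intro mult_mono A t) auto
    qed (use A t in auto)
  qed (use t m\<phi> in auto)
  have "(\<integral>z. (if z = 0 then 0 else D z v) \<partial>lborel) = 0"
  proof (rule integral_derivative_eq_0[where R=R])
    show "continuous_on UNIV (\<lambda>z. F z * \<phi> z)"
      by (intro continuous_intros cont t)
    show "((\<lambda>z. F z * \<phi> z) has_derivative D z) (at z)" if "z \<noteq> 0" for z
      unfolding D_def by (rule has_derivative_mult[OF der(1)[OF that] t(3)])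
    show "cmod (D z h) \<le> (A * B + M * B) * cmod h" if "z \<noteq> 0" for z h
    proof (cases "z \<in> cball 0 R")
      case True
      have "cmod (D z h) \<le> cmod (F z) * cmod (frechet_derivative \<phi> (at z) h) + cmod (F' z h) * cmod (\<phi> z)"
        unfolding D_def using norm_triangle_ineq[of "F z * frechet_derivative \<phi> (at z) h" "F' z h * \<phi> z"] by (simp add: norm_mult)
      also have "\<dots> \<le> A * (B * cmod h) + (M * cmod h) * B"
        using M that True by (intro add_mono mult_mono A t der) auto
      finally show ?thesis
        by (simp add: algebra_simps)
    qed (use t A M in \<open>auto simp: D_def\<close>)
  qed (use t A M in auto)
  also have "(\<integral>z. (if z = 0 then 0 else D z v) \<partial>lborel) = (\<integral>z. (if z = 0 then 0 else F' z v) * \<phi> z + F z * frechet_derivative \<phi> (at z) v \<partial>lborel)"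
  proof (rule integral_cong_AE)
    show "AE z in lborel. (if z = 0 then 0 else D z v) = (if z = 0 then 0 else F' z v) * \<phi> z + F z * frechet_derivative \<phi> (at z) v"
      using AE_lborel_singleton[of 0] by eventually_elim (simp add: D_def)
    show "(\<lambda>z. if z = 0 then 0 else D z v) \<in> borel_measurable lborel"
    proof -
      have "(\<lambda>z. if z = 0 then 0 else D z v) = (\<lambda>z. if z = 0 then 0 else (if z = 0 then 0 else F' z v) * \<phi> z + F z * frechet_derivative \<phi> (at z) v)"
        by (auto simp: D_def)
      also have "\<dots> \<in> borel_measurable lborel"
        using m m\<phi> by (intro measurable_If) auto
      finally show ?thesis .
    qed
  qed (use m m\<phi> in auto)
  also have "\<dots> = (\<integral>z. (if z = 0 then 0 else F' z v) * \<phi> z \<partial>lborel) + (\<integral>z. F z * frechet_derivative \<phi> (at z) v \<partial>lborel)"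
    by (rule Bochner_Integration.integral_add[OF I1 I2])
  finally show "(\<integral>z. (if z = 0 then 0 else F' z v) * \<phi> z \<partial>lborel) = - (\<integral>z. F z * frechet_derivative \<phi> (at z) v \<partial>lborel)"
    by (simp add: add_eq_0_iff)
qed

lemma quasiconformal_on_UNIV_I:
  assumes iso: "isotopic_to_id F" and K: "1 \<le> K"
    and qc: "\<And>z. z \<noteq> 0 \<Longrightarrow> qc_differentiable K M F z"
  shows "quasiconformal_on K UNIV F"
proof -
  have cont: "continuous_on UNIV F" and inj: "inj F"
    using isotopic_to_id_imp[OF iso] by auto
  define F' where "F' z = frechet_derivative F (at z)" for z
  note f = qc_differentiable_frechet[OF qc]
  \<comment> \<open>The value 0 at the origin makes the derivative a Borel function on the whole
    plane. There \<open>dilatation\<close> is infinite, but a point does not influence the essential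
    supremum.\<close>
  define g where "g v z = (if z = 0 then 0 else F' z v)" for v z
  define Fz where "Fz z = (g 1 z - \<i> * g \<i> z) / 2" for z
  define Fzb where "Fzb z = (g 1 z + \<i> * g \<i> z) / 2" for z
  have M: "0 \<le> M" using f(5)[of 1] by simp
  have w: "Fz z = wirtinger_dz F z" "Fzb z = wirtinger_dzbar F z" if "z \<noteq> 0" for z
    using that by (simp_all add: Fz_def Fzb_def g_def wirtinger_dz_def wirtinger_dzbar_def F'_def)
  have gm [measurable]: "g v \<in> borel_measurable borel" for v
    unfolding g_def F'_def by (rule measurable_derivative_off_origin(1)[OF cont f(1)])
  have m: "Fz \<in> borel_measurable borel" "Fzb \<in> borel_measurable borel"
    unfolding Fz_def Fzb_def by measurable
  have b: "cmod (Fz z) \<le> M" "cmod (Fzb z) \<le> M" for z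
    using w[of z] f(3,4)[of z] M by (cases "z = 0"; simp add: Fz_def Fzb_def g_def)+
  have loc: "locally_integrable_on h UNIV" if "h \<in> borel_measurable borel" "\<And>z. cmod (h z) \<le> M" for h
    unfolding locally_integrable_on_def set_integrable_def
  proof (intro allI impI)
    fix C :: "complex set" assume C: "compact C \<and> C \<subseteq> UNIV"
    then have "bounded C"
      by (simp add: compact_imp_bounded)
    then obtain R where "\<And>z. z \<in> C \<Longrightarrow> z \<in> cball 0 R"
      unfolding bounded_iff by auto
    moreover have "C \<in> sets borel"
      using C by (simp add: borel_closed compact_imp_closed)
    ultimately have "integrable lborel (\<lambda>z. indicator C z *\<^sub>R h z)"
      using that M by (intro integrable_bounded_support[where B=M and R=R]) (auto simp: indicator_def)
    then show "integrable lebesgue (\<lambda>z. indicator C z *\<^sub>R h z)"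
      by (simp add: integrable_completion)
  qed
  have "(F has_derivative F' z) (at z)" "cmod (F' z h) \<le> M * cmod h" if "z \<noteq> 0" for z h
    using f(1,2)[OF that] by (simp_all add: F'_def)
  note parts = integral_parts_off_origin[where F'=F', OF cont M this, folded g_def, simplified]
  have E: "(\<integral>z. Fz z * \<phi> z \<partial>lborel) = - (\<integral>z. F z * wirtinger_dz \<phi> z \<partial>lborel)"
     "(\<integral>z. Fzb z * \<phi> z \<partial>lborel) = - (\<integral>z. F z * wirtinger_dzbar \<phi> z \<partial>lborel)"
    if \<phi>: "test_function UNIV \<phi>" for \<phi>
  proof -
    note p = parts[OF \<phi>]
    have e: "Fz z * \<phi> z = (1/2) * (g 1 z * \<phi> z) + (- \<i>/2) * (g \<i> z * \<phi> z)"
       "Fzb z * \<phi> z = (1/2) * (g 1 z * \<phi> z) + (\<i>/2) * (g \<i> z * \<phi> z)"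
       "F z * wirtinger_dz \<phi> z = (1/2) * (F z * frechet_derivative \<phi> (at z) 1) + (- \<i>/2) * (F z * frechet_derivative \<phi> (at z) \<i>)"
       "F z * wirtinger_dzbar \<phi> z = (1/2) * (F z * frechet_derivative \<phi> (at z) 1) + (\<i>/2) * (F z * frechet_derivative \<phi> (at z) \<i>)" for z
      by (simp_all add: Fz_def Fzb_def wirtinger_dz_def wirtinger_dzbar_def field_simps)
    have lin: "(\<integral>z. a * (u z :: complex) + b * v z \<partial>lborel) = a * (\<integral>z. u z \<partial>lborel) + b * (\<integral>z. v z \<partial>lborel)"
      if "integrable lborel u" "integrable lborel v" for a b and u v :: "complex \<Rightarrow> complex"
      using that by simp
    show "(\<integral>z. Fz z * \<phi> z \<partial>lborel) = - (\<integral>z. F z * wirtinger_dz \<phi> z \<partial>lborel)"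
      "(\<integral>z. Fzb z * \<phi> z \<partial>lborel) = - (\<integral>z. F z * wirtinger_dzbar \<phi> z \<partial>lborel)"
      unfolding e lin[OF p(1) p(1)] lin[OF p(2) p(2)] p(3) by simp_all
  qed
  have meas: "wirtinger_dz \<phi> \<in> borel_measurable borel" "wirtinger_dzbar \<phi> \<in> borel_measurable borel" "\<phi> \<in> borel_measurable borel"
    if \<phi>: "test_function UNIV \<phi>" for \<phi>
  proof -
    obtain R B where t: "continuous_on UNIV \<phi>" "\<And>v. continuous_on UNIV (\<lambda>z. frechet_derivative \<phi> (at z) v)"
      using test_functionE[OF \<phi>] by blast
    show "wirtinger_dz \<phi> \<in> borel_measurable borel" "wirtinger_dzbar \<phi> \<in> borel_measurable borel" "\<phi> \<in> borel_measurable borel"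
      unfolding wirtinger_dz_def[abs_def] wirtinger_dzbar_def[abs_def]
      by (intro borel_measurable_continuous_onI continuous_intros t; simp)+
  qed
  have cm: "(\<integral>z. u z * v z \<partial>lebesgue) = (\<integral>z. u z * v z \<partial>lborel)"
    if "u \<in> borel_measurable borel" "v \<in> borel_measurable borel" for u v :: "complex \<Rightarrow> complex"
    using that by (intro integral_completion) simp
  have Fm: "F \<in> borel_measurable borel"
    using cont by (rule borel_measurable_continuous_onI)
  have dist: "distrib_dz_on UNIV F Fz" "distrib_dzbar_on UNIV F Fzb"
    unfolding distrib_dz_on_def distrib_dzbar_on_def set_lebesgue_integral_def
    using loc[OF m(1) b(1)] loc[OF m(2) b(2)] by (simp_all add: cm m meas Fm E)
  have ess: "esssup (lebesgue_on UNIV) (\<lambda>z. dilatation (Fz z) (Fzb z)) \<le> ereal K"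
  proof (rule esssup_I)
    note m[measurable]
    have "(\<lambda>z. dilatation (Fz z) (Fzb z)) \<in> borel_measurable borel"
      unfolding dilatation_def by measurable
    then show "(\<lambda>z. dilatation (Fz z) (Fzb z)) \<in> borel_measurable (lebesgue_on UNIV)"
      by (simp add: measurable_completion lebesgue_on_UNIV_eq)
    have "AE z in lborel. z \<noteq> (0::complex)"
      by (rule AE_lborel_singleton)
    then have "AE z in lebesgue. z \<noteq> (0::complex)"
      by (rule AE_completion)
    then show "AE z in lebesgue_on UNIV. dilatation (Fz z) (Fzb z) \<le> ereal K"
      unfolding lebesgue_on_UNIV_eq
    proof eventually_elim
      case (elim z)
      then show ?case
        using f(6,7)[of z] w[of z] by (simp add: dilatation_def pos_divide_le_eq)
    qed
  qed
  \<comment> \<open>Only a homeomorphism onto the image is asked for, so invariance of domain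
    finishes without a proof of surjectivity.\<close>
  obtain G where "homeomorphism UNIV (F ` UNIV) F G"
    using invariance_of_domain_homeomorphism[OF open_UNIV cont _ inj] by auto
  then show ?thesis
    unfolding quasiconformal_on_def
    using K dist ess isotopic_to_id_imp_orientation_preserving[OF iso] by blast
qed

section \<open>The twist, the radial stretching and the extension\<close>

text \<open>In logarithmic coordinates this is a vertical shear by \<open>g\<close>, of Jacobian 1,
  hence \<open>d = 1\<close>. At each time of the isotopy it preserves the modulus and rotates each
  circle rigidly, so it is injective.\<close>

lemma twist_map:
  assumes g: "\<And>x. \<exists>D. (g has_real_derivative D) (at x) \<and> \<bar>D\<bar> \<le> G"
  defines "T \<equiv> (\<lambda>z. z * exp (\<i> * of_real (g (ln (cmod z)))))"
  shows "isotopic_to_id T" and "z \<noteq> 0 \<Longrightarrow> qc_differentiable ((1 + G)^2) (1 + G) T z"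
proof -
  have cg: "continuous_on UNIV g"
    using g by (meson DERIV_isCont continuous_at_imp_continuous_on)
  show "isotopic_to_id T"
    unfolding T_def
  proof (rule isotopic_to_id_mult_exp[where B=0])
    show "continuous_on (- {0}) (\<lambda>z. \<i> * of_real (g (ln (cmod z))))"
      by (auto intro!: continuous_intros continuous_on_compose2[OF cg])
    fix t :: real and z w :: complex
    assume eq: "z * exp (of_real t * (\<i> * of_real (g (ln (cmod z))))) = w * exp (of_real t * (\<i> * of_real (g (ln (cmod w)))))"
    then have "cmod (z * exp (of_real t * (\<i> * of_real (g (ln (cmod z)))))) = cmod (w * exp (of_real t * (\<i> * of_real (g (ln (cmod w))))))"
      by simp
    then have "cmod z = cmod w"
      by (simp add: norm_mult norm_exp_eq_Re)
    with eq show "z = w"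
      by simp
  qed simp
  assume z: "z \<noteq> 0"
  obtain D where D: "(g has_real_derivative D) (at (ln (cmod z)))" "\<bar>D\<bar> \<le> G"
    using g by blast
  have "((\<lambda>z. g (ln (cmod z))) has_derivative (\<lambda>h. D * Re (h / z))) (at z)"
    using has_derivative_compose[OF has_derivative_ln_cmod[OF z], of g "(*) D"] D(1) by (simp add: has_field_derivative_def)
  from has_derivative_mult_right[where x="\<i>", OF has_derivative_of_real[OF this]]
  have "((\<lambda>z. \<i> * of_real (g (ln (cmod z)))) has_derivative (\<lambda>h. (\<i> * of_real D) * of_real (Re (h / z)) + 0 * of_real (Im (h / z)))) (at z)"
    by (simp add: mult.assoc)
  then have "qc_differentiable ((1 + G)^2 / 1) (exp 0 * (1 + G)) T z"
    unfolding T_def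
  proof (rule qc_differentiable_mult_exp[OF z])
    show "1 \<le> (cmod (1 + (\<i> * of_real D - \<i> * 0) / 2))^2 - (cmod ((\<i> * of_real D + \<i> * 0) / 2))^2"
      by (simp add: cmod_power2 norm_divide norm_mult) (simp add: power2_eq_square)
  qed (use D in \<open>auto simp: norm_mult\<close>)
  then show "qc_differentiable ((1 + G)^2) (1 + G) T z"
    by simp
qed

text \<open>In logarithmic coordinates: a horizontal displacement equal to \<open>d j\<close> on the
  ray of direction \<open>\<omega> j\<close>, faded out by angular cutoffs with disjoint supports.
  The bound 1/2 on the slopes makes the map injective on each ray and keeps the Jacobian at least
  1/2. The angular derivative may be large, since it enters only the norm; \<open>B\<close> is a
  crude bound for it, with \<open>2 / (1 - \<kappa>)\<close> the slope of one cutoff.\<close>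

lemma radial_map:
  fixes \<omega> :: "'j \<Rightarrow> complex"
  assumes J: "finite J" and \<omega>: "\<And>j. j \<in> J \<Longrightarrow> cmod (\<omega> j) = 1" and \<kappa>: "\<kappa> < 1"
    and disj: "\<And>i j s. i \<in> J \<Longrightarrow> j \<in> J \<Longrightarrow> cmod s = 1 \<Longrightarrow> Re (s * cnj (\<omega> i)) > \<kappa> \<Longrightarrow> Re (s * cnj (\<omega> j)) > \<kappa> \<Longrightarrow> i = j"
    and d: "\<And>j x. j \<in> J \<Longrightarrow> \<exists>D. (d j has_real_derivative D) (at x) \<and> \<bar>D\<bar> \<le> 1/2"
    and C: "\<And>j x. j \<in> J \<Longrightarrow> \<bar>d j x\<bar> \<le> C" "0 \<le> C"
  defines "B \<equiv> of_nat (card J) * (2 / (1 - \<kappa>) * C)"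
  obtains u where "isotopic_to_id (\<lambda>z. z * exp (of_real (u z)))"
    and "\<And>z. z \<noteq> 0 \<Longrightarrow> qc_differentiable ((1 + (1/2 + B))^2 / (1/2)) (exp C * (1 + (1/2 + B))) (\<lambda>z. z * exp (of_real (u z))) z"
    and "\<And>z j. z \<noteq> 0 \<Longrightarrow> j \<in> J \<Longrightarrow> sgn z = \<omega> j \<Longrightarrow> u z = d j (ln (cmod z))"
proof -
  \<comment> \<open>For a unit vector \<open>s\<close>, the real part is the cosine of the angle
    between \<open>s\<close> and \<open>\<omega> j\<close>; the cutoff is 1 on the ray itself and 0
    as soon as the cosine is at most \<open>\<kappa>\<close>.\<close>
  define \<rho> where "\<rho> j s = smoothstep ((Re (s * cnj (\<omega> j)) - \<kappa>) / (1 - \<kappa>))" for j s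
  define U where "U s x = (\<Sum>j\<in>J. \<rho> j s * d j x)" for s x
  define u where "u z = U (sgn z) (ln (cmod z))" for z
  have \<rho>0: "\<rho> j s = 0" if "Re (s * cnj (\<omega> j)) \<le> \<kappa>" for j s
    using that \<kappa> by (simp add: \<rho>_def divide_nonpos_pos)
  have \<rho>b: "0 \<le> \<rho> j s" "\<rho> j s \<le> 1" for j s
    by (simp_all add: \<rho>_def smoothstep_bounds)
  have \<comment> \<open>at each direction at most one of the cut-off functions is nonzero\<close>
    single: "(\<forall>c. (\<Sum>j\<in>J. \<rho> j s * c j) = 0) \<or> (\<exists>j\<in>J. \<forall>c. (\<Sum>j\<in>J. \<rho> j s * c j) = \<rho> j s * c j)" if "cmod s = 1" for s
  proof (cases "\<exists>j\<in>J. Re (s * cnj (\<omega> j)) > \<kappa>")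
    case True
    then obtain j where j: "j \<in> J" "Re (s * cnj (\<omega> j)) > \<kappa>"
      by blast
    have "\<rho> i s = 0" if "i \<in> J - {j}" for i
      using disj[of i j s] j that \<open>cmod s = 1\<close> by (intro \<rho>0) force
    then have "(\<Sum>j\<in>J. \<rho> j s * c j) = \<rho> j s * c j" for c
      by (subst sum.remove[OF J j(1)]) simp
    with j show ?thesis by blast
  next
    case False
    then have "\<rho> j s = 0" if "j \<in> J" for j
      using that by (intro \<rho>0) force
    then show ?thesis by simp
  qed
  have sum_bound: "\<bar>\<Sum>j\<in>J. \<rho> j s * c j\<bar> \<le> b" if "cmod s = 1" "\<And>j. j \<in> J \<Longrightarrow> \<bar>c j\<bar> \<le> b" "0 \<le> b" for s c b
    using single[OF that(1)]
  proof
    assume "\<exists>j\<in>J. \<forall>c. (\<Sum>j\<in>J. \<rho> j s * c j) = \<rho> j s * c j"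
    then obtain j where "j \<in> J" "(\<Sum>j\<in>J. \<rho> j s * c j) = \<rho> j s * c j"
      by blast
    then show ?thesis
      using mult_mono[OF \<rho>b(2)[of j s] that(2)[of j]] \<rho>b(1)[of j s] by (simp add: abs_mult)
  qed (use that in simp)
  have s1: "cmod (sgn z) = 1" if "z \<noteq> 0" for z :: complex
    using that by (simp add: norm_sgn)
  have ub: "\<bar>u z\<bar> \<le> C" if "z \<noteq> 0" for z
    unfolding u_def U_def by (rule sum_bound[OF s1[OF that] C])
  have lip: "\<bar>d j x - d j y\<bar> \<le> 1/2 * \<bar>x - y\<bar>" if j: "j \<in> J" for j x y
  proof -
    obtain D where D: "\<And>x. (d j has_real_derivative D x) (at x)" "\<And>x. \<bar>D x\<bar> \<le> 1/2"
      using d[OF j] by metis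
    show ?thesis
      using field_differentiable_bound[of UNIV "d j" D "1/2" x y] D by simp
  qed
  have deriv: "\<exists>\<alpha> \<beta>. (u has_derivative (\<lambda>h. \<alpha> * Re (h / z) + \<beta> * Im (h / z))) (at z) \<and> \<bar>\<alpha>\<bar> \<le> 1/2 \<and> \<bar>\<beta>\<bar> \<le> B"
    if z: "z \<noteq> 0" for z
  proof -
    have "\<exists>D. (d j has_real_derivative D) (at (ln (cmod z))) \<and> \<bar>D\<bar> \<le> 1/2" if "j \<in> J" for j
      using d[OF that] .
    then obtain D where D: "\<And>j. j \<in> J \<Longrightarrow> (d j has_real_derivative D j) (at (ln (cmod z)))" "\<And>j. j \<in> J \<Longrightarrow> \<bar>D j\<bar> \<le> 1/2"
      by metis
    have "\<exists>E. ((\<lambda>z. \<rho> j (sgn z)) has_derivative (\<lambda>h. E * Im (h / z))) (at z) \<and> \<bar>E\<bar> \<le> 2 / (1 - \<kappa>)" if j: "j \<in> J" for j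
    proof -
      let ?a = "\<lambda>z. (Re (sgn z * cnj (\<omega> j)) - \<kappa>) / (1 - \<kappa>)"
      obtain S where S: "(smoothstep has_real_derivative S) (at (?a z))" "\<bar>S\<bar> \<le> 2"
        using smoothstep_derivative by metis
      define e where "e = Re (\<i> * sgn z * cnj (\<omega> j)) / (1 - \<kappa>)"
      have "((\<lambda>z. Re (sgn z * cnj (\<omega> j))) has_derivative (\<lambda>h. Re (\<i> * sgn z * of_real (Im (h / z)) * cnj (\<omega> j)))) (at z)"
        by (intro has_derivative_Re has_derivative_mult_left has_derivative_sgn_complex z)
      then have "(?a has_derivative (\<lambda>h. (Re (\<i> * sgn z * of_real (Im (h / z)) * cnj (\<omega> j)) - 0) / (1 - \<kappa>))) (at z)"
        unfolding divide_inverse[of _ "1 - \<kappa>"] by (intro has_derivative_mult_left has_derivative_diff has_derivative_const)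
      moreover have "(Re (\<i> * sgn z * of_real (Im (h / z)) * cnj (\<omega> j)) - 0) / (1 - \<kappa>) = e * Im (h / z)" for h
        unfolding e_def by (simp add: field_simps)
      ultimately have "(?a has_derivative (\<lambda>h. e * Im (h / z))) (at z)"
        by simp
      from has_derivative_compose[OF this S(1)[unfolded has_field_derivative_def]]
      have "((\<lambda>z. \<rho> j (sgn z)) has_derivative (\<lambda>h. (S * e) * Im (h / z))) (at z)"
        by (simp add: \<rho>_def mult.assoc)
      moreover have "\<bar>e\<bar> \<le> 1 / (1 - \<kappa>)"
        using abs_Re_le_cmod[of "\<i> * sgn z * cnj (\<omega> j)"] s1[OF z] \<omega>[OF j] \<kappa>
        unfolding e_def by (simp add: norm_mult divide_right_mono)
      then have "\<bar>S * e\<bar> \<le> 2 * (1 / (1 - \<kappa>))"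
        unfolding abs_mult using S(2) by (intro mult_mono) auto
      ultimately show ?thesis by auto
    qed
    then obtain E where E: "\<And>j. j \<in> J \<Longrightarrow> ((\<lambda>z. \<rho> j (sgn z)) has_derivative (\<lambda>h. E j * Im (h / z))) (at z)"
      "\<And>j. j \<in> J \<Longrightarrow> \<bar>E j\<bar> \<le> 2 / (1 - \<kappa>)"
      by metis
    have "((\<lambda>z. d j (ln (cmod z))) has_derivative (\<lambda>h. D j * Re (h / z))) (at z)" if "j \<in> J" for j
      using has_derivative_compose[OF has_derivative_ln_cmod[OF z] D(1)[OF that, unfolded has_field_derivative_def]] .
    then have "(u has_derivative (\<lambda>h. \<Sum>j\<in>J. \<rho> j (sgn z) * (D j * Re (h / z)) + E j * Im (h / z) * d j (ln (cmod z)))) (at z)"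
      unfolding u_def U_def by (intro has_derivative_sum has_derivative_mult E) auto
    moreover have "(\<Sum>j\<in>J. \<rho> j (sgn z) * (D j * Re (h / z)) + E j * Im (h / z) * d j (ln (cmod z)))
      = (\<Sum>j\<in>J. \<rho> j (sgn z) * D j) * Re (h / z) + (\<Sum>j\<in>J. E j * d j (ln (cmod z))) * Im (h / z)" for h
      by (simp add: sum.distrib sum_distrib_left ac_simps)
    ultimately have "(u has_derivative (\<lambda>h. (\<Sum>j\<in>J. \<rho> j (sgn z) * D j) * Re (h / z) + (\<Sum>j\<in>J. E j * d j (ln (cmod z))) * Im (h / z))) (at z)"
      by simp
    moreover have "\<bar>\<Sum>j\<in>J. \<rho> j (sgn z) * D j\<bar> \<le> 1/2"
      by (rule sum_bound[OF s1[OF z] D(2)]) auto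
    moreover have "\<bar>\<Sum>j\<in>J. E j * d j (ln (cmod z))\<bar> \<le> B"
    proof -
      have "\<bar>\<Sum>j\<in>J. E j * d j (ln (cmod z))\<bar> \<le> (\<Sum>j\<in>J. \<bar>E j\<bar> * \<bar>d j (ln (cmod z))\<bar>)"
        using sum_abs[of "\<lambda>j. E j * d j (ln (cmod z))" J] by (simp add: abs_mult)
      also have "\<dots> \<le> (\<Sum>j\<in>J. 2 / (1 - \<kappa>) * C)"
        using \<kappa> by (intro sum_mono mult_mono E C) auto
      finally show ?thesis
        by (simp add: B_def)
    qed
    ultimately show ?thesis by blast
  qed
  show thesis
  proof (rule that[of u])
    show "isotopic_to_id (\<lambda>z. z * exp (of_real (u z)))"
    proof (rule isotopic_to_id_mult_exp[where B=C])
      show "continuous_on (- {0}) (\<lambda>z. complex_of_real (u z))"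
        using deriv has_derivative_continuous by (intro continuous_on_of_real continuous_at_imp_continuous_on) blast
      show "\<bar>Re (of_real (u z))\<bar> \<le> C" if "z \<noteq> 0" for z
        using ub[OF that] by simp
      fix t :: real and z w :: complex
      assume t: "0 \<le> t" "t \<le> 1" and nz: "z \<noteq> 0" "w \<noteq> 0"
        and eq: "z * exp (of_real t * of_real (u z)) = w * exp (of_real t * of_real (u w))"
      \<comment> \<open>Positive factors preserve directions, so \<open>z\<close> and
        \<open>w\<close> lie on one ray. Along a ray \<open>u\<close> is 1/2-Lipschitz in the
        logarithm of the modulus and cannot compensate a difference of moduli.\<close>
      have eq': "exp (t * u z) *\<^sub>R z = exp (t * u w) *\<^sub>R w"
        using eq by (simp add: scaleR_conv_of_real exp_of_real flip: of_real_mult) (simp add: mult.commute)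
      then have "sgn (exp (t * u z) *\<^sub>R z) = sgn (exp (t * u w) *\<^sub>R w)"
        by simp
      then have s: "sgn z = sgn w"
        by (simp add: sgn_scaleR)
      have "cmod (exp (t * u z) *\<^sub>R z) = cmod (exp (t * u w) *\<^sub>R w)"
        using eq' by simp
      then have "ln (exp (t * u z) * cmod z) = ln (exp (t * u w) * cmod w)"
        by simp
      then have l: "t * u z + ln (cmod z) = t * u w + ln (cmod w)"
        using nz by (simp add: ln_mult)
      have "\<bar>u z - u w\<bar> = \<bar>\<Sum>j\<in>J. \<rho> j (sgn z) * (d j (ln (cmod z)) - d j (ln (cmod w)))\<bar>"
        by (simp add: u_def U_def s right_diff_distrib sum_subtractf)
      also have "\<dots> \<le> 1/2 * \<bar>ln (cmod z) - ln (cmod w)\<bar>"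
        by (intro sum_bound s1 nz lip) auto
      finally have "\<bar>t * (u z - u w)\<bar> \<le> 1 * (1/2 * \<bar>ln (cmod z) - ln (cmod w)\<bar>)"
        unfolding abs_mult using t by (intro mult_mono) auto
      moreover have "t * (u z - u w) = ln (cmod w) - ln (cmod z)"
        using l by (simp add: algebra_simps)
      ultimately have "ln (cmod z) = ln (cmod w)"
        by (simp add: abs_minus_commute)
      then have "cmod z = cmod w"
        using nz by simp
      with s show "z = w"
        using nz by (simp add: sgn_div_norm)
    qed
    show "qc_differentiable ((1 + (1/2 + B))^2 / (1/2)) (exp C * (1 + (1/2 + B))) (\<lambda>z. z * exp (of_real (u z))) z" if z: "z \<noteq> 0" for z
    proof -
      obtain \<alpha> \<beta> where D: "(u has_derivative (\<lambda>h. \<alpha> * Re (h / z) + \<beta> * Im (h / z))) (at z)" "\<bar>\<alpha>\<bar> \<le> 1/2" "\<bar>\<beta>\<bar> \<le> B"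
        using deriv[OF z] by blast
      have "((\<lambda>z. complex_of_real (u z)) has_derivative (\<lambda>h. of_real \<alpha> * of_real (Re (h / z)) + of_real \<beta> * of_real (Im (h / z)))) (at z)"
        using has_derivative_of_real[OF D(1)] by simp
      then show ?thesis
      proof (rule qc_differentiable_mult_exp[OF z])
        show "Re (of_real (u z)) \<le> C"
          using ub[OF z] by simp
        \<comment> \<open>For real \<open>\<alpha>\<close> and \<open>\<beta>\<close> the right side
          is \<open>1 + \<alpha>\<close>; the angular derivative cancels.\<close>
        show "1/2 \<le> (cmod (1 + (of_real \<alpha> - \<i> * of_real \<beta>) / 2))^2 - (cmod ((of_real \<alpha> + \<i> * of_real \<beta>) / 2))^2"
          unfolding cmod_power2 using D(2) by (simp add: power2_eq_square field_simps)
      qed (use D in auto)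
    qed
    show "u z = d j (ln (cmod z))" if "z \<noteq> 0" "j \<in> J" "sgn z = \<omega> j" for z j
    proof -
      have "\<omega> j * cnj (\<omega> j) = 1"
        using \<omega>[OF that(2)] by (simp add: complex_norm_square[symmetric])
      then have one: "\<rho> j (sgn z) = 1" "Re (sgn z * cnj (\<omega> j)) > \<kappa>"
        using that \<kappa> by (simp_all add: \<rho>_def)
      have "\<rho> i (sgn z) = 0" if "i \<in> J - {j}" for i
        using disj[of i j "sgn z"] one s1[OF \<open>z \<noteq> 0\<close>] that \<open>j \<in> J\<close> by (intro \<rho>0) force
      then show ?thesis
        unfolding u_def U_def by (subst sum.remove[OF J \<open>j \<in> J\<close>]) (simp add: one)
    qed
  qed
qed

text \<open>For unit vectors the squared distance is 2 minus twice the cosine. A cosine above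
  \<open>1 - \<delta>^2 / 8\<close> thus means a distance below \<open>\<delta> / 2\<close>, and no
  vector is that close to two members of a family with mutual distances at least
  \<open>\<delta>\<close>.\<close>

lemma unit_vectors_separated:
  assumes J: "finite J" and inj: "inj_on \<omega> J" and \<omega>: "\<And>j. j \<in> J \<Longrightarrow> cmod (\<omega> j) = 1"
  obtains \<kappa> where "\<kappa> < 1"
    "\<And>i j s. i \<in> J \<Longrightarrow> j \<in> J \<Longrightarrow> cmod s = 1 \<Longrightarrow> Re (s * cnj (\<omega> i)) > \<kappa> \<Longrightarrow> Re (s * cnj (\<omega> j)) > \<kappa> \<Longrightarrow> i = j"
proof -
  define P where "P = (\<lambda>(i, j). cmod (\<omega> i - \<omega> j)) ` {(i, j). i \<in> J \<and> j \<in> J \<and> i \<noteq> j}"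
  \<comment> \<open>Inserting 1 keeps the minimum meaningful for a family with fewer than two
    members.\<close>
  define \<delta> where "\<delta> = Min (insert 1 P)"
  have "finite {(i, j). i \<in> J \<and> j \<in> J \<and> i \<noteq> j}"
    by (rule finite_subset[of _ "J \<times> J"]) (use J in auto)
  then have fin: "finite P"
    by (simp add: P_def)
  have pos: "\<delta> > 0"
    using fin inj by (auto simp: \<delta>_def P_def inj_on_def)
  have le: "\<delta> \<le> cmod (\<omega> i - \<omega> j)" if "i \<in> J" "j \<in> J" "i \<noteq> j" for i j
    unfolding \<delta>_def using fin that by (intro Min_le) (auto simp: P_def)
  have near: "cmod (s - \<omega> i) < \<delta> / 2" if "i \<in> J" "cmod s = 1" "Re (s * cnj (\<omega> i)) > 1 - \<delta>^2 / 8" for s i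
  proof -
    have "(cmod (s - \<omega> i))^2 = (cmod s)^2 + (cmod (\<omega> i))^2 - 2 * Re (s * cnj (\<omega> i))"
      unfolding cmod_power2 by (simp add: power2_eq_square algebra_simps)
    also have "\<dots> < (\<delta> / 2)^2"
      using that \<omega> by (simp add: power_divide)
    finally show ?thesis
      by (rule power2_less_imp_less) (use pos in auto)
  qed
  show thesis
  proof (rule that[of "1 - \<delta>^2 / 8"])
    show "1 - \<delta>^2 / 8 < 1" using pos by simp
    fix i j s assume A: "i \<in> J" "j \<in> J" "cmod s = 1" "Re (s * cnj (\<omega> i)) > 1 - \<delta>^2 / 8" "Re (s * cnj (\<omega> j)) > 1 - \<delta>^2 / 8"
    have "cmod (\<omega> i - \<omega> j) \<le> cmod (s - \<omega> i) + cmod (s - \<omega> j)"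
      using norm_triangle_ineq4[of "s - \<omega> j" "s - \<omega> i"] by simp
    then show "i = j"
      using near[of i s] near[of j s] le[of i j] A by force
  qed
qed

lemma root_of_unity_int:
  fixes N :: int
  assumes "N > 0"
  defines "\<omega> \<equiv> (\<lambda>n::int. exp (\<i> * of_real (2 * pi / of_int N * of_int n)))"
  shows "inj_on \<omega> {0..<N}" and "\<omega> (k * N + j) = \<omega> j" and "cmod (\<omega> j) = 1"
proof -
  show "inj_on \<omega> {0..<N}"
  proof (rule inj_onI)
    fix i j assume ij: "i \<in> {0..<N}" "j \<in> {0..<N}" "\<omega> i = \<omega> j"
    then obtain n :: int where "\<i> * of_real (2 * pi / of_int N * of_int i) = \<i> * of_real (2 * pi / of_int N * of_int j) + of_real (of_int (2 * n) * pi) * \<i>"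
      unfolding \<omega>_def exp_eq by blast
    then have "2 * pi / of_int N * of_int i = 2 * pi / of_int N * of_int j + of_int (2 * n) * pi"
      by (simp add: complex_eq_iff)
    then have "(2 * pi) * (real_of_int i - of_int j) = (2 * pi) * (of_int n * of_int N)"
      using assms by (simp add: field_simps)
    then have "real_of_int (i - j) = of_int (n * N)"
      by (simp only: mult_cancel_left) simp
    then have "i - j = n * N"
      by (simp only: of_int_eq_iff)
    moreover have "\<bar>i - j\<bar> < N"
      using ij by auto
    ultimately have "n = 0"
      using assms by (auto simp: abs_mult)
    with \<open>i - j = n * N\<close> show "i = j" by simp
  qed
  have "\<i> * of_real (2 * pi / of_int N * of_int (k * N + j)) = \<i> * of_real (2 * pi / of_int N * of_int j) + of_real (of_int (2 * k) * pi) * \<i>"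
    using assms by (simp add: complex_eq_iff field_simps)
  then show "\<omega> (k * N + j) = \<omega> j"
    unfolding \<omega>_def exp_eq by blast
  show "cmod (\<omega> j) = 1"
    by (simp add: \<omega>_def norm_exp_eq_Re)
qed

lemma qc_differentiable_scale: "qc_differentiable 1 (exp c) (\<lambda>z. of_real (exp c) * z) z"
  unfolding qc_differentiable_def
  by (intro exI[of _ "of_real (exp c)"] exI[of _ 0]) (auto intro!: derivative_eq_intros)

text \<open>The twist by \<open>2 \<pi> ln \<bar>z\<bar> / N\<close> moves the points \<open>e\<^sup>n\<close> to \<open>N\<close> rays according to \<open>n mod N\<close>.  Along each ray they
  are far apart compared to the displacement, so a radial stretching permutes them; a second twist brings them back.\<close>

lemma bounded_displacement_extension:
  fixes C :: int
  assumes C: "0 \<le> C"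
  obtains K where "1 \<le> K"
    "\<And>\<tau> t. bij \<tau> \<Longrightarrow> (\<And>n. \<bar>\<tau> n - n\<bar> \<le> C) \<Longrightarrow>
       \<exists>F. quasiconformal_on K UNIV F \<and> (\<forall>n. F (exp (of_int n)) = exp (of_int (\<tau> n + t)))"
proof -
  \<comment> \<open>On one ray the logarithms of consecutive points differ by \<open>N\<close>,
    while their displacements differ by at most \<open>2 * C\<close>. The interpolant doubles the
    slope, giving \<open>4 * C / N\<close>, at most 1/2. The summand 8 keeps \<open>N\<close>
    positive when \<open>C\<close> is 0 and makes both twists have slope at most 7, an upper bound
    for \<open>2 * pi\<close>.\<close>
  define N where "N = 8 * C + 8"
  have N: "N > 0" "real_of_int N > 0" "real_of_int N \<ge> 8"
    using C by (auto simp: N_def)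
  define \<omega> where "\<omega> n = exp (\<i> * of_real (2 * pi / of_int N * of_int n))" for n :: int
  note root = root_of_unity_int[OF N(1), folded \<omega>_def]
  obtain \<kappa> where \<kappa>: "\<kappa> < 1"
    "\<And>i j s. i \<in> {0..<N} \<Longrightarrow> j \<in> {0..<N} \<Longrightarrow> cmod s = 1 \<Longrightarrow> Re (s * cnj (\<omega> i)) > \<kappa> \<Longrightarrow> Re (s * cnj (\<omega> j)) > \<kappa> \<Longrightarrow> i = j"
    using unit_vectors_separated[OF _ root(1,3)] by (metis finite_atLeastLessThan_int)
  define B where "B = of_nat (card {0..<N}) * (2 / (1 - \<kappa>) * real_of_int C)"
  have B: "B \<ge> 0"
    using \<kappa> C by (simp add: B_def)
  define R where "R = (1 + (1/2 + B))^2 / (1/2)"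
  \<comment> \<open>The factors belong to the scaling, the second twist, the radial stretching and
    the first twist. Every one is fixed by \<open>C\<close> before the permutation and the shift are
    given.\<close>
  define K where "K = 1 * ((1 + 7)^2 * (R * (1 + 7)^2))"
  have "1 \<le> (1 + (1/2 + B))^2"
    using B by (intro one_le_power) auto
  then have "1 \<le> R"
    by (simp add: R_def)
  then have K: "1 \<le> K"
    by (simp add: K_def)
  have "\<exists>F. quasiconformal_on K UNIV F \<and> (\<forall>n. F (exp (of_int n)) = exp (of_int (\<tau> n + t)))"
    if \<tau>: "bij \<tau>" and disp: "\<And>n. \<bar>\<tau> n - n\<bar> \<le> C" for \<tau> t
  proof -
    have pi7: "2 * pi \<le> 7"
      using pi_less_4 pi_approx by simp
    define g where "g x = 2 * pi / of_int N * x" for x :: real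
    define T where "T z = z * exp (\<i> * of_real (g (ln (cmod z))))" for z
    have g: "\<exists>D. (g has_real_derivative D) (at x) \<and> \<bar>D\<bar> \<le> 7" for x
    proof (intro exI conjI)
      show "(g has_real_derivative 2 * pi / of_int N) (at x)"
        unfolding g_def using N by (auto intro!: derivative_eq_intros)
      have "2 * pi / of_int N \<le> 7 / 1"
        using N pi7 by (intro frac_le) auto
      then show "\<bar>2 * pi / of_int N\<bar> \<le> 7"
        using N by simp
    qed
    note T = twist_map[OF g, folded T_def]
    \<comment> \<open>The point that has arrived at modulus \<open>exp m\<close> started as
      \<open>exp n\<close> with \<open>n = inv \<tau> m\<close> and was rotated by
      \<open>2 * pi * n / N\<close>; the second twist has to undo exactly this angle.\<close>
    define v where "v m = - (2 * pi / of_int N) * real_of_int (inv \<tau> m)" for m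
    have inv: "\<bar>inv \<tau> m - m\<bar> \<le> C" for m
      using disp[of "inv \<tau> m"] \<tau> by (simp add: bij_is_surj surj_f_inv_f abs_minus_commute)
    have v: "\<bar>v (m + 1) - v m\<bar> \<le> 7/2" for m
    proof -
      have "\<bar>v (m + 1) - v m\<bar> = 2 * pi / of_int N * real_of_int \<bar>inv \<tau> (m + 1) - inv \<tau> m\<bar>"
      proof -
        have "v (m + 1) - v m = - (2 * pi / of_int N) * real_of_int (inv \<tau> (m + 1) - inv \<tau> m)"
          by (simp add: v_def algebra_simps)
        then show ?thesis
          using N by (simp only: abs_mult abs_minus_cancel of_int_abs) simp
      qed
      also have "\<dots> \<le> 2 * pi / of_int N * real_of_int (2 * C + 1)"
        using inv[of m] inv[of "m + 1"] N by (intro mult_left_mono, unfold of_int_le_iff) auto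
      also have "\<dots> = 2 * pi * (real_of_int (2 * C + 1) / of_int N)"
        by simp
      also have "\<dots> \<le> 7 * (1/2)"
        using N C pi7 by (intro mult_mono) (auto simp: N_def field_simps)
      finally show ?thesis by simp
    qed
    define T' where "T' z = z * exp (\<i> * of_real (interpolate v (ln (cmod z))))" for z
    have "\<exists>D. (interpolate v has_real_derivative D) (at x) \<and> \<bar>D\<bar> \<le> 7" for x
      using interpolate_derivative[of v "7/2" x, OF v] by force
    note T' = twist_map[OF this, folded T'_def]
    \<comment> \<open>The points on ray \<open>j\<close> are those with
      \<open>n = k * N + j\<close>. At logarithmic radius \<open>n\<close> the interpolant is
      evaluated at the integer \<open>k\<close> and returns the displacement
      \<open>\<tau> n - n\<close>.\<close>
    define d where "d j x = interpolate (\<lambda>k. real_of_int (\<tau> (k * N + j) - (k * N + j))) ((x - of_int j) / of_int N)" for j x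
    have d: "\<exists>D. (d j has_real_derivative D) (at x) \<and> \<bar>D\<bar> \<le> 1/2" for j x
    proof -
      let ?w = "\<lambda>k. real_of_int (\<tau> (k * N + j) - (k * N + j))"
      have w: "\<bar>?w (k + 1) - ?w k\<bar> \<le> 2 * real_of_int C" for k
      proof -
        have "\<bar>?w (k + 1)\<bar> \<le> of_int C" "\<bar>?w k\<bar> \<le> of_int C"
          using disp by (simp_all only: of_int_le_iff flip: of_int_abs)
        then show ?thesis by linarith
      qed
      obtain D where D: "(interpolate ?w has_real_derivative D) (at ((x - of_int j) / of_int N))" "\<bar>D\<bar> \<le> 2 * (2 * of_int C)"
        by (rule interpolate_derivative[of ?w, OF w])
      have "((\<lambda>x. (x - of_int j) / of_int N) has_real_derivative 1 / of_int N) (at x)"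
        using N by (auto intro!: derivative_eq_intros)
      from DERIV_chain2[where g="\<lambda>x. (x - of_int j) / of_int N" and x=x, OF D(1) this]
      have "(d j has_real_derivative D * (1 / of_int N)) (at x)"
        by (simp add: d_def[abs_def])
      moreover have "\<bar>D * (1 / of_int N)\<bar> \<le> 1/2"
        using D(2) N C by (simp add: abs_mult N_def field_simps)
      ultimately show ?thesis by blast
    qed
    have dC: "\<bar>d j x\<bar> \<le> of_int C" for j x
      unfolding d_def using disp by (intro interpolate_bound) (simp only: of_int_le_iff flip: of_int_abs)
    have fin: "finite {0..<N}" and C0: "0 \<le> real_of_int C"
      using C by simp_all
    obtain u where u: "isotopic_to_id (\<lambda>z. z * exp (of_real (u z)))"
      "\<And>z. z \<noteq> 0 \<Longrightarrow> qc_differentiable R (exp C * (1 + (1/2 + B))) (\<lambda>z. z * exp (of_real (u z))) z"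
      "\<And>z j. z \<noteq> 0 \<Longrightarrow> j \<in> {0..<N} \<Longrightarrow> sgn z = \<omega> j \<Longrightarrow> u z = d j (ln (cmod z))"
    proof (rule radial_map[of "{0..<N}" \<omega> \<kappa> d "of_int C", folded B_def, folded R_def, OF fin root(3) \<kappa>(1) _ d dC C0])
      show "i = j" if "i \<in> {0..<N}" "j \<in> {0..<N}" "cmod s = 1" "Re (s * cnj (\<omega> i)) > \<kappa>" "Re (s * cnj (\<omega> j)) > \<kappa>" for i j s
        using that by (rule \<kappa>(2))
    qed (rule that)
    define P where "P z = z * exp (of_real (u z))" for z
    define F where "F z = of_real (exp (of_int t)) * T' (P (T z))" for z
    have "isotopic_to_id F"
      unfolding F_def using isotopic_to_id_compose[OF isotopic_to_id_compose[OF isotopic_to_id_compose[OF T(1) u(1)[folded P_def]] T'(1)] isotopic_to_id_scale[of "of_int t"]] .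
    moreover have "qc_differentiable K (exp (of_int t) * ((1 + 7) * (exp C * (1 + (1/2 + B)) * (1 + 7)))) F z" if "z \<noteq> 0" for z
    proof -
      have "T z \<noteq> 0" "P (T z) \<noteq> 0"
        using that by (auto simp: T_def P_def)
      then show ?thesis
        unfolding F_def K_def
        by (intro qc_differentiable_compose[where F="\<lambda>z. T' (P (T z))" and G="\<lambda>z. of_real (exp (of_int t)) * z"]
              qc_differentiable_compose[where F="\<lambda>z. P (T z)" and G=T'] qc_differentiable_compose[where F=T and G=P]
              qc_differentiable_scale T T' u(2)[folded P_def] that)
    qed
    ultimately have "quasiconformal_on K UNIV F"
      using quasiconformal_on_UNIV_I[OF _ K] by blast
    moreover have "F (exp (of_int n)) = exp (of_int (\<tau> n + t))" for n :: int
    proof -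
      define k j where "k = n div N" and "j = n mod N"
      have n: "n = k * N + j" "j \<in> {0..<N}"
        using N by (auto simp: k_def j_def)
      have "T (exp (of_int n)) = of_real (exp (of_int n)) * \<omega> n"
        by (simp add: T_def \<omega>_def g_def norm_exp_eq_Re exp_of_real[symmetric])
      then have Tn: "T (exp (of_int n)) = of_real (exp (of_int n)) * \<omega> n" "cmod (T (exp (of_int n))) = exp (of_int n)"
        using root(3)[of n] by (simp_all add: norm_mult norm_exp_eq_Re)
      have "sgn (T (exp (of_int n))) = \<omega> n"
        unfolding sgn_div_norm Tn(2) unfolding Tn(1) by (simp add: scaleR_conv_of_real)
      also have "\<dots> = \<omega> j"
        unfolding n(1) by (rule root(2))
      finally have "u (T (exp (of_int n))) = d j (of_int n)"
        using u(3)[of "T (exp (of_int n))" j] n(2) Tn by force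
      also have "(of_int n - of_int j) / of_int N = real_of_int k"
        using N n(1) by simp
      then have "d j (of_int n) = of_int (\<tau> n - n)"
        unfolding d_def by (simp only: interpolate_of_int n(1)[symmetric])
      finally have "P (T (exp (of_int n))) = of_real (exp (of_int n)) * \<omega> n * of_real (exp (of_int (\<tau> n - n)))"
        unfolding P_def by (simp add: Tn exp_of_real[symmetric])
      also have "\<dots> = of_real (exp (of_int (\<tau> n))) * \<omega> n"
        by (simp add: exp_diff)
      finally have Pn: "P (T (exp (of_int n))) = of_real (exp (of_int (\<tau> n))) * \<omega> n"
        "cmod (P (T (exp (of_int n)))) = exp (of_int (\<tau> n))"
        using root(3)[of n] by (simp_all add: norm_mult norm_exp_eq_Re)
      have "v (\<tau> n) = - (2 * pi / of_int N * of_int n)"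
        using \<tau> by (simp add: v_def bij_is_inj inv_f_f)
      then have "T' (P (T (exp (of_int n)))) = of_real (exp (of_int (\<tau> n))) * (\<omega> n * exp (- (\<i> * of_real (2 * pi / of_int N * of_int n))))"
        unfolding T'_def Pn(2) unfolding Pn(1) by simp
      also have "\<omega> n * exp (- (\<i> * of_real (2 * pi / of_int N * of_int n))) = 1"
        unfolding \<omega>_def by (simp add: exp_minus)
      finally have "F (exp (of_int n)) = of_real (exp (of_int t)) * of_real (exp (of_int (\<tau> n)))"
        unfolding F_def by simp
      then show ?thesis
        by (simp add: exp_add exp_of_real[symmetric] mult.commute)
    qed
    ultimately show ?thesis by blast
  qed
  with K that show thesis by blast
qed

section \<open>Lebesgue points\<close>

text \<open>The measure with density \<open>f\<close> vanishes on \<open>S\<close>, so by outer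
  regularity \<open>S\<close> has an open neighbourhood \<open>U\<close> of tiny mass. Around a bad
  point there are arbitrarily small balls in \<open>U\<close> whose mass exceeds
  \<open>\<epsilon>\<close> times their volume. By Vitali, disjoint ones cover almost all bad
  points, and their total volume is at most the mass of \<open>U\<close> divided by
  \<open>\<epsilon>\<close>.\<close>

lemma zero_density_of_vanishing:
  fixes f :: "'a::euclidean_space \<Rightarrow> ennreal"
  assumes f [measurable]: "f \<in> borel_measurable borel" and fin: "(\<integral>\<^sup>+x. f x \<partial>lborel) < \<infinity>"
    and S [measurable]: "S \<in> sets borel" and zero: "\<And>x. x \<in> S \<Longrightarrow> f x = 0"
  shows "AE x in lborel. x \<in> S \<longrightarrow> (\<forall>\<epsilon>>0. \<exists>\<delta>>0. \<forall>r. 0 < r \<and> r < \<delta> \<longrightarrow>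
    (\<integral>\<^sup>+y\<in>ball x r. f y \<partial>lborel) \<le> ennreal \<epsilon> * emeasure lborel (ball x r))"
proof -
  define \<nu> where "\<nu> = density lborel f"
  have [measurable_cong, simp]: "sets \<nu> = sets borel"
    by (simp add: \<nu>_def)
  have \<nu>: "emeasure \<nu> A = (\<integral>\<^sup>+y\<in>A. f y \<partial>lborel)" if "A \<in> sets borel" for A
    using that by (simp add: \<nu>_def emeasure_density)
  define bad where "bad \<epsilon> = {x\<in>S. \<forall>\<delta>>0. \<exists>r. 0 < r \<and> r < \<delta> \<and> ennreal \<epsilon> * emeasure lborel (ball x r) < emeasure \<nu> (ball x r)}" for \<epsilon> :: real
  have neg: "negligible (bad \<epsilon>)" if \<epsilon>: "\<epsilon> > 0" for \<epsilon>
    unfolding negligible_outer_le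
  proof (intro allI impI)
    fix e :: real assume e: "e > 0"
    have "emeasure \<nu> S = 0"
      using zero by (auto simp: \<nu> nn_integral_0_iff_AE indicator_def intro!: AE_I2)
    moreover have "emeasure \<nu> (space \<nu>) \<noteq> \<infinity>"
      using fin by (simp add: \<nu>_def emeasure_density)
    ultimately have "(INF U \<in> {U. S \<subseteq> U \<and> open U}. emeasure \<nu> U) < ennreal (\<epsilon> * e)"
      using outer_regular[of \<nu> S] \<epsilon> e by simp
    then obtain U where U: "S \<subseteq> U" "open U" "emeasure \<nu> U < ennreal (\<epsilon> * e)"
      by (auto simp: INF_less_iff)
    define K where "K = {(x, r). 0 < r \<and> ball x r \<subseteq> U \<and> ennreal \<epsilon> * emeasure lborel (ball x r) < emeasure \<nu> (ball x r)}"
    have cover: "\<exists>i. i \<in> K \<and> x \<in> ball (fst i) (snd i) \<and> snd i < d" if x: "x \<in> bad \<epsilon>" and d: "0 < d" for x d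
    proof -
      have "x \<in> U" using x U by (auto simp: bad_def)
      then obtain \<rho> where \<rho>: "\<rho> > 0" "ball x \<rho> \<subseteq> U"
        using U(2) open_contains_ball by blast
      obtain r where r: "0 < r" "r < min \<rho> d" "ennreal \<epsilon> * emeasure lborel (ball x r) < emeasure \<nu> (ball x r)"
      proof -
        have "\<forall>\<delta>>0. \<exists>r. 0 < r \<and> r < \<delta> \<and> ennreal \<epsilon> * emeasure lborel (ball x r) < emeasure \<nu> (ball x r)"
          using x by (simp add: bad_def)
        from this[rule_format, of "min \<rho> d"] \<rho> d show thesis
          using that by auto
      qed
      have "ball x r \<subseteq> U"
        using \<rho>(2) r(2) by force
      then show ?thesis
        using r by (intro exI[of _ "(x, r)"]) (auto simp: K_def)
    qed
    obtain C where C: "countable C" "C \<subseteq> K" "pairwise (\<lambda>i j. disjnt (ball (fst i) (snd i)) (ball (fst j) (snd j))) C"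
      and N: "negligible (bad \<epsilon> - (\<Union>i\<in>C. ball (fst i) (snd i)))"
      by (rule Vitali_covering_theorem_balls[of "bad \<epsilon>" K fst snd]) (use cover in blast)+
    define W where "W = (\<Union>i\<in>C. ball (fst i) (snd i))"
    have W [measurable]: "open W"
      unfolding W_def by blast
    have disj: "disjoint_family_on (\<lambda>i. ball (fst i) (snd i)) C"
      using C(3) by (auto simp: disjoint_family_on_def pairwise_def disjnt_def)
    have "ennreal \<epsilon> * emeasure lborel W = ennreal \<epsilon> * (\<integral>\<^sup>+i. emeasure lborel (ball (fst i) (snd i)) \<partial>count_space C)"
      unfolding W_def by (subst emeasure_UN_countable) (use C disj in auto)
    also have "\<dots> = (\<integral>\<^sup>+i. ennreal \<epsilon> * emeasure lborel (ball (fst i) (snd i)) \<partial>count_space C)"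
      by (simp add: nn_integral_cmult)
    also have "\<dots> \<le> (\<integral>\<^sup>+i. emeasure \<nu> (ball (fst i) (snd i)) \<partial>count_space C)"
      using C(2) by (intro nn_integral_mono) (auto simp: K_def)
    also have "\<dots> = emeasure \<nu> W"
      unfolding W_def by (subst emeasure_UN_countable) (use C disj in auto)
    also have "\<dots> \<le> emeasure \<nu> U"
    proof (rule emeasure_mono)
      have "ball (fst i) (snd i) \<subseteq> U" if "i \<in> C" for i
        using subsetD[OF C(2) that] by (cases i) (simp add: K_def)
      then show "W \<subseteq> U"
        by (auto simp: W_def)
    qed (use U in simp)
    also have "\<dots> \<le> ennreal (\<epsilon> * e)"
      using U by simp
    finally have "ennreal \<epsilon> * emeasure lborel W \<le> ennreal \<epsilon> * ennreal e"
      using \<epsilon> e by (simp add: ennreal_mult)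
    then have We: "emeasure lborel W \<le> ennreal e"
      using \<epsilon> by (simp add: ennreal_mult_le_mult_iff)
    let ?N = "bad \<epsilon> - W"
    have N': "?N \<in> lmeasurable" "measure lebesgue ?N = 0"
      using N by (auto simp: W_def negligible_imp_measurable negligible_imp_measure0)
    have W': "W \<in> lmeasurable" "measure lebesgue W \<le> e"
      using We e W by (auto simp: fmeasurable_def measure_def intro!: enn2real_leI order_le_less_trans[OF We])
    show "\<exists>T. bad \<epsilon> \<subseteq> T \<and> T \<in> lmeasurable \<and> measure lebesgue T \<le> e"
    proof (intro exI conjI)
      show "bad \<epsilon> \<subseteq> W \<union> ?N" by blast
      show "W \<union> ?N \<in> lmeasurable"
        using N' W' by (rule_tac fmeasurable.Un)
      show "measure lebesgue (W \<union> ?N) \<le> e"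
        using measure_Un_le[of W lebesgue ?N] N' W' by (auto simp: fmeasurable_def)
    qed
  qed
  have "AE x in lborel. \<forall>k::nat. x \<notin> bad (1 / real (Suc k))"
  proof (subst AE_all_countable, rule allI)
    fix k :: nat
    have "AE x in lebesgue. x \<notin> bad (1 / real (Suc k))"
      using neg[of "1 / real (Suc k)"] by (intro AE_not_in) (simp add: negligible_iff_null_sets)
    then show "AE x in lborel. x \<notin> bad (1 / real (Suc k))"
      by (simp add: AE_completion_iff)
  qed
  then show ?thesis
  proof eventually_elim
    case (elim x)
    show ?case
    proof (intro impI allI)
      fix \<epsilon> :: real assume x: "x \<in> S" and \<epsilon>: "\<epsilon> > 0"
      obtain k where k: "1 / real (Suc k) < \<epsilon>"
        using \<epsilon> nat_approx_posE by metis
      have "x \<notin> bad (1 / real (Suc k))"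
        using elim by blast
      then obtain \<delta> where \<delta>: "\<delta> > 0" "\<And>r. 0 < r \<Longrightarrow> r < \<delta> \<Longrightarrow> \<not> ennreal (1 / real (Suc k)) * emeasure lborel (ball x r) < emeasure \<nu> (ball x r)"
        using x unfolding bad_def by blast
      have "(\<integral>\<^sup>+y\<in>ball x r. f y \<partial>lborel) \<le> ennreal \<epsilon> * emeasure lborel (ball x r)" if "0 < r" "r < \<delta>" for r
      proof -
        have "(\<integral>\<^sup>+y\<in>ball x r. f y \<partial>lborel) \<le> ennreal (1 / real (Suc k)) * emeasure lborel (ball x r)"
          using \<delta>(2)[OF that] by (simp add: \<nu> not_less)
        also have "\<dots> \<le> ennreal \<epsilon> * emeasure lborel (ball x r)"
          using k by (intro mult_right_mono ennreal_leI) auto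
        finally show ?thesis .
      qed
      then show "\<exists>\<delta>>0. \<forall>r. 0 < r \<and> r < \<delta> \<longrightarrow> (\<integral>\<^sup>+y\<in>ball x r. f y \<partial>lborel) \<le> ennreal \<epsilon> * emeasure lborel (ball x r)"
        using \<delta>(1) by blast
    qed
  qed
qed

definition lebesgue_point :: "('a::euclidean_space \<Rightarrow> 'b::euclidean_space) \<Rightarrow> 'a \<Rightarrow> bool" where
  "lebesgue_point g x \<longleftrightarrow> (\<forall>\<epsilon>>0. \<exists>\<delta>>0. \<forall>r. 0 < r \<and> r < \<delta> \<longrightarrow>
    (\<integral>\<^sup>+y\<in>ball x r. ennreal (norm (g y - g x)) \<partial>lborel) \<le> ennreal \<epsilon> * emeasure lborel (ball x r))"

text \<open>Reduction to the vanishing case: for \<open>q\<close> in a countable dense set, truncate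
  the distance of \<open>g\<close> from \<open>q\<close> to 0 on the set \<open>S q k m\<close>
  where it is already small. Almost every point of that set is a point of zero density for what
  remains, and every \<open>x\<close> lies in such sets with \<open>q\<close> as close to
  \<open>g x\<close> as desired.\<close>

lemma AE_lebesgue_point:
  fixes g :: "'a::euclidean_space \<Rightarrow> 'b::euclidean_space"
  assumes g [measurable]: "g \<in> borel_measurable borel"
    and int: "\<And>R. (\<integral>\<^sup>+y\<in>ball 0 R. ennreal (norm (g y)) \<partial>lborel) < \<infinity>"
  shows "AE x in lborel. lebesgue_point g x"
proof -
  obtain D :: "'b set" where D: "countable D" "\<And>X. open X \<Longrightarrow> X \<noteq> {} \<Longrightarrow> \<exists>d\<in>D. d \<in> X"
    using countable_dense_setE by blast
  define S where "S q k m = {x \<in> ball 0 (real m). norm (g x - q) \<le> 1 / real (Suc k)}" for q :: 'b and k m :: nat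
  define f where "f q k m y = ennreal (norm (g y - q)) * indicator (ball 0 (real m) - S q k m) y" for q k m y
  have [measurable]: "ball (c::'a) r \<in> sets borel" for c r
    by simp
  have S [measurable]: "S q k m \<in> sets borel" for q k m
    unfolding S_def by measurable
  have "AE x in lborel. x \<in> S q k m \<longrightarrow> (\<forall>\<epsilon>>0. \<exists>\<delta>>0. \<forall>r. 0 < r \<and> r < \<delta> \<longrightarrow>
    (\<integral>\<^sup>+y\<in>ball x r. f q k m y \<partial>lborel) \<le> ennreal \<epsilon> * emeasure lborel (ball x r))" for q k m
  proof (rule zero_density_of_vanishing)
    show "f q k m \<in> borel_measurable borel"
      unfolding f_def by (intro borel_measurable_times_ennreal borel_measurable_indicator) auto
    have "(\<integral>\<^sup>+x. f q k m x \<partial>lborel) \<le> (\<integral>\<^sup>+x. ennreal (norm (g x)) * indicator (ball 0 (real m)) x + ennreal (norm q) * indicator (ball 0 (real m)) x \<partial>lborel)"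
      using norm_triangle_ineq4[of "g _" q] by (intro nn_integral_mono) (auto simp: f_def indicator_def ennreal_plus[symmetric] simp del: ennreal_plus)
    also have "\<dots> = (\<integral>\<^sup>+y\<in>ball 0 (real m). ennreal (norm (g y)) \<partial>lborel) + ennreal (norm q) * emeasure lborel (ball (0::'a) (real m))"
      by (subst nn_integral_add) (auto simp: nn_integral_cmult)
    also have "\<dots> < \<infinity>"
      using int[of "real m"] emeasure_bounded_finite[of "ball (0::'a) (real m)"] by (simp add: ennreal_mult_less_top)
    finally show "(\<integral>\<^sup>+x. f q k m x \<partial>lborel) < \<infinity>" .
  qed (auto simp: f_def)
  then have "AE x in lborel. \<forall>q\<in>D. \<forall>k m. x \<in> S q k m \<longrightarrow> (\<forall>\<epsilon>>0. \<exists>\<delta>>0. \<forall>r. 0 < r \<and> r < \<delta> \<longrightarrow>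
    (\<integral>\<^sup>+y\<in>ball x r. f q k m y \<partial>lborel) \<le> ennreal \<epsilon> * emeasure lborel (ball x r))"
    using D(1) by (simp add: AE_ball_countable AE_all_countable)
  then show ?thesis
  proof eventually_elim
    case (elim x)
    show ?case
      unfolding lebesgue_point_def
    proof (intro allI impI)
      fix \<epsilon> :: real assume \<epsilon>: "\<epsilon> > 0"
      then obtain k where k: "1 / real (Suc k) < \<epsilon> / 3"
        using nat_approx_posE[of "\<epsilon> / 3"] by auto
      obtain q where q: "q \<in> D" "q \<in> ball (g x) (1 / real (Suc k))"
        using D(2)[of "ball (g x) (1 / real (Suc k))"] by auto
      obtain m where m: "norm x < real m"
        using reals_Archimedean2 by blast
      have xS: "x \<in> S q k m"
        using q m by (simp add: S_def dist_norm)
      obtain \<delta> where \<delta>: "\<delta> > 0" "\<And>r. 0 < r \<Longrightarrow> r < \<delta> \<Longrightarrow> (\<integral>\<^sup>+y\<in>ball x r. f q k m y \<partial>lborel) \<le> ennreal (\<epsilon>/3) * emeasure lborel (ball x r)"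
        using elim[rule_format, OF q(1) xS, of "\<epsilon> / 3"] \<epsilon> by auto
      have "(\<integral>\<^sup>+y\<in>ball x r. ennreal (norm (g y - g x)) \<partial>lborel) \<le> ennreal \<epsilon> * emeasure lborel (ball x r)"
        if r: "0 < r" "r < min \<delta> (real m - norm x)" for r
      proof -
        \<comment> \<open>One third of \<open>\<epsilon>\<close> is left for the mean of the
          truncated function; the other two bound the distances of \<open>g x\<close> and, inside
          \<open>S q k m\<close>, of \<open>g y\<close> from \<open>q\<close>.\<close>
        have pt: "ennreal (norm (g y - g x)) \<le> f q k m y + ennreal (2 * (\<epsilon>/3))" if "y \<in> ball x r" for y
        proof -
          have "norm y < real m"
            using that r norm_triangle_ineq[of x "y - x"] by (auto simp: dist_norm norm_minus_commute)
          have xq: "norm (g x - q) < \<epsilon> / 3"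
            using q k by (simp add: dist_norm)
          have tri: "norm (g y - g x) \<le> norm (g y - q) + norm (g x - q)"
            using norm_triangle_ineq4[of "g y - q" "g x - q"] by simp
          show ?thesis
          proof (cases "y \<in> S q k m")
            case True
            then have "norm (g y - g x) \<le> 2 * (\<epsilon>/3)"
              using tri xq k by (simp add: S_def)
            then have "ennreal (norm (g y - g x)) \<le> ennreal (2 * (\<epsilon>/3))"
              by (rule ennreal_leI)
            then show ?thesis
              by (simp add: add_increasing)
          next
            case False
            then have "f q k m y = ennreal (norm (g y - q))"
              using \<open>norm y < real m\<close> by (simp add: f_def)
            moreover have "ennreal (norm (g y - g x)) \<le> ennreal (norm (g y - q) + 2 * (\<epsilon>/3))"
              using tri xq \<epsilon> by (intro ennreal_leI) linarith
            ultimately show ?thesis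
              using \<epsilon> by simp
          qed
        qed
        have "(\<integral>\<^sup>+y\<in>ball x r. ennreal (norm (g y - g x)) \<partial>lborel) \<le> (\<integral>\<^sup>+y. f q k m y * indicator (ball x r) y + ennreal (2 * (\<epsilon>/3)) * indicator (ball x r) y \<partial>lborel)"
          using pt by (intro nn_integral_mono) (auto simp: indicator_def)
        also have "\<dots> = (\<integral>\<^sup>+y\<in>ball x r. f q k m y \<partial>lborel) + ennreal (2 * (\<epsilon>/3)) * emeasure lborel (ball x r)"
          unfolding f_def by (subst nn_integral_add) (auto simp: nn_integral_cmult)
        also have "\<dots> \<le> ennreal (\<epsilon>/3) * emeasure lborel (ball x r) + ennreal (2 * (\<epsilon>/3)) * emeasure lborel (ball x r)"
          using \<delta>(2)[of r] r by (intro add_right_mono) auto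
        also have "\<dots> = ennreal \<epsilon> * emeasure lborel (ball x r)"
          using \<epsilon> by (simp add: distrib_right[symmetric] ennreal_plus[symmetric] del: ennreal_plus)
        finally show ?thesis .
      qed
      then show "\<exists>\<delta>>0. \<forall>r. 0 < r \<and> r < \<delta> \<longrightarrow> (\<integral>\<^sup>+y\<in>ball x r. ennreal (norm (g y - g x)) \<partial>lborel) \<le> ennreal \<epsilon> * emeasure lborel (ball x r)"
        using \<delta>(1) m by (intro exI[of _ "min \<delta> (real m - norm x)"]) auto
    qed
  qed
qed

section \<open>Smooth cutoff functions\<close>

text \<open>With \<open>s = 1 / t\<close>, the derivative of \<open>p(s) exp (- s)\<close> with
  respect to \<open>t\<close> is \<open>s^2 (p(s) - p'(s)) exp (- s)\<close>.\<close>

fun flat_poly :: "nat \<Rightarrow> real poly" where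
  "flat_poly 0 = 1"
| "flat_poly (Suc k) = [:0, 0, 1:] * (flat_poly k - pderiv (flat_poly k))"

text \<open>\<open>flat k\<close> is the \<open>k\<close>-th derivative of \<open>exp (-1/t)\<close> extended by \<open>0\<close> to \<open>t \<le> 0\<close>.\<close>

definition flat :: "nat \<Rightarrow> real \<Rightarrow> real" where
  "flat k t = (if t \<le> 0 then 0 else poly (flat_poly k) (1 / t) * exp (- (1 / t)))"

lemma poly_times_exp_tendsto_0: "((\<lambda>s::real. poly p s * exp (- s)) \<longlongrightarrow> 0) at_top"
proof -
  have "((\<lambda>s. \<Sum>i\<le>degree p. coeff p i * (s ^ i / exp s)) \<longlongrightarrow> (\<Sum>i\<le>degree p. coeff p i * 0)) at_top"
    by (intro tendsto_intros tendsto_power_div_exp_0)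
  then show ?thesis
    by (simp add: poly_altdef sum_distrib_right exp_minus divide_inverse mult.assoc)
qed

text \<open>At 0 the right difference quotient is again a polynomial in \<open>1 / h\<close> times
  \<open>exp (- 1 / h)\<close>, one degree higher, and tends to 0 because the exponential
  wins.\<close>

lemma flat_has_derivative: "(flat k has_real_derivative flat (Suc k) t) (at t)"
proof (cases t "0::real" rule: linorder_cases)
  case less
  have "((\<lambda>_. 0) has_real_derivative 0) (at t)"
    by simp
  then have "(flat k has_real_derivative 0) (at t)"
    by (rule has_field_derivative_transform_within_open[where S="{..<0}"]) (use less in \<open>auto simp: flat_def\<close>)
  then show ?thesis
    using less by (simp add: flat_def)
next
  case greater
  let ?p = "flat_poly k"
  have "((\<lambda>t. poly ?p (1 / t) * exp (- (1 / t))) has_real_derivative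
     poly ?p (1 / t) * (exp (- (1 / t)) * (1 / t^2)) + (poly (pderiv ?p) (1 / t) * (- (1 / t^2))) * exp (- (1 / t))) (at t)"
    using greater by (auto intro!: derivative_eq_intros DERIV_chain2[OF poly_DERIV] simp: power2_eq_square)
  also have "poly ?p (1 / t) * (exp (- (1 / t)) * (1 / t^2)) + (poly (pderiv ?p) (1 / t) * (- (1 / t^2))) * exp (- (1 / t)) = flat (Suc k) t"
    using greater by (simp add: flat_def power2_eq_square algebra_simps)
  finally show ?thesis
    by (rule has_field_derivative_transform_within_open[where S="{0<..}"]) (use greater in \<open>auto simp: flat_def\<close>)
next
  case equal
  have "((\<lambda>h. flat k h / h) \<longlongrightarrow> 0) (at_right 0)"
  proof -
    have "((\<lambda>h. poly ([:0, 1:] * flat_poly k) (inverse h) * exp (- inverse h)) \<longlongrightarrow> 0) (at_right 0)"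
      by (rule filterlim_compose[OF poly_times_exp_tendsto_0 filterlim_inverse_at_top_right])
    moreover have "\<forall>\<^sub>F h in at_right 0. poly ([:0, 1:] * flat_poly k) (inverse h) * exp (- inverse h) = flat k h / h"
      using eventually_at_right_less[of 0] by eventually_elim (simp add: flat_def divide_inverse)
    ultimately show ?thesis
      by (rule Lim_transform_eventually)
  qed
  moreover have "((\<lambda>h. flat k h / h) \<longlongrightarrow> 0) (at_left 0)"
  proof (rule tendsto_eventually)
    show "\<forall>\<^sub>F h in at_left 0. flat k h / h = 0"
      using eventually_at_left_real[of "-1" 0] by (auto elim!: eventually_mono simp: flat_def)
  qed
  ultimately have "((\<lambda>h. flat k h / h) \<longlongrightarrow> 0) (at 0)"
    by (rule filterlim_split_at[rotated])
  then show ?thesis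
    using equal by (simp add: DERIV_def flat_def[of _ 0])
qed

lemma continuous_flat: "continuous_on A (flat k)"
  by (meson DERIV_isCont continuous_at_imp_continuous_on flat_has_derivative)

lemma flat_0_bounds: "0 \<le> flat 0 t" "flat 0 t \<le> 1"
  by (auto simp: flat_def)

lemma flat_nonpos [simp]: "t \<le> 0 \<Longrightarrow> flat k t = 0"
  by (simp add: flat_def)

lemma flat_1_nonneg: "0 \<le> flat 1 t"
  by (simp add: flat_def)

lemma flat_0_tendsto_1: "(flat 0 \<longlongrightarrow> 1) at_top"
proof -
  have "((\<lambda>t::real. exp (- inverse t)) \<longlongrightarrow> exp (- 0)) at_top"
    by (intro tendsto_intros tendsto_inverse_0_at_top filterlim_ident)
  moreover have "\<forall>\<^sub>F t in at_top. exp (- inverse t) = flat 0 t"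
    using eventually_gt_at_top[of 0] by eventually_elim (simp add: flat_def divide_inverse)
  ultimately show ?thesis
    using Lim_transform_eventually by force
qed

lemma C_k_Suc_imp: "C_k (Suc k) \<phi> \<Longrightarrow> C_k k \<phi>"
proof (induction k arbitrary: \<phi>)
  case 0
  then show ?case
    by (simp add: differentiable_imp_continuous_on)
next
  case (Suc k)
  then show ?case
    by (metis C_k.simps(2))
qed

lemma C_k_const: "C_k k (\<lambda>x. c)"
  by (induction k arbitrary: c) auto

lemma C_k_add:
  assumes "C_k k \<phi>" "C_k k \<psi>" shows "C_k k (\<lambda>x. \<phi> x + \<psi> x)"
  using assms
proof (induction k arbitrary: \<phi> \<psi>)
  case 0
  then show ?case by (simp add: continuous_on_add)
next
  case (Suc k)
  have d: "\<phi> differentiable at x" "\<psi> differentiable at x" for x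
    using Suc.prems by (auto simp: differentiable_on_def)
  have "frechet_derivative (\<lambda>x. \<phi> x + \<psi> x) (at x) = (\<lambda>v. frechet_derivative \<phi> (at x) v + frechet_derivative \<psi> (at x) v)" for x
    by (rule frechet_derivative_at[symmetric] has_derivative_add d[unfolded frechet_derivative_works])+
  then show ?case
    using Suc d by (auto simp: differentiable_on_def)
qed

lemma C_k_mult:
  fixes \<phi> \<psi> :: "'a::real_normed_vector \<Rightarrow> 'b::real_normed_algebra"
  assumes "C_k k \<phi>" "C_k k \<psi>" shows "C_k k (\<lambda>x. \<phi> x * \<psi> x)"
  using assms
proof (induction k arbitrary: \<phi> \<psi>)
  case 0
  then show ?case by (simp add: continuous_on_mult)
next
  case (Suc k)
  have d: "\<phi> differentiable at x" "\<psi> differentiable at x" for x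
    using Suc.prems by (auto simp: differentiable_on_def)
  have "frechet_derivative (\<lambda>x. \<phi> x * \<psi> x) (at x) = (\<lambda>v. \<phi> x * frechet_derivative \<psi> (at x) v + frechet_derivative \<phi> (at x) v * \<psi> x)" for x
    by (rule frechet_derivative_at[symmetric] has_derivative_mult d[unfolded frechet_derivative_works])+
  moreover have "C_k k (\<lambda>x. \<phi> x * frechet_derivative \<psi> (at x) v + frechet_derivative \<phi> (at x) v * \<psi> x)" for v
    using Suc.prems C_k_Suc_imp[OF Suc.prems(1)] C_k_Suc_imp[OF Suc.prems(2)] by (intro C_k_add Suc.IH) auto
  ultimately show ?case
    using d by (auto simp: differentiable_on_def intro!: differentiable_mult)
qed

lemma flat_affine_has_derivative:
  fixes L :: "'a::real_normed_vector \<Rightarrow> real"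
  assumes L: "bounded_linear L"
  shows "((\<lambda>z. complex_of_real (flat j (L z + c))) has_derivative (\<lambda>v. of_real (flat (Suc j) (L z + c)) * of_real (L v))) (at z)"
proof -
  have "((\<lambda>z. L z + c) has_derivative L) (at z)"
    using has_derivative_add[OF bounded_linear_imp_has_derivative[OF L] has_derivative_const[of c]] by simp
  from has_derivative_compose[OF this flat_has_derivative[unfolded has_field_derivative_def]]
  have "((\<lambda>z. flat j (L z + c)) has_derivative (\<lambda>v. flat (Suc j) (L z + c) * L v)) (at z)" .
  from has_derivative_of_real[OF this] show ?thesis
    by simp
qed

text \<open>The family over all \<open>j\<close> is closed under differentiation up to constant
  factors, hence the induction with \<open>j\<close> arbitrary.\<close>

lemma C_k_flat_affine:
  fixes L :: "'a::real_normed_vector \<Rightarrow> real"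
  assumes L: "bounded_linear L"
  shows "C_k k (\<lambda>z. complex_of_real (flat j (L z + c)))"
proof (induction k arbitrary: j)
  case 0
  have "continuous_on UNIV (\<lambda>z. L z + c)"
    using L by (intro continuous_intros linear_continuous_on)
  then show ?case
    by (auto intro!: continuous_intros continuous_on_compose2[OF continuous_flat[of UNIV]])
next
  case (Suc k)
  note d = flat_affine_has_derivative[OF L]
  have "frechet_derivative (\<lambda>z. complex_of_real (flat j (L z + c))) (at z) = (\<lambda>v. of_real (flat (Suc j) (L z + c)) * of_real (L v))" for z
    by (rule frechet_derivative_at[symmetric, OF d])
  then show ?case
    using d[of j c] by (auto simp: differentiable_on_def differentiable_def intro!: exI C_k_mult C_k_const Suc)
qed

text \<open>As \<open>n\<close> tends to infinity, \<open>cutoff n a b\<close> increases to the indicator function of \<open>(a, b)\<close>.\<close>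

definition cutoff :: "nat \<Rightarrow> real \<Rightarrow> real \<Rightarrow> real \<Rightarrow> real" where
  "cutoff n a b x = flat 0 (real n * (x - a)) * flat 0 (real n * (b - x))"

definition cutoff' :: "nat \<Rightarrow> real \<Rightarrow> real \<Rightarrow> real \<Rightarrow> real" where
  "cutoff' n a b x = real n * flat 1 (real n * (x - a)) * flat 0 (real n * (b - x))
     - real n * flat 0 (real n * (x - a)) * flat 1 (real n * (b - x))"

definition box_cutoff :: "nat \<Rightarrow> real \<Rightarrow> real \<Rightarrow> real \<Rightarrow> real \<Rightarrow> complex \<Rightarrow> complex" where
  "box_cutoff n a b c d z = of_real (cutoff n a b (Re z) * cutoff n c d (Im z))"

lemma cutoff_outside: "x \<notin> {a<..<b} \<Longrightarrow> cutoff n a b x = 0" "x \<notin> {a<..<b} \<Longrightarrow> cutoff' n a b x = 0"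
  by (auto simp: cutoff_def cutoff'_def mult_nonneg_nonpos not_less)

lemma cutoff_bounds: "0 \<le> cutoff n a b x" "cutoff n a b x \<le> 1"
  unfolding cutoff_def by (auto intro!: mult_le_one flat_0_bounds mult_nonneg_nonneg)

lemma cutoff_has_derivative: "(cutoff n a b has_real_derivative cutoff' n a b x) (at x)"
  unfolding cutoff_def[abs_def] cutoff'_def One_nat_def
  by (auto intro!: derivative_eq_intros DERIV_chain2[OF flat_has_derivative])

lemma cutoff_tendsto:
  "(\<lambda>n. cutoff n a b x) \<longlonglongrightarrow> indicator {a<..<b} x"
proof (cases "x \<in> {a<..<b}")
  case True
  have "(\<lambda>n. flat 0 (real n * c)) \<longlonglongrightarrow> 1" if "c > 0" for c
    by (rule filterlim_compose[OF flat_0_tendsto_1])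
       (rule filterlim_at_top_mult_tendsto_pos[OF tendsto_const that filterlim_real_sequentially])
  from tendsto_mult[OF this[of "x - a"] this[of "b - x"]] show ?thesis
    using True by (simp add: cutoff_def)
qed (simp add: cutoff_outside)

lemma test_function_box_cutoff: "test_function UNIV (box_cutoff n a b c d)"
proof -
  have L: "bounded_linear (\<lambda>z. r * Re z)" "bounded_linear (\<lambda>z. r * Im z)" for r
    by (auto intro!: bounded_linear_mult_right bounded_linear_compose[OF bounded_linear_mult_right] bounded_linear_Re bounded_linear_Im)
  have eq: "box_cutoff n a b c d = (\<lambda>z. of_real (flat 0 (real n * Re z + (- real n * a))) * of_real (flat 0 ((- real n) * Re z + real n * b))
     * (of_real (flat 0 (real n * Im z + (- real n * c))) * of_real (flat 0 ((- real n) * Im z + real n * d))))"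
    by (auto simp: box_cutoff_def cutoff_def fun_eq_iff algebra_simps)
  have "C_k k (box_cutoff n a b c d)" for k
    unfolding eq by (intro C_k_mult C_k_flat_affine L)
  moreover have sub: "closure {z. box_cutoff n a b c d z \<noteq> 0} \<subseteq> cbox (Complex a c) (Complex b d)"
  proof (rule closure_minimal)
    show "{z. box_cutoff n a b c d z \<noteq> 0} \<subseteq> cbox (Complex a c) (Complex b d)"
    proof
      fix z assume "z \<in> {z. box_cutoff n a b c d z \<noteq> 0}"
      then have "cutoff n a b (Re z) \<noteq> 0" "cutoff n c d (Im z) \<noteq> 0"
        by (auto simp: box_cutoff_def)
      then have "Re z \<in> {a<..<b}" "Im z \<in> {c<..<d}"
        using cutoff_outside by blast+
      then show "z \<in> cbox (Complex a c) (Complex b d)"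
        by (auto simp: in_cbox_complex_iff)
    qed
  qed (rule closed_cbox)
  then have "compact (closure {z. box_cutoff n a b c d z \<noteq> 0})"
    by (meson bounded_cbox bounded_subset compact_eq_bounded_closed closed_closure)
  ultimately show ?thesis
    by (simp add: test_function_def)
qed

lemma box_cutoff_frechet:
  "frechet_derivative (box_cutoff n a b c d) (at z) 1 = of_real (cutoff' n a b (Re z) * cutoff n c d (Im z))"
  "frechet_derivative (box_cutoff n a b c d) (at z) \<i> = of_real (cutoff n a b (Re z) * cutoff' n c d (Im z))"
proof -
  have "((\<lambda>z. cutoff n a b (Re z)) has_derivative (\<lambda>h. cutoff' n a b (Re z) * Re h)) (at z)"
    "((\<lambda>z. cutoff n c d (Im z)) has_derivative (\<lambda>h. cutoff' n c d (Im z) * Im h)) (at z)"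
    by (rule has_derivative_compose[OF _ cutoff_has_derivative[unfolded has_field_derivative_def]], auto intro!: derivative_eq_intros)+
  from has_derivative_of_real[OF has_derivative_mult[OF this]]
  have "(box_cutoff n a b c d has_derivative (\<lambda>h. of_real (cutoff n a b (Re z) * (cutoff' n c d (Im z) * Im h) + cutoff' n a b (Re z) * Re h * cutoff n c d (Im z)))) (at z)"
    by (simp only: box_cutoff_def[abs_def])
  from frechet_derivative_at[OF this, symmetric] show
    "frechet_derivative (box_cutoff n a b c d) (at z) 1 = of_real (cutoff' n a b (Re z) * cutoff n c d (Im z))"
    "frechet_derivative (box_cutoff n a b c d) (at z) \<i> = of_real (cutoff n a b (Re z) * cutoff' n c d (Im z))"
    by simp_all
qed

section \<open>Absolute continuity on lines\<close>

lemma integrable_continuous_support: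
  fixes g :: "'a::euclidean_space \<Rightarrow> 'b::{banach, second_countable_topology}"
  assumes cont: "continuous_on UNIV g" and C: "compact C" "\<And>x. x \<notin> C \<Longrightarrow> g x = 0"
  shows "integrable lborel g"
proof -
  have "bounded C" "bounded (g ` C)"
    using C compact_continuous_image[OF continuous_on_subset[OF cont]] by (auto intro!: compact_imp_bounded)
  then obtain R B where R: "\<And>x. x \<in> C \<Longrightarrow> norm x \<le> R" and B: "\<And>x. x \<in> C \<Longrightarrow> norm (g x) \<le> B"
    unfolding bounded_iff by auto
  show ?thesis
  proof (rule integrable_bounded_support)
    show "g \<in> borel_measurable lborel"
      using borel_measurable_continuous_onI[OF cont] by simp
    show "norm (g x) \<le> max B 0" for x
      using B[of x] C(2)[of x] by (cases "x \<in> C") (auto simp: le_max_iff_disj)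
    show "g x = 0" if "x \<notin> cball 0 R" for x
      using R C(2) that by auto
  qed
qed

text \<open>\<open>flat 1\<close> is the derivative of \<open>flat 0\<close>, which climbs from 0 to
  1. Rescaled copies of it therefore form an approximate identity.\<close>

lemma has_bochner_integral_flat_1: "has_bochner_integral lborel (flat 1) 1"
proof (rule has_bochner_integral_nn_integral)
  have m: "flat 1 \<in> borel_measurable borel"
    by (rule borel_measurable_continuous_onI[OF continuous_flat])
  then show "flat 1 \<in> borel_measurable lborel" by simp
  have "(\<integral>\<^sup>+x. ennreal (flat 1 x) \<partial>lborel) = (\<integral>\<^sup>+x. ennreal (flat 1 x) * indicator {0..} x \<partial>lborel)"
    by (intro nn_integral_cong) (auto simp: indicator_def)
  also have "\<dots> = ennreal (1 - flat 0 0)"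
    by (rule nn_integral_FTC_atLeast[OF m _ _ flat_0_tendsto_1])
       (use flat_has_derivative[of 0] flat_1_nonneg in simp_all)
  finally show "(\<integral>\<^sup>+x. ennreal (flat 1 x) \<partial>lborel) = ennreal 1"
    by simp
qed (use flat_1_nonneg in auto)

text \<open>The rescaled \<open>flat 1\<close> concentrates at \<open>a\<close> from the right,
  where the other factor tends to 1. Substituting \<open>x = a + s / (n + 1)\<close> yields the
  functions \<open>K n\<close>, all dominated by \<open>M * flat 1\<close>.\<close>

lemma flat_delta_left:
  fixes h :: "real \<Rightarrow> complex"
  assumes h: "continuous_on UNIV h" and ab: "a < b" and M: "\<And>x. x \<in> {a..b} \<Longrightarrow> cmod (h x) \<le> M"
  defines "k \<equiv> (\<lambda>n x. h x * of_real (real (Suc n) * flat 1 (real (Suc n) * (x - a)) * flat 0 (real (Suc n) * (b - x))))"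
  shows "(\<lambda>n. \<integral>x. k n x \<partial>lborel) \<longlonglongrightarrow> h a" and "cmod (\<integral>x. k n x \<partial>lborel) \<le> M" and "integrable lborel (k n)"
proof -
  have M0: "0 \<le> M"
    using M[of a] ab norm_ge_zero[of "h a"] by (simp del: norm_ge_zero)
  define K where "K n s = h (a + (1 / real (Suc n)) * s) * of_real (flat 1 s * flat 0 (real (Suc n) * (b - a) - s))" for n s
  have hm [measurable]: "h \<in> borel_measurable borel" "flat j \<in> borel_measurable borel" for j
    by (auto intro: borel_measurable_continuous_onI h continuous_flat)
  have eq: "(\<integral>x. k n x \<partial>lborel) = (\<integral>s. K n s \<partial>lborel)" for n
  proof -
    define c where "c = 1 / real (Suc n)"
    have c: "c > 0" "real (Suc n) = 1 / c"
      by (simp_all add: c_def)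
    have "k n (a + c * s) = of_real (1 / c) * K n s" for s
      using c unfolding k_def K_def c_def[symmetric] c(2) by (simp add: field_simps)
    then show ?thesis
      using c by (subst lborel_integral_real_affine[of c _ a]) (auto simp: scaleR_conv_of_real)
  qed
  have dom: "cmod (K n s) \<le> M * flat 1 s" for n s
  proof (cases "0 < s \<and> s < real (Suc n) * (b - a)")
    case True
    then have "a + (1 / real (Suc n)) * s \<in> {a..b}"
      by (simp add: field_simps)
    then show ?thesis
      unfolding K_def norm_mult norm_of_real abs_mult
      using flat_0_bounds flat_1_nonneg M0 by (intro mult_mono M) (auto intro!: mult_right_le_one_le)
  next
    case False
    then show ?thesis
      using flat_1_nonneg M0 by (auto simp: K_def not_less)
  qed
  have int: "integrable lborel (\<lambda>s. M * flat 1 s)" and intval: "(\<integral>s. M * flat 1 s \<partial>lborel) = M"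
    using has_bochner_integral_flat_1 by (auto simp: has_bochner_integral_iff)
  have Km: "K n \<in> borel_measurable lborel" for n
    unfolding K_def by measurable
  have "(\<lambda>n. \<integral>s. K n s \<partial>lborel) \<longlonglongrightarrow> (\<integral>s. h a * of_real (flat 1 s) \<partial>lborel)"
  proof (rule integral_dominated_convergence[where w="\<lambda>s. M * flat 1 s"])
    show "AE s in lborel. (\<lambda>n. K n s) \<longlonglongrightarrow> h a * of_real (flat 1 s)"
    proof (rule AE_I2)
      fix s
      have lim0: "(\<lambda>n. 1 / real (Suc n)) \<longlonglongrightarrow> 0"
        using LIMSEQ_inverse_real_of_nat by (simp add: divide_inverse)
      have "(\<lambda>n. a + (1 / real (Suc n)) * s) \<longlonglongrightarrow> a + 0 * s"
        by (intro tendsto_intros lim0)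
      moreover have "(h \<longlongrightarrow> h a) (nhds a)"
        using h by (simp add: continuous_on_eq_continuous_at continuous_at tendsto_at_iff_tendsto_nhds)
      ultimately have 1: "(\<lambda>n. h (a + (1 / real (Suc n)) * s)) \<longlonglongrightarrow> h a"
        using filterlim_compose by force
      have "filterlim (\<lambda>n. real (Suc n) * (b - a)) at_top sequentially"
        by (rule filterlim_at_top_mult_tendsto_pos[OF tendsto_const _ filterlim_compose[OF filterlim_real_sequentially filterlim_Suc]])
          (use ab in simp)
      then have "filterlim (\<lambda>n. (- s) + real (Suc n) * (b - a)) at_top sequentially"
        by (rule filterlim_tendsto_add_at_top[OF tendsto_const])
      from filterlim_compose[OF flat_0_tendsto_1 this]
      have 2: "(\<lambda>n. flat 0 (real (Suc n) * (b - a) - s)) \<longlonglongrightarrow> 1"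
        by (simp add: algebra_simps)
      have "(\<lambda>n. K n s) \<longlonglongrightarrow> h a * of_real (flat 1 s * 1)"
        unfolding K_def by (intro tendsto_intros 1 2)
      then show "(\<lambda>n. K n s) \<longlonglongrightarrow> h a * of_real (flat 1 s)" by simp
    qed
  qed (use Km int dom in auto)
  also have "(\<integral>s. h a * of_real (flat 1 s) \<partial>lborel) = h a"
    using has_bochner_integral_flat_1 by (auto simp: has_bochner_integral_iff)
  finally show "(\<lambda>n. \<integral>x. k n x \<partial>lborel) \<longlonglongrightarrow> h a"
    unfolding eq .
  have "integrable lborel (K n)"
    by (rule Bochner_Integration.integrable_bound[OF int Km]) (use dom in \<open>auto intro!: AE_I2 order_trans[OF dom]\<close>)
  then have "cmod (\<integral>s. K n s \<partial>lborel) \<le> (\<integral>s. M * flat 1 s \<partial>lborel)"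
    using dom int by (intro order_trans[OF integral_norm_bound] integral_mono) auto
  then show "cmod (\<integral>x. k n x \<partial>lborel) \<le> M"
    unfolding eq intval .
  show "integrable lborel (k n)"
  proof (rule integrable_continuous_support[of _ "{a..b}"])
    show "continuous_on UNIV (k n)"
      unfolding k_def by (intro continuous_intros h continuous_on_compose2[OF continuous_flat[of UNIV]]) auto
    show "k n x = 0" if "x \<notin> {a..b}" for x
      using that by (auto simp: k_def not_le mult_nonneg_nonpos)
  qed auto
qed

text \<open>The reflection of the line exchanges the two ends of the interval.\<close>

lemma flat_delta_right:
  fixes h :: "real \<Rightarrow> complex"
  assumes h: "continuous_on UNIV h" and ab: "a < b" and M: "\<And>x. x \<in> {a..b} \<Longrightarrow> cmod (h x) \<le> M"
  defines "k \<equiv> (\<lambda>n x. h x * of_real (real (Suc n) * flat 0 (real (Suc n) * (x - a)) * flat 1 (real (Suc n) * (b - x))))"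
  shows "(\<lambda>n. \<integral>x. k n x \<partial>lborel) \<longlonglongrightarrow> h b" and "cmod (\<integral>x. k n x \<partial>lborel) \<le> M" and "integrable lborel (k n)"
proof -
  let ?k = "\<lambda>n x. h (- x) * of_real (real (Suc n) * flat 1 (real (Suc n) * (x - - b)) * flat 0 (real (Suc n) * (- a - x)))"
  have h': "continuous_on UNIV (\<lambda>x. h (- x))"
    by (rule continuous_on_compose2[OF h]) (auto intro!: continuous_intros)
  have M': "cmod (h (- x)) \<le> M" if "x \<in> {- b..- a}" for x
    using that by (intro M) auto
  have ab': "- b < - a"
    using ab by simp
  note l = flat_delta_left[where h="\<lambda>x. h (- x)", OF h' ab' M']
  have e: "k n (- x) = ?k n x" for n x
    by (simp add: k_def minus_diff_commute add.commute mult.commute mult.left_commute)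
  have eq: "(\<integral>x. k n x \<partial>lborel) = (\<integral>x. ?k n x \<partial>lborel)" for n
    using lborel_integral_real_affine[of "- 1" "k n" 0] by (simp add: e)
  show "(\<lambda>n. \<integral>x. k n x \<partial>lborel) \<longlonglongrightarrow> h b" "cmod (\<integral>x. k n x \<partial>lborel) \<le> M"
    unfolding eq using l(1,2) by simp_all
  show "integrable lborel (k n)"
  proof -
    have "?k n (0 + - 1 * x) = k n x" for x
      using e[of n "- x"] by simp
    moreover have "integrable lborel (\<lambda>x. ?k n (0 + - 1 * x))"
      by (rule lborel_integrable_real_affine[OF flat_delta_left(3)[where h="\<lambda>x. h (- x)", OF h' ab' M']]) auto
    ultimately show ?thesis
      by (simp only:)
  qed
qed

text \<open>The derivative of a cutoff tends to the indicator's: a point mass at \<open>a\<close>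
  minus one at \<open>b\<close>. The uniform bound serves dominated convergence in the other
  variable.\<close>

lemma cutoff'_integral:
  fixes h :: "real \<Rightarrow> complex"
  assumes h: "continuous_on UNIV h" and ab: "a < b" and M: "\<And>x. x \<in> {a..b} \<Longrightarrow> cmod (h x) \<le> M"
  shows "(\<lambda>n. \<integral>x. h x * of_real (cutoff' (Suc n) a b x) \<partial>lborel) \<longlonglongrightarrow> h a - h b"
    and "cmod (\<integral>x. h x * of_real (cutoff' (Suc n) a b x) \<partial>lborel) \<le> 2 * M"
proof -
  let ?k = "\<lambda>n x. h x * of_real (real (Suc n) * flat 1 (real (Suc n) * (x - a)) * flat 0 (real (Suc n) * (b - x)))"
  let ?l = "\<lambda>n x. h x * of_real (real (Suc n) * flat 0 (real (Suc n) * (x - a)) * flat 1 (real (Suc n) * (b - x)))"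
  note k = flat_delta_left[OF h ab M] and l = flat_delta_right[OF h ab M]
  have "h x * of_real (cutoff' (Suc n) a b x) = ?k n x - ?l n x" for n x
    unfolding cutoff'_def of_real_diff right_diff_distrib ..
  then have eq: "(\<integral>x. h x * of_real (cutoff' (Suc n) a b x) \<partial>lborel) = (\<integral>x. ?k n x \<partial>lborel) - (\<integral>x. ?l n x \<partial>lborel)" for n
    using k(3) l(3) by (simp only: Bochner_Integration.integral_diff)
  show "(\<lambda>n. \<integral>x. h x * of_real (cutoff' (Suc n) a b x) \<partial>lborel) \<longlonglongrightarrow> h a - h b"
    unfolding eq by (intro tendsto_diff k(1) l(1))
  show "cmod (\<integral>x. h x * of_real (cutoff' (Suc n) a b x) \<partial>lborel) \<le> 2 * M"
    unfolding eq using norm_triangle_ineq4[of "\<integral>x. ?k n x \<partial>lborel" "\<integral>x. ?l n x \<partial>lborel"] k(2)[of n] l(2)[of n] by linarith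
qed

text \<open>The limit of the weak identity \<open>H\<close> as the cutoffs increase to the indicator
  of the rectangle: the integral of \<open>g\<close> equals the flux of \<open>f\<close> through the
  sides \<open>x = b\<close> and \<open>x = a\<close>.\<close>

lemma box_identity:
  fixes f g :: "real \<times> real \<Rightarrow> complex"
  assumes f: "continuous_on UNIV f" and g [measurable]: "g \<in> borel_measurable borel"
    and gint: "\<And>C. compact C \<Longrightarrow> integrable lborel (\<lambda>p. indicator C p *\<^sub>R g p)"
    and H: "\<And>n. (\<integral>p. g p * of_real (cutoff n a b (fst p) * cutoff n c d (snd p)) \<partial>lborel)
        = - (\<integral>p. f p * of_real (cutoff' n a b (fst p) * cutoff n c d (snd p)) \<partial>lborel)"
    and ab: "a < b" and cd: "c < d"
  shows "(\<integral>p. indicator ({a<..<b} \<times> {c<..<d}) p *\<^sub>R g p \<partial>lborel)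
    = (\<integral>y. indicator {c<..<d} y *\<^sub>R (f (b, y) - f (a, y)) \<partial>lborel)"
proof -
  have cutc: "continuous_on UNIV (cutoff n a b)" "continuous_on UNIV (cutoff' n a b)" for n a b
    unfolding cutoff_def[abs_def] cutoff'_def[abs_def]
    by (intro continuous_intros continuous_on_compose2[OF continuous_flat[of UNIV]]; auto)+
  have cutm [measurable]: "cutoff n a b \<in> borel_measurable borel" "cutoff' n a b \<in> borel_measurable borel" for n a b
    by (intro borel_measurable_continuous_onI cutc)+
  let ?C = "{a..b} \<times> {c..d}"
  have "compact (f ` ?C)"
    by (intro compact_continuous_image continuous_on_subset[OF f] compact_Times) auto
  then obtain M where M: "\<And>p. p \<in> ?C \<Longrightarrow> cmod (f p) \<le> M"
    using compact_imp_bounded by (metis bounded_iff imageI)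
  have M0: "0 \<le> M"
    using M[of "(a, c)"] ab cd norm_ge_zero[of "f (a, c)"] by (simp del: norm_ge_zero)
  have lim1: "(\<lambda>n. \<integral>p. g p * of_real (cutoff (Suc n) a b (fst p) * cutoff (Suc n) c d (snd p)) \<partial>lborel)
    \<longlonglongrightarrow> (\<integral>p. indicator ({a<..<b} \<times> {c<..<d}) p *\<^sub>R g p \<partial>lborel)"
  proof (rule integral_dominated_convergence[where w="\<lambda>p. norm (indicator ?C p *\<^sub>R g p)"])
    show "integrable lborel (\<lambda>p. norm (indicator ?C p *\<^sub>R g p))"
      by (intro integrable_norm gint compact_Times) auto
    show "AE p in lborel. (\<lambda>n. g p * of_real (cutoff (Suc n) a b (fst p) * cutoff (Suc n) c d (snd p))) \<longlonglongrightarrow> indicator ({a<..<b} \<times> {c<..<d}) p *\<^sub>R g p"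
    proof (rule AE_I2)
      fix p :: "real \<times> real"
      have "(\<lambda>n. g p * of_real (cutoff (Suc n) a b (fst p) * cutoff (Suc n) c d (snd p))) \<longlonglongrightarrow> g p * of_real (indicator {a<..<b} (fst p) * indicator {c<..<d} (snd p))"
        by (intro tendsto_intros LIMSEQ_Suc cutoff_tendsto)
      then show "(\<lambda>n. g p * of_real (cutoff (Suc n) a b (fst p) * cutoff (Suc n) c d (snd p))) \<longlonglongrightarrow> indicator ({a<..<b} \<times> {c<..<d}) p *\<^sub>R g p"
        by (cases p) (simp add: indicator_times scaleR_conv_of_real mult.commute)
    qed
    show "AE p in lborel. norm (g p * of_real (cutoff (Suc n) a b (fst p) * cutoff (Suc n) c d (snd p))) \<le> norm (indicator ?C p *\<^sub>R g p)" for n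
    proof (rule AE_I2)
      fix p :: "real \<times> real"
      show "norm (g p * of_real (cutoff (Suc n) a b (fst p) * cutoff (Suc n) c d (snd p))) \<le> norm (indicator ?C p *\<^sub>R g p)"
      proof (cases "fst p \<in> {a<..<b} \<and> snd p \<in> {c<..<d}")
        case True
        then have "p \<in> ?C" by (cases p) auto
        then show ?thesis
          using cutoff_bounds by (simp add: norm_mult abs_mult mult_left_le mult_le_one)
      next
        case False
        then show ?thesis
          using cutoff_outside(1) by auto
      qed
    qed
    show "(\<lambda>p. indicator ({a<..<b} \<times> {c<..<d}) p *\<^sub>R g p) \<in> borel_measurable lborel"
      using borel_open[OF open_Times[of "{a<..<b}" "{c<..<d}"]] by simp
    have [measurable]: "g \<in> borel_measurable (borel \<Otimes>\<^sub>M borel)"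
      using g by (simp add: borel_prod)
    show "(\<lambda>p. g p * of_real (cutoff (Suc n) a b (fst p) * cutoff (Suc n) c d (snd p))) \<in> borel_measurable lborel" for n
      by (simp add: borel_prod[symmetric])
  qed
  have int2: "(\<integral>p. f p * of_real (cutoff' (Suc n) a b (fst p) * cutoff (Suc n) c d (snd p)) \<partial>lborel)
    = (\<integral>y. of_real (cutoff (Suc n) c d y) * (\<integral>x. f (x, y) * of_real (cutoff' (Suc n) a b x) \<partial>lborel) \<partial>lborel)" for n
  proof -
    let ?u = "\<lambda>p. f p * of_real (cutoff' (Suc n) a b (fst p) * cutoff (Suc n) c d (snd p))"
    have "integrable lborel ?u"
    proof (rule integrable_continuous_support[of _ ?C])
      show "continuous_on UNIV ?u"
        by (intro continuous_intros f continuous_on_compose2[OF cutc(1)] continuous_on_compose2[OF cutc(2)]) auto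
      show "?u p = 0" if "p \<notin> ?C" for p
      proof -
        have "fst p \<notin> {a<..<b} \<or> snd p \<notin> {c<..<d}"
          using that by (cases p) auto
        then show ?thesis
          using cutoff_outside by auto
      qed
    qed (intro compact_Times; simp)
    moreover have "case_prod (\<lambda>x y. ?u (x, y)) = ?u"
      by (auto simp: fun_eq_iff)
    ultimately have "integrable (lborel \<Otimes>\<^sub>M lborel) (case_prod (\<lambda>x y. ?u (x, y)))"
      by (simp only: lborel_prod)
    from lborel_pair.integral_snd[OF this]
    have "(\<integral>p. ?u p \<partial>lborel) = (\<integral>y. \<integral>x. ?u (x, y) \<partial>lborel \<partial>lborel)"
      by (simp add: lborel_prod split_def)
    also have "\<dots> = (\<integral>y. \<integral>x. of_real (cutoff (Suc n) c d y) * (f (x, y) * of_real (cutoff' (Suc n) a b x)) \<partial>lborel \<partial>lborel)"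
      by (intro Bochner_Integration.integral_cong refl) simp
    finally show ?thesis
      by (simp only: integral_mult_right_zero)
  qed
  have fy: "continuous_on UNIV (\<lambda>x. f (x, y))" "continuous_on UNIV (\<lambda>y. f (x, y))" for x y
    by (auto intro!: continuous_on_compose2[OF f] continuous_intros)
  have My: "cmod (f (x, y)) \<le> M" if "y \<in> {c..d}" "x \<in> {a..b}" for x y
    using that by (intro M) auto
  have lim2: "(\<lambda>n. \<integral>y. of_real (cutoff (Suc n) c d y) * (\<integral>x. f (x, y) * of_real (cutoff' (Suc n) a b x) \<partial>lborel) \<partial>lborel)
    \<longlonglongrightarrow> (\<integral>y. indicator {c<..<d} y *\<^sub>R (f (a, y) - f (b, y)) \<partial>lborel)"
  proof (rule integral_dominated_convergence[where w="\<lambda>y. indicator {c..d} y * (2 * M)"])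
    show "(\<lambda>y. indicator {c<..<d} y *\<^sub>R (f (a, y) - f (b, y))) \<in> borel_measurable lborel"
      using borel_measurable_continuous_onI[OF fy(2)] by simp
    have [measurable]: "f \<in> borel_measurable (borel \<Otimes>\<^sub>M borel)"
      using borel_measurable_continuous_onI[OF f] by (simp add: borel_prod)
    show "(\<lambda>y. of_real (cutoff (Suc n) c d y) * (\<integral>x. f (x, y) * of_real (cutoff' (Suc n) a b x) \<partial>lborel)) \<in> borel_measurable lborel" for n
      by measurable
    show "integrable lborel (\<lambda>y. indicator {c..d} y * (2 * M))"
      using cd by (simp add: integrable_indicator_iff)
    show "AE y in lborel. (\<lambda>n. of_real (cutoff (Suc n) c d y) * (\<integral>x. f (x, y) * of_real (cutoff' (Suc n) a b x) \<partial>lborel))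
      \<longlonglongrightarrow> indicator {c<..<d} y *\<^sub>R (f (a, y) - f (b, y))"
    proof (rule AE_I2)
      fix y
      show "(\<lambda>n. of_real (cutoff (Suc n) c d y) * (\<integral>x. f (x, y) * of_real (cutoff' (Suc n) a b x) \<partial>lborel))
        \<longlonglongrightarrow> indicator {c<..<d} y *\<^sub>R (f (a, y) - f (b, y))"
      proof (cases "y \<in> {c<..<d}")
        case True
        have "(\<lambda>n. of_real (cutoff (Suc n) c d y) * (\<integral>x. f (x, y) * of_real (cutoff' (Suc n) a b x) \<partial>lborel))
          \<longlonglongrightarrow> of_real (indicator {c<..<d} y) * (f (a, y) - f (b, y))"
          using True by (intro tendsto_mult tendsto_of_real LIMSEQ_Suc cutoff_tendsto cutoff'_integral(1)[OF fy(1) ab My]) auto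
        then show ?thesis
          by (simp add: scaleR_conv_of_real)
      qed (simp add: cutoff_outside)
    qed
    show "AE y in lborel. norm (of_real (cutoff (Suc n) c d y) * (\<integral>x. f (x, y) * of_real (cutoff' (Suc n) a b x) \<partial>lborel)) \<le> indicator {c..d} y * (2 * M)" for n
    proof (rule AE_I2)
      fix y
      show "norm (of_real (cutoff (Suc n) c d y) * (\<integral>x. f (x, y) * of_real (cutoff' (Suc n) a b x) \<partial>lborel)) \<le> indicator {c..d} y * (2 * M)"
      proof (cases "y \<in> {c<..<d}")
        case True
        then have y: "y \<in> {c..d}" by auto
        have "norm (of_real (cutoff (Suc n) c d y) * (\<integral>x. f (x, y) * of_real (cutoff' (Suc n) a b x) \<partial>lborel)) \<le> 1 * (2 * M)"
          unfolding norm_mult norm_of_real using cutoff_bounds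
          by (intro mult_mono cutoff'_integral(2)[OF fy(1) ab My[OF y]]) auto
        then show ?thesis
          using y by simp
      qed (use M0 in \<open>simp add: cutoff_outside\<close>)
    qed
  qed
  have "(\<integral>p. indicator ({a<..<b} \<times> {c<..<d}) p *\<^sub>R g p \<partial>lborel) = - (\<integral>y. indicator {c<..<d} y *\<^sub>R (f (a, y) - f (b, y)) \<partial>lborel)"
    using LIMSEQ_unique[OF lim1] tendsto_minus[OF lim2] unfolding H int2 .
  also have "\<dots> = (\<integral>y. - (indicator {c<..<d} y *\<^sub>R (f (a, y) - f (b, y))) \<partial>lborel)"
    by simp
  also have "\<dots> = (\<integral>y. indicator {c<..<d} y *\<^sub>R (f (b, y) - f (a, y)) \<partial>lborel)"
    by (intro Bochner_Integration.integral_cong refl) (simp add: algebra_simps)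
  finally show ?thesis .
qed

lemma norm_integral_le_nn_integral:
  fixes f :: "'a \<Rightarrow> 'b::{banach, second_countable_topology}"
  shows "ennreal (norm (\<integral>x. f x \<partial>M)) \<le> (\<integral>\<^sup>+x. ennreal (norm (f x)) \<partial>M)"
  by (cases "integrable M f") (simp_all add: integral_norm_bound_ennreal not_integrable_integral_eq)

text \<open>At a Lebesgue point the value is the limit of the means over centred intervals, and
  these are all 0.\<close>

lemma AE_eq_0_of_interval_integrals:
  fixes H :: "real \<Rightarrow> complex"
  assumes H [measurable]: "H \<in> borel_measurable borel"
    and fin: "\<And>R. (\<integral>\<^sup>+y\<in>ball 0 R. ennreal (norm (H y)) \<partial>lborel) < \<infinity>"
    and zero: "\<And>c d. c < d \<Longrightarrow> (\<integral>y. indicator {c<..<d} y *\<^sub>R H y \<partial>lborel) = 0"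
  shows "AE y in lborel. H y = 0"
  using AE_lebesgue_point[OF H fin]
proof eventually_elim
  case (elim y)
  have "cmod (H y) \<le> \<epsilon>" if \<epsilon>: "\<epsilon> > 0" for \<epsilon>
  proof -
    obtain \<delta> where \<delta>: "\<delta> > 0" "\<And>r. 0 < r \<Longrightarrow> r < \<delta> \<Longrightarrow>
        (\<integral>\<^sup>+x\<in>ball y r. ennreal (cmod (H x - H y)) \<partial>lborel) \<le> ennreal \<epsilon> * emeasure lborel (ball y r)"
      using elim \<epsilon> unfolding lebesgue_point_def by blast
    define r where "r = \<delta> / 2"
    have r: "0 < r" "r < \<delta>"
      using \<delta> by (simp_all add: r_def)
    let ?I = "{y - r<..<y + r}"
    have ball: "ball y r = ?I"
      by (rule ball_eq_greaterThanLessThan)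
    have i1: "integrable lborel (\<lambda>x. indicator ?I x *\<^sub>R H x)"
    proof (rule integrableI_bounded)
      have "(\<integral>\<^sup>+x. ennreal (norm (indicator ?I x *\<^sub>R H x)) \<partial>lborel) \<le> (\<integral>\<^sup>+x\<in>ball 0 (\<bar>y\<bar> + r). ennreal (norm (H x)) \<partial>lborel)"
        by (intro nn_integral_mono) (auto simp: indicator_def)
      also have "\<dots> < \<infinity>" by (rule fin)
      finally show "(\<integral>\<^sup>+x. ennreal (norm (indicator ?I x *\<^sub>R H x)) \<partial>lborel) < \<infinity>" .
    qed simp
    have i2: "integrable lborel (\<lambda>x. indicator ?I x *\<^sub>R H y)"
      using r by simp
    have "(\<integral>x. indicator ?I x *\<^sub>R (H x - H y) \<partial>lborel) = (\<integral>x. indicator ?I x *\<^sub>R H x \<partial>lborel) - (\<integral>x. indicator ?I x *\<^sub>R H y \<partial>lborel)"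
      unfolding scaleR_diff_right by (rule Bochner_Integration.integral_diff[OF i1 i2])
    also have "\<dots> = - ((2 * r) *\<^sub>R H y)"
      using zero[of "y - r" "y + r"] r by simp
    finally have "ennreal (cmod ((2 * r) *\<^sub>R H y)) \<le> (\<integral>\<^sup>+x. ennreal (cmod (indicator ?I x *\<^sub>R (H x - H y))) \<partial>lborel)"
      using norm_integral_le_nn_integral[of lborel "\<lambda>x. indicator ?I x *\<^sub>R (H x - H y)"] by simp
    also have "\<dots> = (\<integral>\<^sup>+x\<in>ball y r. ennreal (cmod (H x - H y)) \<partial>lborel)"
      unfolding ball by (intro nn_integral_cong) (auto simp: indicator_def)
    also have "\<dots> \<le> ennreal \<epsilon> * emeasure lborel (ball y r)"
      by (rule \<delta>(2)[OF r])
    also have "\<dots> = ennreal (\<epsilon> * (2 * r))"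
      unfolding ball using r \<epsilon> by (simp add: ennreal_mult)
    finally have "2 * r * cmod (H y) \<le> \<epsilon> * (2 * r)"
      using r \<epsilon> by (simp add: abs_mult)
    then show ?thesis
      using r by simp
  qed
  then have "cmod (H y) \<le> 0"
    by (rule field_le_epsilon[where y=0, simplified])
  then show ?case by simp
qed

lemma closure_rat_interval:
  fixes \<alpha> \<beta> :: real
  assumes "\<alpha> < \<beta>" shows "{\<alpha>..\<beta>} \<subseteq> closure ({\<alpha><..<\<beta>} \<inter> \<rat>)"
proof
  fix x assume x: "x \<in> {\<alpha>..\<beta>}"
  show "x \<in> closure ({\<alpha><..<\<beta>} \<inter> \<rat>)"
    unfolding closure_approachable
  proof (intro allI impI)
    fix e :: real assume "e > 0"
    then have "max \<alpha> (x - e) < min \<beta> (x + e)"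
      using x assms by auto
    from Rats_dense_in_real[OF this] obtain q where "q \<in> \<rat>" "max \<alpha> (x - e) < q" "q < min \<beta> (x + e)"
      by blast
    then show "\<exists>y\<in>{\<alpha><..<\<beta>} \<inter> \<rat>. dist y x < e"
      by (intro bexI[of _ q]) (auto simp: dist_real_def abs_if)
  qed
qed

text \<open>For fixed ends \<open>a < b\<close>, \<open>box_identity\<close> on all strips shows
  that the increment of \<open>f\<close> is the integral of \<open>g\<close> for almost every
  \<open>y\<close>. The null set depends on \<open>a\<close> and \<open>b\<close>, so this is done
  for rational ends at once; since the right side of the claim does not involve \<open>a\<close> and
  \<open>b\<close>, continuity of \<open>f\<close> extends it to real ones.\<close>

lemma AE_lines:
  fixes f g :: "real \<times> real \<Rightarrow> complex"
  assumes f: "continuous_on UNIV f" and g [measurable]: "g \<in> borel_measurable borel"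
    and gint: "\<And>C. compact C \<Longrightarrow> integrable lborel (\<lambda>p. indicator C p *\<^sub>R g p)"
    and H: "\<And>n a b c d. (\<integral>p. g p * of_real (cutoff n a b (fst p) * cutoff n c d (snd p)) \<partial>lborel)
        = - (\<integral>p. f p * of_real (cutoff' n a b (fst p) * cutoff n c d (snd p)) \<partial>lborel)"
  shows "AE y in lborel. \<forall>\<alpha> \<beta> a b A. a \<in> {\<alpha>..\<beta>} \<longrightarrow> b \<in> {\<alpha>..\<beta>} \<longrightarrow>
    ennreal (cmod (f (b, y) - f (a, y) - of_real (b - a) * A)) \<le> (\<integral>\<^sup>+x\<in>{\<alpha>..\<beta>}. ennreal (cmod (g (x, y) - A)) \<partial>lborel)"
proof -
  have [measurable]: "g \<in> borel_measurable (borel \<Otimes>\<^sub>M borel)" "f \<in> borel_measurable (borel \<Otimes>\<^sub>M borel)"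
    using g borel_measurable_continuous_onI[OF f] by (simp_all add: borel_prod)
  \<comment> \<open>The mass of \<open>g\<close> on a bounded piece of the line at height
    \<open>y\<close>. It is finite for almost every \<open>y\<close>, uniformly in the choice of the
    piece, which makes \<open>g\<close> integrable along the line.\<close>
  define \<Phi> where "\<Phi> k y = (\<integral>\<^sup>+x\<in>{- k..k}. ennreal (cmod (g (x, y))) \<partial>lborel)" for k y :: real
  have [measurable]: "\<Phi> k \<in> borel_measurable borel" for k
    unfolding \<Phi>_def by measurable
  have \<Phi>fin: "(\<integral>\<^sup>+y\<in>{- k..k}. \<Phi> k y \<partial>lborel) < \<infinity>" for k
  proof -
    have "(\<integral>\<^sup>+y\<in>{- k..k}. \<Phi> k y \<partial>lborel) = (\<integral>\<^sup>+y. \<integral>\<^sup>+x. ennreal (cmod (g (x, y))) * indicator {- k..k} x * indicator {- k..k} y \<partial>lborel \<partial>lborel)"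
      unfolding \<Phi>_def by (intro nn_integral_cong nn_integral_multc[symmetric]) measurable
    also have "\<dots> = (\<integral>\<^sup>+p. ennreal (cmod (g p)) * indicator {- k..k} (fst p) * indicator {- k..k} (snd p) \<partial>(lborel \<Otimes>\<^sub>M lborel))"
      by (subst lborel_pair.nn_integral_snd[symmetric]) auto
    also have "\<dots> = (\<integral>\<^sup>+p. ennreal (norm (indicator ({- k..k} \<times> {- k..k}) p *\<^sub>R g p)) \<partial>lborel)"
      unfolding lborel_prod by (intro nn_integral_cong) (auto simp: indicator_def split: prod.splits)
    also have "\<dots> < \<infinity>"
      using gint[OF compact_Times[of "{- k..k}" "{- k..k}"]] unfolding integrable_iff_bounded by auto
    finally show ?thesis .
  qed
  have "AE y in lborel. \<forall>k::nat. \<Phi> k y * indicator {- real k..real k} y \<noteq> \<infinity>"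
    unfolding AE_all_countable by (intro allI nn_integral_noteq_infinite) (use \<Phi>fin in \<open>auto simp: less_top\<close>)
  then have ae1: "AE y in lborel. \<forall>k. \<Phi> k y < \<infinity>"
  proof eventually_elim
    case (elim y)
    show ?case
    proof
      fix k
      obtain n :: nat where n: "\<bar>y\<bar> + \<bar>k\<bar> \<le> real n"
        using real_arch_simple by blast
      have "\<Phi> k y \<le> \<Phi> (real n) y"
        unfolding \<Phi>_def using n by (intro nn_integral_mono mult_left_mono) (auto simp: indicator_def)
      also have "\<Phi> (real n) y < \<infinity>"
      proof -
        have "y \<in> {- real n..real n}" using n by auto
        then show ?thesis
          using elim[rule_format, of n] by (simp add: less_top)
      qed
      finally show "\<Phi> k y < \<infinity>" .
    qed
  qed
  have fy: "continuous_on UNIV (\<lambda>x. f (x, y))" "continuous_on UNIV (\<lambda>y. f (x, y))" for x y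
    by (auto intro!: continuous_on_compose2[OF f] continuous_intros)
  have ae2: "AE y in lborel. f (b, y) - f (a, y) = (\<integral>x. indicator {a<..<b} x *\<^sub>R g (x, y) \<partial>lborel)" if ab: "a < b" for a b
  proof -
    define G where "G y = (\<integral>x. indicator {a<..<b} x *\<^sub>R g (x, y) \<partial>lborel)" for y
    have G [measurable]: "G \<in> borel_measurable borel"
      unfolding G_def by measurable
    have f1 [measurable]: "(\<lambda>y. f (b, y) - f (a, y)) \<in> borel_measurable borel"
      by (intro borel_measurable_continuous_onI continuous_intros fy)
    have Gfin: "(\<integral>\<^sup>+y\<in>{- k..k}. ennreal (cmod (G y)) \<partial>lborel) < \<infinity>" for k
    proof -
      define m where "m = max k (max \<bar>a\<bar> \<bar>b\<bar>)"
      have "(\<integral>\<^sup>+y\<in>{- k..k}. ennreal (cmod (G y)) \<partial>lborel) \<le> (\<integral>\<^sup>+y\<in>{- m..m}. \<Phi> m y \<partial>lborel)"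
      proof (intro nn_integral_mono mult_mono)
        fix y
        have "ennreal (cmod (G y)) \<le> (\<integral>\<^sup>+x. ennreal (cmod (indicator {a<..<b} x *\<^sub>R g (x, y))) \<partial>lborel)"
          unfolding G_def by (rule norm_integral_le_nn_integral)
        also have "\<dots> \<le> \<Phi> m y"
          unfolding \<Phi>_def by (intro nn_integral_mono) (auto simp: indicator_def m_def)
        finally show "ennreal (cmod (G y)) \<le> \<Phi> m y" .
        show "indicator {- k..k} y \<le> (indicator {- m..m} y :: ennreal)"
          by (auto simp: indicator_def m_def)
      qed auto
      also have "\<dots> < \<infinity>" by (rule \<Phi>fin)
      finally show ?thesis .
    qed
    have ffin: "integrable lborel (\<lambda>y. indicator {- k..k} y *\<^sub>R (f (b, y) - f (a, y)))" for k
      by (rule borel_integrable_compact) (auto intro!: continuous_intros continuous_on_subset[OF fy(2)])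
    have "AE y in lborel. (f (b, y) - f (a, y)) - G y = 0"
    proof (rule AE_eq_0_of_interval_integrals)
      show "(\<integral>\<^sup>+y\<in>ball 0 R. ennreal (cmod ((f (b, y) - f (a, y)) - G y)) \<partial>lborel) < \<infinity>" for R
      proof -
        have "(\<integral>\<^sup>+y\<in>ball 0 R. ennreal (cmod ((f (b, y) - f (a, y)) - G y)) \<partial>lborel)
          \<le> (\<integral>\<^sup>+y. ennreal (cmod (indicator {- R..R} y *\<^sub>R (f (b, y) - f (a, y)))) + ennreal (cmod (G y)) * indicator {- R..R} y \<partial>lborel)"
          by (intro nn_integral_mono) (auto simp: indicator_def norm_triangle_ineq4 simp flip: ennreal_plus)
        also have "\<dots> = (\<integral>\<^sup>+y. ennreal (cmod (indicator {- R..R} y *\<^sub>R (f (b, y) - f (a, y)))) \<partial>lborel) + (\<integral>\<^sup>+y\<in>{- R..R}. ennreal (cmod (G y)) \<partial>lborel)"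
          by (intro nn_integral_add) measurable
        also have "\<dots> < \<infinity>"
          using Gfin[of R] ffin[of R] unfolding integrable_iff_bounded by auto
        finally show ?thesis .
      qed
      fix c d :: real assume cd: "c < d"
      define k where "k = max \<bar>c\<bar> \<bar>d\<bar>"
      have i1: "integrable lborel (\<lambda>y. indicator {c<..<d} y *\<^sub>R (f (b, y) - f (a, y)))"
      proof (rule Bochner_Integration.integrable_bound[OF ffin[of k]])
        show "AE y in lborel. norm (indicator {c<..<d} y *\<^sub>R (f (b, y) - f (a, y))) \<le> norm (indicator {- k..k} y *\<^sub>R (f (b, y) - f (a, y)))"
          by (intro AE_I2) (auto simp: indicator_def k_def)
      qed measurable
      have i2: "integrable lborel (\<lambda>y. indicator {c<..<d} y *\<^sub>R G y)"
      proof (rule integrableI_bounded)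
        have "(\<integral>\<^sup>+y. ennreal (norm (indicator {c<..<d} y *\<^sub>R G y)) \<partial>lborel) \<le> (\<integral>\<^sup>+y\<in>{- k..k}. ennreal (cmod (G y)) \<partial>lborel)"
          by (intro nn_integral_mono) (auto simp: indicator_def k_def)
        also have "\<dots> < \<infinity>" by (rule Gfin)
        finally show "(\<integral>\<^sup>+y. ennreal (norm (indicator {c<..<d} y *\<^sub>R G y)) \<partial>lborel) < \<infinity>" .
      qed measurable
      have "integrable lborel (\<lambda>p. indicator ({a<..<b} \<times> {c<..<d}) p *\<^sub>R g p)"
      proof (rule Bochner_Integration.integrable_bound[OF gint[OF compact_Times[of "{a..b}" "{c..d}"]]])
        show "(\<lambda>p. indicator ({a<..<b} \<times> {c<..<d}) p *\<^sub>R g p) \<in> borel_measurable lborel"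
          using borel_open[OF open_Times[of "{a<..<b}" "{c<..<d}"]] by simp
        show "AE p in lborel. norm (indicator ({a<..<b} \<times> {c<..<d}) p *\<^sub>R g p) \<le> norm (indicator ({a..b} \<times> {c..d}) p *\<^sub>R g p)"
          by (intro AE_I2) (auto simp: indicator_def)
      qed auto
      moreover have e: "(\<lambda>p. indicator ({a<..<b} \<times> {c<..<d}) p *\<^sub>R g p) = case_prod (\<lambda>x y. indicator {c<..<d} y *\<^sub>R (indicator {a<..<b} x *\<^sub>R g (x, y)))"
        by (auto simp: fun_eq_iff indicator_def)
      ultimately have "integrable (lborel \<Otimes>\<^sub>M lborel) (case_prod (\<lambda>x y. indicator {c<..<d} y *\<^sub>R (indicator {a<..<b} x *\<^sub>R g (x, y))))"
        by (simp only: lborel_prod)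
      from lborel_pair.integral_snd[OF this]
      have "(\<integral>p. indicator ({a<..<b} \<times> {c<..<d}) p *\<^sub>R g p \<partial>lborel) = (\<integral>y. \<integral>x. indicator {c<..<d} y *\<^sub>R (indicator {a<..<b} x *\<^sub>R g (x, y)) \<partial>lborel \<partial>lborel)"
        unfolding e lborel_prod by simp
      also have "\<dots> = (\<integral>y. indicator {c<..<d} y *\<^sub>R G y \<partial>lborel)"
        unfolding G_def by (simp only: integral_scaleR_right)
      finally have "(\<integral>y. indicator {c<..<d} y *\<^sub>R G y \<partial>lborel) = (\<integral>y. indicator {c<..<d} y *\<^sub>R (f (b, y) - f (a, y)) \<partial>lborel)"
        using box_identity[OF f g gint H ab cd] by simp
      then show "(\<integral>y. indicator {c<..<d} y *\<^sub>R (f (b, y) - f (a, y) - G y) \<partial>lborel) = 0"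
        unfolding scaleR_diff_right[of _ "_ - _"] using Bochner_Integration.integral_diff[OF i1 i2] by simp
    qed measurable
    then show ?thesis
      unfolding G_def by eventually_elim simp
  qed
  have "AE y in lborel. \<forall>a\<in>\<rat>. \<forall>b\<in>\<rat>. a < b \<longrightarrow> f (b, y) - f (a, y) = (\<integral>x. indicator {a<..<b} x *\<^sub>R g (x, y) \<partial>lborel)"
    by (intro AE_ball_countable[THEN iffD2] ballI countable_rat) (use ae2 in auto)
  with ae1 show ?thesis
  proof eventually_elim
    case (elim y)
    have gy: "integrable lborel (\<lambda>x. indicator {a<..<b} x *\<^sub>R g (x, y))" for a b
    proof (rule integrableI_bounded)
      have "(\<integral>\<^sup>+x. ennreal (norm (indicator {a<..<b} x *\<^sub>R g (x, y))) \<partial>lborel) \<le> \<Phi> (max \<bar>a\<bar> \<bar>b\<bar>) y"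
        unfolding \<Phi>_def by (intro nn_integral_mono) (auto simp: indicator_def)
      also have "\<dots> < \<infinity>" using elim by blast
      finally show "(\<integral>\<^sup>+x. ennreal (norm (indicator {a<..<b} x *\<^sub>R g (x, y))) \<partial>lborel) < \<infinity>" .
    qed measurable
    have rat: "ennreal (cmod (f (b, y) - f (a, y) - of_real (b - a) * A)) \<le> (\<integral>\<^sup>+x\<in>{\<alpha>..\<beta>}. ennreal (cmod (g (x, y) - A)) \<partial>lborel)"
      if "a \<in> \<rat>" "b \<in> \<rat>" "a < b" "\<alpha> \<le> a" "b \<le> \<beta>" for a b \<alpha> \<beta> A
    proof -
      have "f (b, y) - f (a, y) - of_real (b - a) * A = (\<integral>x. indicator {a<..<b} x *\<^sub>R g (x, y) \<partial>lborel) - (\<integral>x. indicator {a<..<b} x *\<^sub>R A \<partial>lborel)"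
        using elim that by (simp add: scaleR_conv_of_real)
      also have "\<dots> = (\<integral>x. indicator {a<..<b} x *\<^sub>R (g (x, y) - A) \<partial>lborel)"
        unfolding scaleR_diff_right by (rule Bochner_Integration.integral_diff[symmetric, OF gy]) (use that in simp)
      finally have "ennreal (cmod (f (b, y) - f (a, y) - of_real (b - a) * A)) \<le> (\<integral>\<^sup>+x. ennreal (cmod (indicator {a<..<b} x *\<^sub>R (g (x, y) - A))) \<partial>lborel)"
        by (simp only: norm_integral_le_nn_integral)
      also have "\<dots> \<le> (\<integral>\<^sup>+x\<in>{\<alpha>..\<beta>}. ennreal (cmod (g (x, y) - A)) \<partial>lborel)"
        using that by (intro nn_integral_mono) (auto simp: indicator_def)
      finally show ?thesis .
    qed
    show ?case
    proof (intro allI impI)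
      fix \<alpha> \<beta> a b :: real and A assume ab: "a \<in> {\<alpha>..\<beta>}" "b \<in> {\<alpha>..\<beta>}"
      let ?R = "\<integral>\<^sup>+x\<in>{\<alpha>..\<beta>}. ennreal (cmod (g (x, y) - A)) \<partial>lborel"
      show "ennreal (cmod (f (b, y) - f (a, y) - of_real (b - a) * A)) \<le> ?R"
      proof (cases "a = b \<or> ?R = \<infinity>")
        case False
        then obtain M where M: "?R = ennreal M" "0 \<le> M"
          by (cases ?R) auto
        have \<alpha>\<beta>: "\<alpha> < \<beta>" using False ab by force
        \<comment> \<open>Pairs of rational interior points are dense in the square over the
          interval, and the left side is continuous in the pair. A finite right side is needed to
          compare in the reals; an infinite one is trivial.\<close>
        let ?S = "({\<alpha><..<\<beta>} \<inter> \<rat>) \<times> ({\<alpha><..<\<beta>} \<inter> \<rat>)"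
        let ?h = "\<lambda>p. cmod (f (snd p, y) - f (fst p, y) - of_real (snd p - fst p) * A)"
        have "?h (a, b) \<le> M"
        proof (rule continuous_le_on_closure[of ?S ?h])
          show "continuous_on (closure ?S) ?h"
            by (intro continuous_intros continuous_on_compose2[OF fy(1)]) auto
          show "(a, b) \<in> closure ?S"
            using closure_rat_interval[OF \<alpha>\<beta>] ab by (auto simp: closure_Times)
          fix p assume p: "p \<in> ?S"
          obtain s t where [simp]: "p = (s, t)" by (cases p)
          have "ennreal (cmod (f (t, y) - f (s, y) - of_real (t - s) * A)) \<le> ?R"
          proof (cases s t rule: linorder_cases)
            case less
            then show ?thesis using p by (intro rat) auto
          next
            case greater
            have "cmod (f (t, y) - f (s, y) - of_real (t - s) * A) = cmod (f (s, y) - f (t, y) - of_real (s - t) * A)"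
              by (subst norm_minus_cancel[symmetric]) (simp add: algebra_simps)
            also have "ennreal \<dots> \<le> ?R"
              using greater p by (intro rat) auto
            finally show ?thesis .
          qed simp
          then show "?h p \<le> M"
            using M by simp
        qed
        then show ?thesis
          using M by (simp add: ennreal_leI)
      qed auto
    qed
  qed
qed

section \<open>Differentiability almost everywhere\<close>

lemma measurable_Complex [measurable]: "(\<lambda>p. Complex (fst p) (snd p)) \<in> borel_measurable (borel \<Otimes>\<^sub>M borel)"
  unfolding borel_prod Complex_eq by (intro borel_measurable_continuous_onI continuous_intros)

lemma measurable_Complex_section [measurable]:
  "(\<lambda>x. Complex x y) \<in> borel_measurable borel" "(\<lambda>y. Complex x y) \<in> borel_measurable borel"
  unfolding Complex_eq by (intro borel_measurable_continuous_onI continuous_intros)+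

lemma emeasure_ball_complex_le: "0 \<le> r \<Longrightarrow> emeasure lborel (ball (z::complex) r) \<le> ennreal (4 * r^2)"
  using pi_less_4 by (subst emeasure_ball) (auto intro!: ennreal_leI mult_right_mono simp: unit_ball_vol_2)

lemma lborel_complex_eq: "(lborel :: complex measure) = distr (lborel \<Otimes>\<^sub>M lborel) borel (\<lambda>p. Complex (fst p) (snd p))"
proof (rule lborel_eqI)
  have m: "(\<lambda>p. Complex (fst p) (snd p)) \<in> borel_measurable (lborel \<Otimes>\<^sub>M lborel)"
    by measurable
  fix l u :: complex assume lu: "\<And>b. b \<in> Basis \<Longrightarrow> l \<bullet> b \<le> u \<bullet> b"
  then have le: "Re l \<le> Re u" "Im l \<le> Im u"
    using lu[of 1] lu[of \<i>] by (auto simp: Basis_complex_def)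
  have "(\<lambda>p. Complex (fst p) (snd p)) -` box l u = {Re l<..<Re u} \<times> {Im l<..<Im u}"
    by (auto simp: in_box_complex_iff)
  then have "emeasure (distr (lborel \<Otimes>\<^sub>M lborel) borel (\<lambda>p. Complex (fst p) (snd p))) (box l u) = emeasure (lborel \<Otimes>\<^sub>M lborel) ({Re l<..<Re u} \<times> {Im l<..<Im u})"
    using m by (subst emeasure_distr) (auto simp: space_pair_measure)
  also have "\<dots> = ennreal (Re u - Re l) * ennreal (Im u - Im l)"
    using le by (subst lborel.emeasure_pair_measure_Times) auto
  also have "\<dots> = (\<Prod>b\<in>Basis. (u - l) \<bullet> b)"
    using le by (simp add: Basis_complex_def ennreal_mult)
  finally show "emeasure (distr (lborel \<Otimes>\<^sub>M lborel) borel (\<lambda>p. Complex (fst p) (snd p))) (box l u) = (\<Prod>b\<in>Basis. (u - l) \<bullet> b)" .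
qed simp

lemma nn_integral_complex:
  assumes u [measurable]: "u \<in> borel_measurable borel"
  shows "(\<integral>\<^sup>+z. u z \<partial>lborel) = (\<integral>\<^sup>+y. \<integral>\<^sup>+x. u (Complex x y) \<partial>lborel \<partial>lborel)"
    and "(\<integral>\<^sup>+z. u z \<partial>lborel) = (\<integral>\<^sup>+x. \<integral>\<^sup>+y. u (Complex x y) \<partial>lborel \<partial>lborel)"
proof -
  have m: "(\<lambda>p. u (Complex (fst p) (snd p))) \<in> borel_measurable (lborel \<Otimes>\<^sub>M lborel)"
    by measurable
  have *: "(\<integral>\<^sup>+z. u z \<partial>lborel) = (\<integral>\<^sup>+p. u (Complex (fst p) (snd p)) \<partial>(lborel \<Otimes>\<^sub>M lborel))"
    by (subst lborel_complex_eq, subst nn_integral_distr) simp_all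
  show "(\<integral>\<^sup>+z. u z \<partial>lborel) = (\<integral>\<^sup>+y. \<integral>\<^sup>+x. u (Complex x y) \<partial>lborel \<partial>lborel)"
    unfolding * using lborel_pair.nn_integral_snd[OF m] by simp
  show "(\<integral>\<^sup>+z. u z \<partial>lborel) = (\<integral>\<^sup>+x. \<integral>\<^sup>+y. u (Complex x y) \<partial>lborel \<partial>lborel)"
    unfolding * using lborel.nn_integral_fst[OF m] by simp
qed

text \<open>Absolute continuity on one horizontal line, with derivative \<open>g\<close>. The slope
  \<open>A\<close> is subtracted so that one condition serves twice: \<open>A = 0\<close> bounds the
  variation of \<open>F\<close>, and \<open>A\<close> equal to a value of \<open>g\<close> bounds
  the deviation from an affine map.\<close>

definition horizontal_acl :: "(complex \<Rightarrow> complex) \<Rightarrow> (complex \<Rightarrow> complex) \<Rightarrow> real \<Rightarrow> bool" where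
  "horizontal_acl F g y \<longleftrightarrow> (\<forall>\<alpha> \<beta> a b A. a \<in> {\<alpha>..\<beta>} \<longrightarrow> b \<in> {\<alpha>..\<beta>} \<longrightarrow>
    ennreal (cmod (F (Complex b y) - F (Complex a y) - of_real (b - a) * A)) \<le> (\<integral>\<^sup>+x\<in>{\<alpha>..\<beta>}. ennreal (cmod (g (Complex x y) - A)) \<partial>lborel))"

definition vertical_acl :: "(complex \<Rightarrow> complex) \<Rightarrow> (complex \<Rightarrow> complex) \<Rightarrow> real \<Rightarrow> bool" where
  "vertical_acl F g x \<longleftrightarrow> (\<forall>\<alpha> \<beta> a b A. a \<in> {\<alpha>..\<beta>} \<longrightarrow> b \<in> {\<alpha>..\<beta>} \<longrightarrow>
    ennreal (cmod (F (Complex x b) - F (Complex x a) - of_real (b - a) * A)) \<le> (\<integral>\<^sup>+y\<in>{\<alpha>..\<beta>}. ennreal (cmod (g (Complex x y) - A)) \<partial>lborel))"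

section \<open>Differentiability at a common Lebesgue point\<close>

lemma exists_good_parameter:
  fixes \<Phi> :: "real \<Rightarrow> ennreal"
  assumes P: "AE y in lborel. P y" and [measurable]: "\<Phi> \<in> borel_measurable borel"
    and cd: "c < d" and \<kappa>: "0 \<le> \<kappa>" and int: "(\<integral>\<^sup>+y\<in>{c<..<d}. \<Phi> y \<partial>lborel) < ennreal (\<kappa> * (d - c))"
  shows "\<exists>y\<in>{c<..<d}. P y \<and> \<Phi> y \<le> ennreal \<kappa>"
proof (rule ccontr)
  assume "\<not> ?thesis"
  then have "AE y in lborel. ennreal \<kappa> * indicator {c<..<d} y \<le> \<Phi> y * indicator {c<..<d} y"
    using P by (auto elim!: eventually_mono simp: indicator_def not_le)
  then have "(\<integral>\<^sup>+y. ennreal \<kappa> * indicator {c<..<d} y \<partial>lborel) \<le> (\<integral>\<^sup>+y\<in>{c<..<d}. \<Phi> y \<partial>lborel)"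
    by (rule nn_integral_mono_AE)
  moreover have "(\<integral>\<^sup>+y. ennreal \<kappa> * indicator {c<..<d} y \<partial>lborel) = ennreal (\<kappa> * (d - c))"
    using cd \<kappa> by (simp add: nn_integral_cmult_indicator ennreal_mult)
  ultimately show False
    using int by simp
qed

lemma max_principle:
  fixes F :: "complex \<Rightarrow> complex"
  assumes F: "continuous_on UNIV F" "inj F" and K: "compact K"
    and bd: "\<And>q. q \<in> K - interior K \<Longrightarrow> cmod (F q - w) \<le> M" and z: "z \<in> K"
  shows "cmod (F z - w) \<le> M"
proof -
  have "continuous_on K (\<lambda>z. cmod (F z - w))"
    by (intro continuous_intros continuous_on_subset[OF F(1)]) auto
  then obtain m where m: "m \<in> K" "\<And>y. y \<in> K \<Longrightarrow> cmod (F y - w) \<le> cmod (F m - w)"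
    using continuous_attains_sup[OF K] z by blast
  have "m \<notin> interior K"
  proof
    assume mi: "m \<in> interior K"
    have "open (F ` interior K)"
      by (rule invariance_of_domain) (use F in \<open>auto intro: continuous_on_subset inj_on_subset\<close>)
    then obtain e where e: "e > 0" "ball (F m) e \<subseteq> F ` interior K"
      using mi open_contains_ball by (metis imageI)
    \<comment> \<open>The point at distance \<open>e / 2\<close> from \<open>F m\<close> in the
      direction away from \<open>w\<close>; if \<open>F m = w\<close>, every direction leads away,
      and 1 is taken.\<close>
    define v where "v = F m + of_real (e / 2) * (if F m = w then 1 else sgn (F m - w))"
    have n1: "cmod (if F m = w then 1 else sgn (F m - w)) = 1"
      by (simp add: norm_sgn)
    have "v \<in> ball (F m) e"
      using e(1) n1 by (simp add: v_def dist_norm norm_mult)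
    then obtain y where y: "y \<in> interior K" "v = F y"
      using e(2) by blast
    have "cmod (v - w) > cmod (F m - w)"
    proof (cases "F m = w")
      case True
      then show ?thesis using e(1) by (simp add: v_def)
    next
      case False
      define c where "c = sgn (F m - w)"
      have "F m - w = of_real (cmod (F m - w)) * c"
        using False by (simp add: c_def sgn_eq)
      moreover have "v - w = (F m - w) + of_real (e / 2) * c"
        using False by (simp add: v_def c_def)
      ultimately have "v - w = of_real (cmod (F m - w) + e / 2) * c"
        by (metis distrib_right of_real_add)
      then have "v - w = of_real (cmod (F m - w) + e / 2) * sgn (F m - w)"
        by (simp only: c_def)
      then have "cmod (v - w) = \<bar>cmod (F m - w) + e / 2\<bar> * 1"
        using False by (simp only: norm_mult norm_of_real norm_sgn) simp
      then show ?thesis using e(1) by simp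
    qed
    moreover have "cmod (F y - w) \<le> cmod (F m - w)"
      using m(2) y interior_subset by blast
    ultimately show False
      using y by simp
  qed
  then have "cmod (F m - w) \<le> M"
    using bd m by blast
  with m(2)[OF z] show ?thesis by simp
qed

lemma differentiable_at_lebesgue_point:
  fixes F gx gy :: "complex \<Rightarrow> complex"
  assumes F: "continuous_on UNIV F" "inj F"
    and g [measurable]: "gx \<in> borel_measurable borel" "gy \<in> borel_measurable borel"
    and acl: "AE y in lborel. horizontal_acl F gx y" "AE x in lborel. vertical_acl F gy x"
    and leb: "lebesgue_point gx z0" "lebesgue_point gy z0"
  shows "(F has_derivative (\<lambda>h. of_real (Re h) * gx z0 + of_real (Im h) * gy z0)) (at z0)"
proof -
  define A B where "A = gx z0" and "B = gy z0"
  define L where "L h = of_real (Re h) * A + of_real (Im h) * B" for h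
  have Lbl: "bounded_linear L"
    unfolding L_def by (intro bounded_linear_add bounded_linear_mult_const bounded_linear_of_real bounded_linear_compose[OF bounded_linear_of_real] bounded_linear_Re bounded_linear_Im)
  have Ladd: "L (p - q) = L p - L q" for p q
    by (simp add: L_def algebra_simps)
  define D where "D z = F z - L z" for z
  have "\<exists>d>0. \<forall>y. cmod (y - z0) < d \<longrightarrow> cmod (F y - F z0 - L (y - z0)) \<le> \<epsilon> * cmod (y - z0)" if \<epsilon>: "\<epsilon> > 0" for \<epsilon>
  proof -
    \<comment> \<open>Relative to the distance \<open>r\<close>, \<open>\<kappa>\<close> is the
      error allowed along a good line and \<open>\<sigma>\<close> the width of a strip in which such
      a line is sought. The final error is \<open>4 * \<kappa>\<close> plus
      \<open>4 * \<sigma>\<close> times the size of the affine map, and each of the two is kept at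
      most \<open>\<epsilon> / 2\<close>.\<close>
    define \<kappa> where "\<kappa> = \<epsilon> / 8"
    define \<sigma> where "\<sigma> = min 1 (\<epsilon> / (8 * (cmod A + cmod B + 1)))"
    have AB: "cmod A + cmod B + 1 > 0"
      using norm_ge_zero[of A] norm_ge_zero[of B] by linarith
    have \<kappa>: "\<kappa> > 0"
      using \<epsilon> by (simp add: \<kappa>_def)
    have \<sigma>: "\<sigma> > 0" "\<sigma> \<le> 1"
      using \<epsilon> AB by (auto simp: \<sigma>_def)
    have "\<sigma> \<le> \<epsilon> / (8 * (cmod A + cmod B + 1))"
      by (simp add: \<sigma>_def)
    then have "\<sigma> * (8 * (cmod A + cmod B + 1)) \<le> \<epsilon>"
      using AB by (subst (asm) pos_le_divide_eq) auto
    then have \<sigma>AB: "8 * (\<sigma> * (cmod A + cmod B)) \<le> \<epsilon>"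
      using \<sigma> by (simp add: algebra_simps)
    \<comment> \<open>The ball of radius \<open>5 * r\<close> has area at most
      \<open>100 * r^2\<close>. With this \<open>\<eta>\<close> the mean deviation over it is at
      most half of \<open>(\<kappa> * r) * (\<sigma> * r)\<close>, so a strip of width
      \<open>\<sigma> * r\<close> must contain a good line.\<close>
    define \<eta> where "\<eta> = \<kappa> * \<sigma> / 200"
    have \<eta>: "\<eta> > 0"
      using \<kappa> \<sigma> by (simp add: \<eta>_def)
    obtain \<delta>1 where \<delta>1: "\<delta>1 > 0" "\<And>r. 0 < r \<Longrightarrow> r < \<delta>1 \<Longrightarrow>
        (\<integral>\<^sup>+y\<in>ball z0 r. ennreal (cmod (gx y - A)) \<partial>lborel) \<le> ennreal \<eta> * emeasure lborel (ball z0 r)"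
      using leb(1)[unfolded lebesgue_point_def, rule_format, OF \<eta>] unfolding A_def by blast
    obtain \<delta>2 where \<delta>2: "\<delta>2 > 0" "\<And>r. 0 < r \<Longrightarrow> r < \<delta>2 \<Longrightarrow>
        (\<integral>\<^sup>+y\<in>ball z0 r. ennreal (cmod (gy y - B)) \<partial>lborel) \<le> ennreal \<eta> * emeasure lborel (ball z0 r)"
      using leb(2)[unfolded lebesgue_point_def, rule_format, OF \<eta>] unfolding B_def by blast
    have "cmod (F z1 - F z0 - L (z1 - z0)) \<le> \<epsilon> * cmod (z1 - z0)" if small: "cmod (z1 - z0) < min \<delta>1 \<delta>2 / 5" for z1
    proof (cases "z1 = z0")
      case False
      define r where "r = cmod (z1 - z0)"
      have r: "r > 0" "5 * r < \<delta>1" "5 * r < \<delta>2"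
        using False small by (auto simp: r_def)
      define x0 y0 where "x0 = Re z0" and "y0 = Im z0"
      \<comment> \<open>Half side \<open>2 * r\<close> leaves room for the lines around points at
        distance \<open>r\<close>, since \<open>\<sigma> \<le> 1\<close>; the square over
        \<open>X\<close> and \<open>Y\<close> lies in the ball of radius
        \<open>5 * r\<close>.\<close>
      define X where "X = {x0 - 2 * r..x0 + 2 * r}"
      define Y where "Y = {y0 - 2 * r..y0 + 2 * r}"
      define \<Phi> where "\<Phi> y = (\<integral>\<^sup>+x\<in>X. ennreal (cmod (gx (Complex x y) - A)) \<partial>lborel)" for y
      define \<Psi> where "\<Psi> x = (\<integral>\<^sup>+y\<in>Y. ennreal (cmod (gy (Complex x y) - B)) \<partial>lborel)" for x
      have [measurable]: "X \<in> sets borel" "Y \<in> sets borel"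
        by (simp_all add: X_def Y_def)
      have [measurable]: "(\<lambda>p. gx (Complex (snd p) (fst p))) \<in> borel_measurable (borel \<Otimes>\<^sub>M borel)"
          "(\<lambda>p. gy (Complex (fst p) (snd p))) \<in> borel_measurable (borel \<Otimes>\<^sub>M borel)"
        unfolding borel_prod Complex_eq
        by (rule measurable_compose[OF _ g(1)] measurable_compose[OF _ g(2)], intro borel_measurable_continuous_onI continuous_intros)+
      have [measurable]: "\<Phi> \<in> borel_measurable borel" "\<Psi> \<in> borel_measurable borel"
        unfolding \<Phi>_def \<Psi>_def by (intro lborel.borel_measurable_nn_integral, simp add: split_def)+
      have inball: "Complex x y \<in> ball z0 (5 * r)" if "x \<in> X" "y \<in> Y" for x y
      proof -
        have "cmod (Complex x y - z0) \<le> \<bar>x - x0\<bar> + \<bar>y - y0\<bar>"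
          using cmod_le[of "Complex x y - z0"] by (simp add: x0_def y0_def)
        also have "\<dots> \<le> 2 * r + 2 * r"
          using that by (intro add_mono) (auto simp: X_def Y_def abs_le_iff)
        finally show ?thesis
          using r(1) by (simp add: dist_norm norm_minus_commute)
      qed
      have [measurable]: "ball z0 (5 * r) \<in> sets borel" by simp
      have small_int: "(\<integral>\<^sup>+y\<in>ball z0 (5 * r). ennreal (cmod (gx y - A)) \<partial>lborel) < ennreal ((\<kappa> * r) * (\<sigma> * r))"
           "(\<integral>\<^sup>+y\<in>ball z0 (5 * r). ennreal (cmod (gy y - B)) \<partial>lborel) < ennreal ((\<kappa> * r) * (\<sigma> * r))"
      proof -
        have "ennreal \<eta> * emeasure lborel (ball z0 (5 * r)) \<le> ennreal \<eta> * ennreal (4 * (5 * r)^2)"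
          using r by (intro mult_left_mono emeasure_ball_complex_le) auto
        also have "\<dots> = ennreal ((\<kappa> * r) * (\<sigma> * r) / 2)"
          using \<eta> by (simp add: \<eta>_def ennreal_mult[symmetric] power2_eq_square field_simps)
        also have "\<dots> < ennreal ((\<kappa> * r) * (\<sigma> * r))"
          using \<kappa> \<sigma> r by (intro ennreal_lessI) (auto simp: field_simps)
        finally have *: "ennreal \<eta> * emeasure lborel (ball z0 (5 * r)) < ennreal ((\<kappa> * r) * (\<sigma> * r))" .
        show "(\<integral>\<^sup>+y\<in>ball z0 (5 * r). ennreal (cmod (gx y - A)) \<partial>lborel) < ennreal ((\<kappa> * r) * (\<sigma> * r))"
           "(\<integral>\<^sup>+y\<in>ball z0 (5 * r). ennreal (cmod (gy y - B)) \<partial>lborel) < ennreal ((\<kappa> * r) * (\<sigma> * r))"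
          using \<delta>1(2)[of "5 * r"] \<delta>2(2)[of "5 * r"] r * by (auto intro: order_le_less_trans)
      qed
      define goodH where "goodH y \<longleftrightarrow> (\<forall>a\<in>X. \<forall>b\<in>X. cmod (D (Complex b y) - D (Complex a y)) \<le> \<kappa> * r)" for y
      define goodV where "goodV x \<longleftrightarrow> (\<forall>a\<in>Y. \<forall>b\<in>Y. cmod (D (Complex x b) - D (Complex x a)) \<le> \<kappa> * r)" for x
      have \<kappa>r: "0 \<le> \<kappa> * r"
        using \<kappa> r by simp
      have exH: "\<exists>y\<in>{c<..<d}. goodH y" if cd: "c < d" "d - c = \<sigma> * r" "{c<..<d} \<subseteq> Y" for c d
      proof -
        have "(\<integral>\<^sup>+y\<in>{c<..<d}. \<Phi> y \<partial>lborel) = (\<integral>\<^sup>+y. \<integral>\<^sup>+x. ennreal (cmod (gx (Complex x y) - A)) * indicator X x * indicator {c<..<d} y \<partial>lborel \<partial>lborel)"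
          unfolding \<Phi>_def by (intro nn_integral_cong nn_integral_multc[symmetric]) measurable
        also have "\<dots> \<le> (\<integral>\<^sup>+y. \<integral>\<^sup>+x. ennreal (cmod (gx (Complex x y) - A)) * indicator (ball z0 (5 * r)) (Complex x y) \<partial>lborel \<partial>lborel)"
          using inball cd(3) by (intro nn_integral_mono) (auto simp: indicator_def simp del: mem_ball)
        also have "\<dots> = (\<integral>\<^sup>+y\<in>ball z0 (5 * r). ennreal (cmod (gx y - A)) \<partial>lborel)"
          by (rule nn_integral_complex(1)[symmetric]) measurable
        also note small_int(1)
        finally have "(\<integral>\<^sup>+y\<in>{c<..<d}. \<Phi> y \<partial>lborel) < ennreal ((\<kappa> * r) * (d - c))"
          unfolding cd(2) .
        from exists_good_parameter[OF acl(1) _ cd(1) \<kappa>r this]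
        obtain y where y: "y \<in> {c<..<d}" "horizontal_acl F gx y" "\<Phi> y \<le> ennreal (\<kappa> * r)"
          by auto
        have "cmod (D (Complex b y) - D (Complex a y)) \<le> \<kappa> * r" if "a \<in> X" "b \<in> X" for a b
        proof -
          have "ennreal (cmod (F (Complex b y) - F (Complex a y) - of_real (b - a) * A)) \<le> \<Phi> y"
            using y(2) that unfolding horizontal_acl_def X_def \<Phi>_def by blast
          also note y(3)
          finally have "cmod (F (Complex b y) - F (Complex a y) - of_real (b - a) * A) \<le> \<kappa> * r"
            using \<kappa>r by simp
          moreover have "F (Complex b y) - F (Complex a y) - of_real (b - a) * A = D (Complex b y) - D (Complex a y)"
            by (simp add: D_def L_def algebra_simps)
          ultimately show ?thesis by simp
        qed
        then show ?thesis
          using y(1) unfolding goodH_def by blast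
      qed
      have exV: "\<exists>x\<in>{c<..<d}. goodV x" if cd: "c < d" "d - c = \<sigma> * r" "{c<..<d} \<subseteq> X" for c d
      proof -
        have "(\<integral>\<^sup>+x\<in>{c<..<d}. \<Psi> x \<partial>lborel) = (\<integral>\<^sup>+x. \<integral>\<^sup>+y. ennreal (cmod (gy (Complex x y) - B)) * indicator Y y * indicator {c<..<d} x \<partial>lborel \<partial>lborel)"
          unfolding \<Psi>_def by (intro nn_integral_cong nn_integral_multc[symmetric]) measurable
        also have "\<dots> \<le> (\<integral>\<^sup>+x. \<integral>\<^sup>+y. ennreal (cmod (gy (Complex x y) - B)) * indicator (ball z0 (5 * r)) (Complex x y) \<partial>lborel \<partial>lborel)"
          using inball cd(3) by (intro nn_integral_mono) (auto simp: indicator_def simp del: mem_ball)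
        also have "\<dots> = (\<integral>\<^sup>+y\<in>ball z0 (5 * r). ennreal (cmod (gy y - B)) \<partial>lborel)"
          by (rule nn_integral_complex(2)[symmetric]) measurable
        also note small_int(2)
        finally have "(\<integral>\<^sup>+x\<in>{c<..<d}. \<Psi> x \<partial>lborel) < ennreal ((\<kappa> * r) * (d - c))"
          unfolding cd(2) .
        from exists_good_parameter[OF acl(2) _ cd(1) \<kappa>r this]
        obtain x where x: "x \<in> {c<..<d}" "vertical_acl F gy x" "\<Psi> x \<le> ennreal (\<kappa> * r)"
          by auto
        have "cmod (D (Complex x b) - D (Complex x a)) \<le> \<kappa> * r" if "a \<in> Y" "b \<in> Y" for a b
        proof -
          have "ennreal (cmod (F (Complex x b) - F (Complex x a) - of_real (b - a) * B)) \<le> \<Psi> x"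
            using x(2) that unfolding vertical_acl_def Y_def \<Psi>_def by blast
          also note x(3)
          finally have "cmod (F (Complex x b) - F (Complex x a) - of_real (b - a) * B) \<le> \<kappa> * r"
            using \<kappa>r by simp
          moreover have "F (Complex x b) - F (Complex x a) - of_real (b - a) * B = D (Complex x b) - D (Complex x a)"
            by (simp add: D_def L_def algebra_simps)
          ultimately show ?thesis by simp
        qed
        then show ?thesis
          using x(1) unfolding goodV_def by blast
      qed
      have \<sigma>r: "0 < \<sigma> * r" "\<sigma> * r \<le> r"
        using \<sigma> r by simp_all
      have pickV: "\<exists>x. c < x \<and> x < c + \<sigma> * r \<and> goodV x" if "x0 - 2 * r \<le> c" "c + \<sigma> * r \<le> x0 + 2 * r" for c
      proof -
        have "{c<..<c + \<sigma> * r} \<subseteq> X"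
          using that unfolding X_def by (intro subsetI) (simp only: greaterThanLessThan_iff atLeastAtMost_iff, linarith)
        then show ?thesis
          using exV[of c "c + \<sigma> * r"] \<sigma>r by auto
      qed
      have pickH: "\<exists>y. c < y \<and> y < c + \<sigma> * r \<and> goodH y" if "y0 - 2 * r \<le> c" "c + \<sigma> * r \<le> y0 + 2 * r" for c
      proof -
        have "{c<..<c + \<sigma> * r} \<subseteq> Y"
          using that unfolding Y_def by (intro subsetI) (simp only: greaterThanLessThan_iff atLeastAtMost_iff, linarith)
        then show ?thesis
          using exH[of c "c + \<sigma> * r"] \<sigma>r by auto
      qed
      obtain a where a: "a \<in> {x0 - \<sigma> * r<..<x0}" "goodV a"
        using pickV[of "x0 - \<sigma> * r"] \<sigma>r r(1) by auto
      obtain b where b: "b \<in> {y0 - \<sigma> * r<..<y0}" "goodH b"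
        using pickH[of "y0 - \<sigma> * r"] \<sigma>r r(1) by auto
      have aX: "a \<in> X" and bY: "b \<in> Y"
        using a b \<sigma>r by (auto simp: X_def Y_def)
      \<comment> \<open>The value of \<open>D\<close> where two good lines near \<open>z0\<close>
        cross. Every point of a good line in the square is joined to this crossing by two good
        segments, at cost \<open>2 * \<kappa> * r\<close>.\<close>
      define c where "c = D (Complex a b)"
      have cell: "cmod (D z - c) \<le> 2 * (\<kappa> * r) + 2 * (\<sigma> * r) * (cmod A + cmod B)"
        if z: "\<bar>Re z - x0\<bar> \<le> r" "\<bar>Im z - y0\<bar> \<le> r" for z
      proof -
        obtain x1 where x1: "x1 \<in> {Re z - \<sigma> * r<..<Re z}" "goodV x1"
          using pickV[of "Re z - \<sigma> * r"] \<sigma>r z by (auto simp: abs_le_iff)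
        obtain x2 where x2: "x2 \<in> {Re z<..<Re z + \<sigma> * r}" "goodV x2"
          using pickV[of "Re z"] \<sigma>r z by (auto simp: abs_le_iff)
        obtain y1 where y1: "y1 \<in> {Im z - \<sigma> * r<..<Im z}" "goodH y1"
          using pickH[of "Im z - \<sigma> * r"] \<sigma>r z by (auto simp: abs_le_iff)
        obtain y2 where y2: "y2 \<in> {Im z<..<Im z + \<sigma> * r}" "goodH y2"
          using pickH[of "Im z"] \<sigma>r z by (auto simp: abs_le_iff)
        let ?K = "cbox (Complex x1 y1) (Complex x2 y2)"
        \<comment> \<open>The maximum principle needs an open map, and \<open>D\<close> need not be
          one. It is applied to \<open>F\<close> with the constant \<open>c + L z\<close> instead;
          the variation of \<open>L\<close> over a cell of side at most
          \<open>2 * \<sigma> * r\<close> is the price.\<close>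
        have "cmod (F z - (c + L z)) \<le> 2 * (\<kappa> * r) + 2 * (\<sigma> * r) * (cmod A + cmod B)"
        proof (rule max_principle[OF F, of ?K])
          show "z \<in> ?K"
            using x1 x2 y1 y2 by (auto simp: in_cbox_complex_iff)
          fix q assume q: "q \<in> ?K - interior ?K"
          have qK: "x1 \<le> Re q" "Re q \<le> x2" "y1 \<le> Im q" "Im q \<le> y2"
            using q by (auto simp: in_cbox_complex_iff)
          have qX: "Re q \<in> X" "Im q \<in> Y"
            using qK x1(1) x2(1) y1(1) y2(1) z \<sigma>r unfolding X_def Y_def greaterThanLessThan_iff atLeastAtMost_iff abs_le_iff by linarith+
          have "Re q = x1 \<or> Re q = x2 \<or> Im q = y1 \<or> Im q = y2"
            using q qK by (auto simp: interior_cbox in_box_complex_iff)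
          then have "goodV (Re q) \<or> goodH (Im q)"
            using x1 x2 y1 y2 by auto
          then have Dq: "cmod (D q - c) \<le> 2 * (\<kappa> * r)"
          proof
            assume "goodV (Re q)"
            then have "cmod (D q - D (Complex (Re q) b)) \<le> \<kappa> * r"
              using qX bY unfolding goodV_def by (metis complex_surj)
            moreover have "cmod (D (Complex (Re q) b) - c) \<le> \<kappa> * r"
              using b(2) qX aX unfolding goodH_def c_def by blast
            ultimately show ?thesis
              using norm_triangle_ineq[of "D q - D (Complex (Re q) b)" "D (Complex (Re q) b) - c"] by simp
          next
            assume "goodH (Im q)"
            then have "cmod (D q - D (Complex a (Im q))) \<le> \<kappa> * r"
              using qX aX unfolding goodH_def by (metis complex_surj)
            moreover have "cmod (D (Complex a (Im q)) - c) \<le> \<kappa> * r"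
              using a(2) qX bY unfolding goodV_def c_def by blast
            ultimately show ?thesis
              using norm_triangle_ineq[of "D q - D (Complex a (Im q))" "D (Complex a (Im q)) - c"] by simp
          qed
          have "\<bar>Re (q - z)\<bar> \<le> 2 * (\<sigma> * r)" "\<bar>Im (q - z)\<bar> \<le> 2 * (\<sigma> * r)"
            using qK x1(1) x2(1) y1(1) y2(1) \<sigma>r by (simp_all add: abs_le_iff)
          then have "\<bar>Re (q - z)\<bar> * cmod A + \<bar>Im (q - z)\<bar> * cmod B \<le> 2 * (\<sigma> * r) * cmod A + 2 * (\<sigma> * r) * cmod B"
            by (intro add_mono mult_right_mono) auto
          moreover have "cmod (L (q - z)) \<le> \<bar>Re (q - z)\<bar> * cmod A + \<bar>Im (q - z)\<bar> * cmod B"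
            unfolding L_def by (rule order_trans[OF norm_triangle_ineq]) (simp only: norm_mult norm_of_real order_refl)
          ultimately have Lq: "cmod (L (q - z)) \<le> 2 * (\<sigma> * r) * (cmod A + cmod B)"
            by (simp add: distrib_left)
          have "F q - (c + L z) = (D q - c) + L (q - z)"
            by (simp add: D_def Ladd)
          then show "cmod (F q - (c + L z)) \<le> 2 * (\<kappa> * r) + 2 * (\<sigma> * r) * (cmod A + cmod B)"
            using norm_triangle_ineq[of "D q - c" "L (q - z)"] Dq Lq by (simp only:)
        qed auto
        then show ?thesis
          by (simp add: D_def algebra_simps)
      qed
      have "cmod (D z1 - c) \<le> 2 * (\<kappa> * r) + 2 * (\<sigma> * r) * (cmod A + cmod B)"
        using abs_Re_le_cmod[of "z1 - z0"] abs_Im_le_cmod[of "z1 - z0"] by (intro cell) (simp_all add: r_def x0_def y0_def)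
      moreover have "cmod (D z0 - c) \<le> 2 * (\<kappa> * r) + 2 * (\<sigma> * r) * (cmod A + cmod B)"
        using r by (intro cell) (simp_all add: x0_def y0_def)
      ultimately have "cmod (D z1 - D z0) \<le> 4 * (\<kappa> * r) + 4 * (\<sigma> * r) * (cmod A + cmod B)"
        using norm_triangle_ineq4[of "D z1 - c" "D z0 - c"] by simp
      also have "\<dots> = \<epsilon> / 2 * r + (8 * (\<sigma> * (cmod A + cmod B))) / 2 * r"
        by (simp add: \<kappa>_def algebra_simps)
      also have "\<dots> \<le> \<epsilon> / 2 * r + \<epsilon> / 2 * r"
        using \<sigma>AB r by (intro add_left_mono mult_right_mono divide_right_mono) auto
      finally show ?thesis
        by (simp add: D_def Ladd r_def algebra_simps)
    qed (simp add: L_def)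
    then show ?thesis
      using \<delta>1(1) \<delta>2(1) by (intro exI[of _ "min \<delta>1 \<delta>2 / 5"]) auto
  qed
  then have "(F has_derivative L) (at z0)"
    unfolding has_derivative_at_alt using Lbl by blast
  then show ?thesis
    unfolding L_def[abs_def] A_def B_def .
qed

section \<open>Regularity extracted from the definition of quasiconformality\<close>

lemma measurable_Complex_swap [measurable]: "(\<lambda>p. Complex (snd p) (fst p)) \<in> borel_measurable (borel \<Otimes>\<^sub>M borel)"
  unfolding borel_prod Complex_eq by (intro borel_measurable_continuous_onI continuous_intros)

text \<open>With the coordinates exchanged, \<open>AE_lines\<close>, which treats lines in the first
  coordinate, also applies to vertical lines.\<close>

lemma lborel_complex_eq_swap: "(lborel :: complex measure) = distr (lborel \<Otimes>\<^sub>M lborel) borel (\<lambda>p. Complex (snd p) (fst p))"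
proof -
  have "distr (lborel \<Otimes>\<^sub>M lborel) borel (\<lambda>p. Complex (fst p) (snd p)) =
    distr (distr (lborel \<Otimes>\<^sub>M lborel) (lborel \<Otimes>\<^sub>M lborel) (\<lambda>(x, y). (y, x))) borel (\<lambda>p. Complex (fst p) (snd p))"
    by (rule arg_cong[where f="\<lambda>M. distr M borel (\<lambda>p. Complex (fst p) (snd p))", OF lborel_pair.distr_pair_swap])
  also have "\<dots> = distr (lborel \<Otimes>\<^sub>M lborel) borel ((\<lambda>p. Complex (fst p) (snd p)) \<circ> (\<lambda>(x, y). (y, x)))"
    by (rule distr_distr) measurable
  finally show ?thesis
    unfolding lborel_complex_eq by (simp add: o_def split_def)
qed

lemma integral_complex:
  fixes u :: "complex \<Rightarrow> complex"
  assumes [measurable]: "u \<in> borel_measurable borel"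
  shows "(\<integral>z. u z \<partial>lborel) = (\<integral>p. u (Complex (fst p) (snd p)) \<partial>lborel)"
    and "(\<integral>z. u z \<partial>lborel) = (\<integral>p. u (Complex (snd p) (fst p)) \<partial>lborel)"
  by (subst lborel_complex_eq, subst integral_distr; simp add: lborel_prod[symmetric])
     (subst lborel_complex_eq_swap, subst integral_distr; simp add: lborel_prod[symmetric])

lemma integrable_complex:
  fixes u :: "complex \<Rightarrow> complex"
  assumes [measurable]: "u \<in> borel_measurable borel" and "integrable lborel u"
  shows "integrable lborel (\<lambda>p. u (Complex (fst p) (snd p)))"
    and "integrable lborel (\<lambda>p. u (Complex (snd p) (fst p)))"
proof -
  show "integrable lborel (\<lambda>p. u (Complex (fst p) (snd p)))"
    using assms(2) unfolding lborel_complex_eq lborel_prod[symmetric] by (subst (asm) integrable_distr_eq) simp_all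
  show "integrable lborel (\<lambda>p. u (Complex (snd p) (fst p)))"
    using assms(2) unfolding lborel_complex_eq_swap lborel_prod[symmetric] by (subst (asm) integrable_distr_eq) simp_all
qed

text \<open>The definition speaks of Lebesgue measurable functions, whereas sections along lines and
  the product structure are handled with Borel functions; changing a null set mediates.\<close>

lemma borel_representative:
  assumes g: "locally_integrable_on g UNIV"
  obtains g' where "g' \<in> borel_measurable borel" "AE z in lborel. g z = g' z"
    "\<And>C. compact C \<Longrightarrow> integrable lborel (\<lambda>z. indicator C z *\<^sub>R g' z)"
    "\<And>\<phi>. \<phi> \<in> borel_measurable borel \<Longrightarrow> (LINT z:UNIV|lebesgue. g z * \<phi> z) = (\<integral>z. g' z * \<phi> z \<partial>lborel)"
proof -
  have int: "integrable lebesgue (\<lambda>z. indicator C z *\<^sub>R g z)" if "compact C" for C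
    using g that by (simp add: locally_integrable_on_def set_integrable_def)
  have gm: "g \<in> borel_measurable lebesgue"
  proof (rule borel_measurable_LIMSEQ_metric)
    show "(\<lambda>z. indicator (cball 0 (real n)) z *\<^sub>R g z) \<in> borel_measurable lebesgue" for n
      by (rule borel_measurable_integrable[OF int]) simp
    show "(\<lambda>n. indicator (cball 0 (real n)) z *\<^sub>R g z) \<longlonglongrightarrow> g z" for z
    proof (rule tendsto_eventually)
      obtain m :: nat where "cmod z \<le> real m"
        using real_arch_simple by blast
      then show "\<forall>\<^sub>F n in sequentially. indicator (cball 0 (real n)) z *\<^sub>R g z = g z"
        by (intro eventually_sequentiallyI[of m]) (auto simp: indicator_def)
    qed
  qed
  have "(\<lambda>z. Re (g z)) \<in> borel_measurable lebesgue" "(\<lambda>z. Im (g z)) \<in> borel_measurable lebesgue"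
    using gm by measurable
  note this[THEN completion_ex_borel_measurable_real]
  then obtain u v where u: "u \<in> borel_measurable lborel" "AE z in lborel. Re (g z) = u z"
    and v: "v \<in> borel_measurable lborel" "AE z in lborel. Im (g z) = v z"
    by blast
  define g' where "g' z = Complex (u z) (v z)" for z
  have g' [measurable]: "g' \<in> borel_measurable borel"
    using u(1) v(1) unfolding g'_def Complex_eq by simp
  have ae: "AE z in lborel. g z = g' z"
    using u(2) v(2) by eventually_elim (simp add: g'_def complex_eq_iff)
  then have ae': "AE z in lebesgue. g z = g' z"
    by (rule AE_completion)
  show thesis
  proof (rule that[OF g' ae])
    show "integrable lborel (\<lambda>z. indicator C z *\<^sub>R g' z)" if C: "compact C" for C
    proof -
      have m: "(\<lambda>z. indicator C z *\<^sub>R g' z) \<in> borel_measurable lborel"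
        using compact_imp_closed[OF C] by simp
      then have "(\<lambda>z. indicator C z *\<^sub>R g' z) \<in> borel_measurable lebesgue"
        by (rule measurable_completion)
      moreover have "(\<lambda>z. indicator C z *\<^sub>R g z) \<in> borel_measurable lebesgue"
        by (rule borel_measurable_integrable[OF int[OF C]])
      ultimately have "integrable lebesgue (\<lambda>z. indicator C z *\<^sub>R g' z)"
        using int[OF C] ae' by (subst integrable_cong_AE[where g="\<lambda>z. indicator C z *\<^sub>R g z"]) (auto elim!: eventually_mono)
      then show ?thesis
        using integrable_completion[OF m] by simp
    qed
    fix \<phi> :: "complex \<Rightarrow> complex" assume \<phi> [measurable]: "\<phi> \<in> borel_measurable borel"
    have "(LINT z:UNIV|lebesgue. g z * \<phi> z) = (\<integral>z. g' z * \<phi> z \<partial>lebesgue)"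
      unfolding set_lebesgue_integral_def
    proof (rule integral_cong_AE)
      have "\<phi> \<in> borel_measurable lebesgue" "g' \<in> borel_measurable lebesgue"
        by (auto intro: measurable_completion)
      then show "(\<lambda>z. indicator UNIV z *\<^sub>R (g z * \<phi> z)) \<in> borel_measurable lebesgue" "(\<lambda>z. g' z * \<phi> z) \<in> borel_measurable lebesgue"
        using gm by simp_all
      show "AE z in lebesgue. indicator UNIV z *\<^sub>R (g z * \<phi> z) = g' z * \<phi> z"
        using ae' by eventually_elim simp
    qed
    also have "\<dots> = (\<integral>z. g' z * \<phi> z \<partial>lborel)"
      by (rule integral_completion) simp
    finally show "(LINT z:UNIV|lebesgue. g z * \<phi> z) = (\<integral>z. g' z * \<phi> z \<partial>lborel)" .
  qed
qed

lemma AE_acl: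
  fixes F gx gy :: "complex \<Rightarrow> complex"
  assumes F: "continuous_on UNIV F" and g [measurable]: "gx \<in> borel_measurable borel" "gy \<in> borel_measurable borel"
    and int: "\<And>C. compact C \<Longrightarrow> integrable lborel (\<lambda>z. indicator C z *\<^sub>R gx z)"
      "\<And>C. compact C \<Longrightarrow> integrable lborel (\<lambda>z. indicator C z *\<^sub>R gy z)"
    and parts: "\<And>\<phi>. test_function UNIV \<phi> \<Longrightarrow> (\<integral>z. gx z * \<phi> z \<partial>lborel) = - (\<integral>z. F z * frechet_derivative \<phi> (at z) 1 \<partial>lborel)"
      "\<And>\<phi>. test_function UNIV \<phi> \<Longrightarrow> (\<integral>z. gy z * \<phi> z \<partial>lborel) = - (\<integral>z. F z * frechet_derivative \<phi> (at z) \<i> \<partial>lborel)"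
  shows "AE y in lborel. horizontal_acl F gx y" "AE x in lborel. vertical_acl F gy x"
proof -
  have Fm [measurable]: "F \<in> borel_measurable borel"
    by (rule borel_measurable_continuous_onI[OF F])
  have cutm [measurable]: "cutoff n a b \<in> borel_measurable borel" "cutoff' n a b \<in> borel_measurable borel" for n a b
    unfolding cutoff_def[abs_def] cutoff'_def[abs_def]
    by (intro borel_measurable_continuous_onI continuous_intros continuous_on_compose2[OF continuous_flat[of UNIV]]; auto)+
  have cC: "continuous_on UNIV (\<lambda>p. Complex (fst p) (snd p))" "continuous_on UNIV (\<lambda>p. Complex (snd p) (fst p))"
    unfolding Complex_eq by (intro continuous_intros)+
  have ind: "integrable lborel (\<lambda>p. indicator C p *\<^sub>R gx (Complex (fst p) (snd p)))"
     "integrable lborel (\<lambda>p. indicator C p *\<^sub>R gy (Complex (snd p) (fst p)))" if C: "compact C" for C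
  proof -
    let ?D = "(\<lambda>p. Complex (fst p) (snd p)) ` C" and ?E = "(\<lambda>p. Complex (snd p) (fst p)) ` C"
    have D: "compact ?D" "compact ?E"
      using C by (auto intro!: compact_continuous_image continuous_on_subset[OF cC(1)] continuous_on_subset[OF cC(2)])
    have m: "(\<lambda>z. indicator ?D z *\<^sub>R gx z) \<in> borel_measurable borel" "(\<lambda>z. indicator ?E z *\<^sub>R gy z) \<in> borel_measurable borel"
      using compact_imp_closed[OF D(1)] compact_imp_closed[OF D(2)] by simp_all
    have i: "indicator ?D (Complex (fst p) (snd p)) = (indicator C p :: real)" "indicator ?E (Complex (snd p) (fst p)) = (indicator C p :: real)" for p
      by (auto simp: indicator_def image_iff prod_eq_iff)
    show "integrable lborel (\<lambda>p. indicator C p *\<^sub>R gx (Complex (fst p) (snd p)))"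
      using integrable_complex(1)[OF m(1) int(1)[OF D(1)]] unfolding i .
    show "integrable lborel (\<lambda>p. indicator C p *\<^sub>R gy (Complex (snd p) (fst p)))"
      using integrable_complex(2)[OF m(2) int(2)[OF D(2)]] unfolding i .
  qed
  have "AE y in lborel. \<forall>\<alpha> \<beta> a b A. a \<in> {\<alpha>..\<beta>} \<longrightarrow> b \<in> {\<alpha>..\<beta>} \<longrightarrow>
    ennreal (cmod ((\<lambda>p. F (Complex (fst p) (snd p))) (b, y) - (\<lambda>p. F (Complex (fst p) (snd p))) (a, y) - of_real (b - a) * A))
     \<le> (\<integral>\<^sup>+x\<in>{\<alpha>..\<beta>}. ennreal (cmod ((\<lambda>p. gx (Complex (fst p) (snd p))) (x, y) - A)) \<partial>lborel)"
  proof (rule AE_lines)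
    show "continuous_on UNIV (\<lambda>p. F (Complex (fst p) (snd p)))"
      by (rule continuous_on_compose2[OF F cC(1)]) auto
    show "(\<lambda>p. gx (Complex (fst p) (snd p))) \<in> borel_measurable borel"
      unfolding borel_prod[symmetric] by measurable
    fix n a b c d
    have 1: "(\<integral>z. gx z * box_cutoff n a b c d z \<partial>lborel) = (\<integral>p. gx (Complex (fst p) (snd p)) * of_real (cutoff n a b (fst p) * cutoff n c d (snd p)) \<partial>lborel)"
      unfolding box_cutoff_def by (subst integral_complex(1)) simp_all
    have 2: "(\<integral>z. F z * frechet_derivative (box_cutoff n a b c d) (at z) 1 \<partial>lborel) = (\<integral>p. F (Complex (fst p) (snd p)) * of_real (cutoff' n a b (fst p) * cutoff n c d (snd p)) \<partial>lborel)"
      unfolding box_cutoff_frechet by (subst integral_complex(1)) simp_all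
    show "(\<integral>p. gx (Complex (fst p) (snd p)) * of_real (cutoff n a b (fst p) * cutoff n c d (snd p)) \<partial>lborel)
        = - (\<integral>p. F (Complex (fst p) (snd p)) * of_real (cutoff' n a b (fst p) * cutoff n c d (snd p)) \<partial>lborel)"
      using parts(1)[OF test_function_box_cutoff[of n a b c d]] unfolding 1 2 .
  qed (rule ind)
  then show "AE y in lborel. horizontal_acl F gx y"
    by (simp add: horizontal_acl_def)
  have "AE y in lborel. \<forall>\<alpha> \<beta> a b A. a \<in> {\<alpha>..\<beta>} \<longrightarrow> b \<in> {\<alpha>..\<beta>} \<longrightarrow>
    ennreal (cmod ((\<lambda>p. F (Complex (snd p) (fst p))) (b, y) - (\<lambda>p. F (Complex (snd p) (fst p))) (a, y) - of_real (b - a) * A))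
     \<le> (\<integral>\<^sup>+x\<in>{\<alpha>..\<beta>}. ennreal (cmod ((\<lambda>p. gy (Complex (snd p) (fst p))) (x, y) - A)) \<partial>lborel)"
  proof (rule AE_lines)
    show "continuous_on UNIV (\<lambda>p. F (Complex (snd p) (fst p)))"
      by (rule continuous_on_compose2[OF F cC(2)]) auto
    show "(\<lambda>p. gy (Complex (snd p) (fst p))) \<in> borel_measurable borel"
      unfolding borel_prod[symmetric] by measurable
    fix n a b c d
    have 1: "(\<integral>z. gy z * box_cutoff n c d a b z \<partial>lborel) = (\<integral>p. gy (Complex (snd p) (fst p)) * of_real (cutoff n a b (fst p) * cutoff n c d (snd p)) \<partial>lborel)"
      unfolding box_cutoff_def by (subst integral_complex(2)) (simp_all add: mult_ac)
    have 2: "(\<integral>z. F z * frechet_derivative (box_cutoff n c d a b) (at z) \<i> \<partial>lborel) = (\<integral>p. F (Complex (snd p) (fst p)) * of_real (cutoff' n a b (fst p) * cutoff n c d (snd p)) \<partial>lborel)"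
      unfolding box_cutoff_frechet by (subst integral_complex(2)) (simp_all add: mult_ac)
    show "(\<integral>p. gy (Complex (snd p) (fst p)) * of_real (cutoff n a b (fst p) * cutoff n c d (snd p)) \<partial>lborel)
        = - (\<integral>p. F (Complex (snd p) (fst p)) * of_real (cutoff' n a b (fst p) * cutoff n c d (snd p)) \<partial>lborel)"
      using parts(2)[OF test_function_box_cutoff[of n c d a b]] unfolding 1 2 .
  qed (rule ind)
  then show "AE x in lborel. vertical_acl F gy x"
    by (simp add: vertical_acl_def)
qed

text \<open>All that the length-area argument takes from the analytic definition. The point is that
  one pair \<open>p\<close>, \<open>q\<close> governs both the variation along lines and the
  classical derivative, so length and area are computed with the same functions.\<close>

lemma quasiconformal_regular:
  assumes qc: "quasiconformal_on K UNIV F"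
  obtains p q where "p \<in> borel_measurable borel" "q \<in> borel_measurable borel"
    "AE y in lborel. horizontal_acl F (\<lambda>z. p z + q z) y" "AE x in lborel. vertical_acl F (\<lambda>z. \<i> * (p z - q z)) x"
    "AE z in lborel. (F has_derivative (\<lambda>h. p z * h + q z * cnj h)) (at z)"
    "AE z in lborel. cmod (q z) < cmod (p z) \<and> cmod (p z) + cmod (q z) \<le> K * (cmod (p z) - cmod (q z))"
proof -
  obtain Fz Fzb where d: "distrib_dz_on UNIV F Fz" "distrib_dzbar_on UNIV F Fzb"
    and ess: "esssup (lebesgue_on UNIV) (\<lambda>z. dilatation (Fz z) (Fzb z)) \<le> ereal K"
    using qc by (auto simp: quasiconformal_on_def)
  obtain G where "homeomorphism UNIV (F ` UNIV) F G"
    using qc by (auto simp: quasiconformal_on_def)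
  then have F: "continuous_on UNIV F" "inj F"
    by (auto simp: homeomorphism_def intro: inj_on_inverseI)
  have loc: "locally_integrable_on Fz UNIV" "locally_integrable_on Fzb UNIV"
    using d by (auto simp: distrib_dz_on_def distrib_dzbar_on_def)
  obtain p where p [measurable]: "p \<in> borel_measurable borel" and p': "AE z in lborel. Fz z = p z"
    "\<And>C. compact C \<Longrightarrow> integrable lborel (\<lambda>z. indicator C z *\<^sub>R p z)"
    "\<And>\<phi>. \<phi> \<in> borel_measurable borel \<Longrightarrow> (LINT z:UNIV|lebesgue. Fz z * \<phi> z) = (\<integral>z. p z * \<phi> z \<partial>lborel)"
    using borel_representative[OF loc(1)] by blast
  obtain q where q [measurable]: "q \<in> borel_measurable borel" and q': "AE z in lborel. Fzb z = q z"
    "\<And>C. compact C \<Longrightarrow> integrable lborel (\<lambda>z. indicator C z *\<^sub>R q z)"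
    "\<And>\<phi>. \<phi> \<in> borel_measurable borel \<Longrightarrow> (LINT z:UNIV|lebesgue. Fzb z * \<phi> z) = (\<integral>z. q z * \<phi> z \<partial>lborel)"
    using borel_representative[OF loc(2)] by blast
  have Fm [measurable]: "F \<in> borel_measurable borel"
    by (rule borel_measurable_continuous_onI[OF F(1)])
  \<comment> \<open>The partial derivatives in x and y, recovered from the two Wirtinger
    derivatives.\<close>
  define gx where "gx z = p z + q z" for z
  define gy where "gy z = \<i> * (p z - q z)" for z
  have gm: "gx \<in> borel_measurable borel" "gy \<in> borel_measurable borel"
    unfolding gx_def gy_def by measurable
  have gint: "integrable lborel (\<lambda>z. indicator C z *\<^sub>R gx z)" "integrable lborel (\<lambda>z. indicator C z *\<^sub>R gy z)" if C: "compact C" for C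
  proof -
    have e: "indicator C z *\<^sub>R gx z = indicator C z *\<^sub>R p z + indicator C z *\<^sub>R q z"
      "indicator C z *\<^sub>R gy z = \<i> * (indicator C z *\<^sub>R p z - indicator C z *\<^sub>R q z)" for z
      by (simp_all add: gx_def gy_def algebra_simps)
    show "integrable lborel (\<lambda>z. indicator C z *\<^sub>R gx z)" "integrable lborel (\<lambda>z. indicator C z *\<^sub>R gy z)"
      unfolding e using p'(2)[OF C] q'(2)[OF C] by simp_all
  qed
  have parts: "(\<integral>z. gx z * \<phi> z \<partial>lborel) = - (\<integral>z. F z * frechet_derivative \<phi> (at z) 1 \<partial>lborel)"
      "(\<integral>z. gy z * \<phi> z \<partial>lborel) = - (\<integral>z. F z * frechet_derivative \<phi> (at z) \<i> \<partial>lborel)"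
    if \<phi>: "test_function UNIV \<phi>" for \<phi>
  proof -
    obtain R B where t: "continuous_on UNIV \<phi>" "\<And>z. z \<notin> cball 0 R \<Longrightarrow> \<phi> z = 0"
      "\<And>v. continuous_on UNIV (\<lambda>z. frechet_derivative \<phi> (at z) v)"
      "\<And>z v. z \<notin> cball 0 R \<Longrightarrow> frechet_derivative \<phi> (at z) v = 0" "\<And>z. cmod (\<phi> z) \<le> B"
      by (rule test_functionE[OF \<phi>], rule that)
    have \<phi>m [measurable]: "\<phi> \<in> borel_measurable borel"
      by (rule borel_measurable_continuous_onI[OF t(1)])
    have ip: "integrable lborel (\<lambda>z. u z * \<phi> z)" if u: "u \<in> borel_measurable borel" "integrable lborel (\<lambda>z. indicator (cball 0 R) z *\<^sub>R u z)" for u :: "complex \<Rightarrow> complex"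
    proof (rule Bochner_Integration.integrable_bound)
      show "integrable lborel (\<lambda>z. B *\<^sub>R (indicator (cball 0 R) z *\<^sub>R u z))"
        by (rule integrable_scaleR_right[OF u(2)])
      show "AE z in lborel. norm (u z * \<phi> z) \<le> norm (B *\<^sub>R (indicator (cball 0 R) z *\<^sub>R u z))"
      proof (rule AE_I2)
        fix z
        show "norm (u z * \<phi> z) \<le> norm (B *\<^sub>R (indicator (cball 0 R) z *\<^sub>R u z))"
        proof (cases "z \<in> cball 0 R")
          case True
          have "cmod (u z) * cmod (\<phi> z) \<le> cmod (u z) * \<bar>B\<bar>"
            using t(5)[of z] by (intro mult_left_mono) auto
          then show ?thesis
            using True by (simp add: norm_mult mult.commute)
        qed (simp add: t(2))
      qed
    qed (use u in simp)
    have ipp: "integrable lborel (\<lambda>z. p z * \<phi> z)" "integrable lborel (\<lambda>z. q z * \<phi> z)"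
      by (intro ip p'(2) q'(2) p q; simp)+
    have iF: "integrable lborel (\<lambda>z. F z * frechet_derivative \<phi> (at z) v)" for v
      by (rule integrable_continuous_support[where C="cball 0 R"]) (auto intro!: continuous_intros F(1) t(3) simp: t(4))
    have lin: "(\<integral>z. a * u z + b * v z \<partial>lborel) = a * (\<integral>z. u z \<partial>lborel) + b * (\<integral>z. v z \<partial>lborel)"
      if "integrable lborel u" "integrable lborel v" for a b and u v :: "complex \<Rightarrow> complex"
      using that by simp
    have e: "F z * wirtinger_dz \<phi> z = (1/2) * (F z * frechet_derivative \<phi> (at z) 1) + (- \<i>/2) * (F z * frechet_derivative \<phi> (at z) \<i>)"
       "F z * wirtinger_dzbar \<phi> z = (1/2) * (F z * frechet_derivative \<phi> (at z) 1) + (\<i>/2) * (F z * frechet_derivative \<phi> (at z) \<i>)" for z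
      by (simp_all add: wirtinger_dz_def wirtinger_dzbar_def field_simps)
    have [measurable]: "(\<lambda>z. frechet_derivative \<phi> (at z) v) \<in> borel_measurable borel" for v
      by (rule borel_measurable_continuous_onI[OF t(3)])
    have wm: "wirtinger_dz \<phi> \<in> borel_measurable borel" "wirtinger_dzbar \<phi> \<in> borel_measurable borel"
      unfolding wirtinger_dz_def[abs_def] wirtinger_dzbar_def[abs_def] by measurable
    have conv: "(LINT z:UNIV|lebesgue. F z * v z) = (\<integral>z. F z * v z \<partial>lborel)" if "v \<in> borel_measurable borel" for v
      unfolding set_lebesgue_integral_def using that by (subst integral_completion) simp_all
    have "(\<integral>z. p z * \<phi> z \<partial>lborel) = - (\<integral>z. F z * wirtinger_dz \<phi> z \<partial>lborel)"
      using d(1) \<phi> p'(3)[OF \<phi>m] conv[OF wm(1)] by (simp add: distrib_dz_on_def)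
    then have P: "(\<integral>z. p z * \<phi> z \<partial>lborel) = - ((1/2) * (\<integral>z. F z * frechet_derivative \<phi> (at z) 1 \<partial>lborel) + (- \<i>/2) * (\<integral>z. F z * frechet_derivative \<phi> (at z) \<i> \<partial>lborel))"
      unfolding e lin[OF iF iF] .
    have "(\<integral>z. q z * \<phi> z \<partial>lborel) = - (\<integral>z. F z * wirtinger_dzbar \<phi> z \<partial>lborel)"
      using d(2) \<phi> q'(3)[OF \<phi>m] conv[OF wm(2)] by (simp add: distrib_dzbar_on_def)
    then have Q: "(\<integral>z. q z * \<phi> z \<partial>lborel) = - ((1/2) * (\<integral>z. F z * frechet_derivative \<phi> (at z) 1 \<partial>lborel) + (\<i>/2) * (\<integral>z. F z * frechet_derivative \<phi> (at z) \<i> \<partial>lborel))"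
      unfolding e lin[OF iF iF] .
    have e': "gx z * \<phi> z = 1 * (p z * \<phi> z) + 1 * (q z * \<phi> z)" "gy z * \<phi> z = \<i> * (p z * \<phi> z) + (- \<i>) * (q z * \<phi> z)" for z
      by (simp_all add: gx_def gy_def algebra_simps)
    show "(\<integral>z. gx z * \<phi> z \<partial>lborel) = - (\<integral>z. F z * frechet_derivative \<phi> (at z) 1 \<partial>lborel)"
      "(\<integral>z. gy z * \<phi> z \<partial>lborel) = - (\<integral>z. F z * frechet_derivative \<phi> (at z) \<i> \<partial>lborel)"
      unfolding e' lin[OF ipp] P Q by (simp_all add: field_simps)
  qed
  note acl = AE_acl[OF F(1) gm gint parts]
  have fin: "(\<integral>\<^sup>+y\<in>ball 0 R. ennreal (cmod (u y)) \<partial>lborel) < \<infinity>"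
    if "u \<in> borel_measurable borel" "\<And>C. compact C \<Longrightarrow> integrable lborel (\<lambda>z. indicator C z *\<^sub>R u z)" for u :: "complex \<Rightarrow> complex" and R
  proof -
    have "(\<integral>\<^sup>+y\<in>ball 0 R. ennreal (cmod (u y)) \<partial>lborel) \<le> (\<integral>\<^sup>+y. ennreal (norm (indicator (cball 0 R) y *\<^sub>R u y)) \<partial>lborel)"
      by (intro nn_integral_mono) (auto simp: indicator_def)
    also have "\<dots> < \<infinity>"
      using that(2)[of "cball 0 R"] unfolding integrable_iff_bounded by auto
    finally show ?thesis .
  qed
  have "AE z in lborel. lebesgue_point gx z" "AE z in lborel. lebesgue_point gy z"
    by (intro AE_lebesgue_point gm fin gint; assumption)+
  then have der: "AE z in lborel. (F has_derivative (\<lambda>h. p z * h + q z * cnj h)) (at z)"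
  proof eventually_elim
    case (elim z)
    have "of_real (Re h) * gx z + of_real (Im h) * gy z = p z * h + q z * cnj h" for h
    proof -
      have h: "h = of_real (Re h) + \<i> * of_real (Im h)" "cnj h = of_real (Re h) - \<i> * of_real (Im h)"
        by (simp_all add: complex_eq_iff)
      show ?thesis
        by (subst (3) h(1), subst h(2)) (simp add: gx_def gy_def algebra_simps)
    qed
    then show ?case
      using differentiable_at_lebesgue_point[OF F gm acl elim] by simp
  qed
  have "AE z in lebesgue_on UNIV. dilatation (Fz z) (Fzb z) \<le> esssup (lebesgue_on UNIV) (\<lambda>z. dilatation (Fz z) (Fzb z))"
    by (rule esssup_AE)
  then have "AE z in lebesgue. dilatation (Fz z) (Fzb z) \<le> ereal K"
    unfolding lebesgue_on_UNIV_eq by eventually_elim (use ess in \<open>auto simp: lebesgue_on_UNIV_eq\<close>)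
  then have "AE z in lborel. dilatation (Fz z) (Fzb z) \<le> ereal K"
    by (simp add: AE_completion_iff)
  \<comment> \<open>Strictness comes for free: \<open>dilatation\<close> is infinite unless
    \<open>q\<close> has the smaller modulus, and the bound \<open>K\<close> is finite.\<close>
  with p'(1) q'(1) have dil: "AE z in lborel. cmod (q z) < cmod (p z) \<and> cmod (p z) + cmod (q z) \<le> K * (cmod (p z) - cmod (q z))"
  proof eventually_elim
    case (elim z)
    then show ?case
      by (auto simp: dilatation_def pos_divide_le_eq split: if_splits)
  qed
  show thesis
    using that[OF p q acl(1)[unfolded gx_def[abs_def]] acl(2)[unfolded gy_def[abs_def]] der dil] .
qed

section \<open>The length-area estimate\<close>

text \<open>Determinants and the change of variables formula live on \<open>real^2\<close>; these
  isometries carry the Jacobian there and back.\<close>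

definition complex_of_vec :: "real^2 \<Rightarrow> complex" where
  "complex_of_vec v = Complex (v $ 1) (v $ 2)"

definition vec_of_complex :: "complex \<Rightarrow> real^2" where
  "vec_of_complex z = vector [Re z, Im z]"

lemma complex_vec_inverse [simp]: "complex_of_vec (vec_of_complex z) = z" "vec_of_complex (complex_of_vec v) = v"
  by (simp_all add: complex_of_vec_def vec_of_complex_def vec_eq_iff forall_2)

lemma bounded_linear_complex_vec: "bounded_linear complex_of_vec" "bounded_linear vec_of_complex"
proof -
  have "linear complex_of_vec"
    by (rule linearI) (simp_all add: complex_of_vec_def complex_eq_iff)
  then show "bounded_linear complex_of_vec"
    by (simp add: linear_conv_bounded_linear)
  have "linear vec_of_complex"
    by (rule linearI) (simp_all add: vec_of_complex_def vec_eq_iff forall_2)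
  then show "bounded_linear vec_of_complex"
    by (simp add: linear_conv_bounded_linear)
qed

lemma measurable_complex_of_vec [measurable]: "complex_of_vec \<in> borel_measurable borel"
  by (intro borel_measurable_continuous_onI linear_continuous_on bounded_linear_complex_vec)

lemma prod_Basis_vec2: "(\<Prod>b\<in>(Basis :: (real^2) set). v \<bullet> b) = v $ 1 * v $ 2"
proof -
  have *: "(Basis :: (real^2) set) = {axis 1 1, axis 2 1}"
    by (auto simp: Basis_vec_def UNIV_2)
  have "axis 1 (1::real) \<noteq> (axis 2 1 :: real^2)"
    by (simp add: axis_eq_axis)
  then show ?thesis
    unfolding * by (simp add: inner_axis)
qed

lemma lborel_complex_eq_vec: "(lborel :: complex measure) = distr lborel borel complex_of_vec"
proof (rule lborel_eqI)
  fix l u :: complex assume lu: "\<And>b. b \<in> Basis \<Longrightarrow> l \<bullet> b \<le> u \<bullet> b"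
  then have le: "Re l \<le> Re u" "Im l \<le> Im u"
    using lu[of 1] lu[of \<i>] by (auto simp: Basis_complex_def)
  have "complex_of_vec -` box l u = box (vec_of_complex l) (vec_of_complex u)"
    by (auto simp: in_box_complex_iff mem_box_cart forall_2 complex_of_vec_def vec_of_complex_def)
  then have "emeasure (distr lborel borel complex_of_vec) (box l u) = emeasure lborel (box (vec_of_complex l) (vec_of_complex u))"
    by (subst emeasure_distr) auto
  also have "\<dots> = ennreal (\<Prod>b\<in>Basis. (vec_of_complex u - vec_of_complex l) \<bullet> b)"
  proof (rule emeasure_lborel_box)
    fix b :: "real^2" assume "b \<in> Basis"
    then have "b = axis 1 1 \<or> b = axis 2 1"
      by (auto simp: Basis_vec_def UNIV_2)
    then show "vec_of_complex l \<bullet> b \<le> vec_of_complex u \<bullet> b"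
      using le by (auto simp: inner_axis vec_of_complex_def)
  qed
  also have "\<dots> = (\<Prod>b\<in>Basis. (u - l) \<bullet> b)"
    using le by (simp add: prod_Basis_vec2 Basis_complex_def vec_of_complex_def)
  finally show "emeasure (distr lborel borel complex_of_vec) (box l u) = (\<Prod>b\<in>Basis. (u - l) \<bullet> b)" .
qed simp

lemma norm_vec_of_complex: "norm (vec_of_complex z) = cmod z"
  by (simp add: norm_vec_def L2_set_def sum_2 vec_of_complex_def cmod_def)

section \<open>Area of the image\<close>

text \<open>The change of variables formula for an injective map that is differentiable at every
  point of \<open>S\<close>. The determinant of the derivative is the difference of the squared
  moduli of \<open>p\<close> and \<open>q\<close>. The image lies in a disc of radius
  \<open>\<rho>\<close>, whose area is estimated by \<open>4 * \<rho>^2\<close>.\<close>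

lemma area_inequality:
  fixes F p q :: "complex \<Rightarrow> complex"
  assumes inj: "inj F" and pq [measurable]: "p \<in> borel_measurable borel" "q \<in> borel_measurable borel"
    and S [measurable]: "S \<in> sets borel"
    and der: "\<And>z. z \<in> S \<Longrightarrow> (F has_derivative (\<lambda>h. p z * h + q z * cnj h)) (at z)"
    and lt: "\<And>z. z \<in> S \<Longrightarrow> cmod (q z) < cmod (p z)"
    and im: "F ` S \<subseteq> ball 0 \<rho>" and \<rho>: "0 \<le> \<rho>"
  shows "(\<integral>\<^sup>+z\<in>S. ennreal ((cmod (p z))^2 - (cmod (q z))^2) \<partial>lborel) \<le> ennreal (4 * \<rho>^2)"
proof -
  let ?V = vec_of_complex and ?C = complex_of_vec
  define f where "f v = ?V (F (?C v))" for v
  define f' where "f' v h = ?V (p (?C v) * ?C h + q (?C v) * cnj (?C h))" for v h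
  define T where "T = ?C -` S"
  have T: "T \<in> sets borel"
    using measurable_sets[OF measurable_complex_of_vec S] by (simp add: T_def)
  have Tl: "T \<in> sets lebesgue"
    using T by simp
  have derf: "(f has_derivative f' v) (at v within T)" if "v \<in> T" for v
  proof -
    have "(?C has_derivative ?C) (at v)"
      by (rule bounded_linear_imp_has_derivative[OF bounded_linear_complex_vec(1)])
    moreover have "(F has_derivative (\<lambda>h. p (?C v) * h + q (?C v) * cnj h)) (at (?C v))"
      using that der by (simp add: T_def)
    ultimately have "((\<lambda>v. F (?C v)) has_derivative (\<lambda>h. p (?C v) * ?C h + q (?C v) * cnj (?C h))) (at v)"
      by (rule has_derivative_compose)
    from bounded_linear.has_derivative[OF bounded_linear_complex_vec(2) this]
    have "(f has_derivative f' v) (at v)"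
      by (simp add: f_def[abs_def] f'_def[abs_def])
    then show ?thesis
      by (rule has_derivative_at_withinI)
  qed
  have injf: "inj_on f T"
    unfolding f_def using inj by (auto simp: inj_on_def inj_def) (metis complex_vec_inverse)
  have det: "\<bar>det (matrix (f' v))\<bar> = (cmod (p (?C v)))^2 - (cmod (q (?C v)))^2" if "v \<in> T" for v
  proof -
    have c: "?C (axis 1 1) = 1" "?C (axis 2 1) = \<i>"
      by (simp_all add: complex_of_vec_def axis_def complex_eq_iff)
    have "det (matrix (f' v)) = (cmod (p (?C v)))^2 - (cmod (q (?C v)))^2"
      unfolding det_2 matrix_def f'_def
      by (simp add: c vec_of_complex_def cmod_power2) (simp add: power2_eq_square algebra_simps)
    moreover have "(cmod (q (?C v)))^2 \<le> (cmod (p (?C v)))^2"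
      using lt[of "?C v"] that by (intro power_mono) (auto simp: T_def)
    ultimately show ?thesis by simp
  qed
  have fT: "f ` T \<subseteq> ball 0 \<rho>"
    using im by (auto simp: f_def T_def norm_vec_of_complex)
  have "f ` T \<in> sets lebesgue"
    by (rule differentiable_image_in_sets_lebesgue[OF Tl]) (use derf in \<open>auto simp: differentiable_on_def differentiable_def\<close>)
  then have lm: "f ` T \<in> lmeasurable"
    using fT bounded_subset[OF bounded_ball] by (intro bounded_set_imp_lmeasurable) auto
  have "((\<lambda>v. \<bar>det (matrix (f' v))\<bar>) has_integral measure lebesgue (f ` T)) T"
    using has_measure_differentiable_image[OF Tl derf injf] lm by blast
  then have "(\<integral>\<^sup>+v. ennreal (indicator T v * \<bar>det (matrix (f' v))\<bar>) \<partial>lborel) = ennreal (measure lebesgue (f ` T))"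
    by (rule nn_integral_has_integral_lebesgue[rotated]) simp
  also have "\<dots> = emeasure lebesgue (f ` T)"
    using lm by (simp add: emeasure_eq_measure2)
  also have "\<dots> \<le> emeasure lebesgue (ball (0::real^2) \<rho>)"
    using fT by (intro emeasure_mono) auto
  also have "\<dots> = emeasure lborel (ball (0::real^2) \<rho>)"
    by simp
  also have "\<dots> \<le> ennreal (4 * \<rho>^2)"
    using pi_less_4 \<rho> by (subst emeasure_ball) (auto intro!: ennreal_leI mult_right_mono simp: unit_ball_vol_2)
  finally have "(\<integral>\<^sup>+v. ennreal (indicator T v * \<bar>det (matrix (f' v))\<bar>) \<partial>lborel) \<le> ennreal (4 * \<rho>^2)" .
  also have "(\<integral>\<^sup>+v. ennreal (indicator T v * \<bar>det (matrix (f' v))\<bar>) \<partial>lborel)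
    = (\<integral>\<^sup>+v. ennreal ((cmod (p (?C v)))^2 - (cmod (q (?C v)))^2) * indicator S (?C v) \<partial>lborel)"
    by (intro nn_integral_cong) (auto simp: det indicator_def T_def)
  also have "\<dots> = (\<integral>\<^sup>+z\<in>S. ennreal ((cmod (p z))^2 - (cmod (q z))^2) \<partial>lborel)"
    by (subst lborel_complex_eq_vec, subst nn_integral_distr) simp_all
  finally show ?thesis .
qed

section \<open>Variation of the modulus across a ring\<close>

text \<open>Take the last time \<open>a'\<close> in the interval at which the value is at most
  \<open>\<psi> a\<close>, then the first time \<open>b'\<close> after it at which the value is at
  least \<open>\<psi> b\<close>.\<close>

lemma crossing_increasing:
  fixes \<psi> :: "real \<Rightarrow> real"
  assumes cont: "continuous_on UNIV \<psi>" and ab: "a < b" and lt: "\<psi> a < \<psi> b"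
  obtains a' b' where "a \<le> a'" "a' < b'" "b' \<le> b" "\<psi> a' \<le> \<psi> a" "\<psi> b \<le> \<psi> b'"
    "\<And>t. a' < t \<Longrightarrow> t < b' \<Longrightarrow> \<psi> a < \<psi> t \<and> \<psi> t < \<psi> b"
proof -
  have c: "compact ({c..d} \<inter> \<psi> -` {..y})" "compact ({c..d} \<inter> \<psi> -` {y..})" for c d y
    by (intro compact_Int_closed compact_Icc closed_vimage cont closed_atMost closed_atLeast)+
  obtain a' where a': "a' \<in> {a..b} \<inter> \<psi> -` {..\<psi> a}" "\<And>t. t \<in> {a..b} \<inter> \<psi> -` {..\<psi> a} \<Longrightarrow> t \<le> a'"
  proof -
    have "a \<in> {a..b} \<inter> \<psi> -` {..\<psi> a}"
      using ab by simp
    then show thesis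
      using compact_attains_sup[OF c(1)[of a b "\<psi> a"]] that by blast
  qed
  obtain b' where b': "b' \<in> {a'..b} \<inter> \<psi> -` {\<psi> b..}" "\<And>t. t \<in> {a'..b} \<inter> \<psi> -` {\<psi> b..} \<Longrightarrow> b' \<le> t"
  proof -
    have "b \<in> {a'..b} \<inter> \<psi> -` {\<psi> b..}"
      using a'(1) by simp
    then show thesis
      using compact_attains_inf[OF c(2)[of a' b "\<psi> b"]] that by blast
  qed
  show thesis
  proof (rule that)
    show "a \<le> a'" "b' \<le> b" "\<psi> a' \<le> \<psi> a" "\<psi> b \<le> \<psi> b'"
      using a'(1) b'(1) by auto
    have "a' \<noteq> b'"
      using a'(1) b'(1) lt by auto
    then show "a' < b'"
      using b'(1) by auto
    fix t assume t: "a' < t" "t < b'"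
    have "\<not> \<psi> t \<le> \<psi> a"
      using a'(2)[of t] t a'(1) b'(1) by auto
    moreover have "\<not> \<psi> b \<le> \<psi> t"
      using b'(2)[of t] t b'(1) by auto
    ultimately show "\<psi> a < \<psi> t \<and> \<psi> t < \<psi> b" by simp
  qed
qed

definition clamp_norm :: "real \<Rightarrow> real \<Rightarrow> complex \<Rightarrow> real" where
  "clamp_norm s S w = min (max (cmod w) s) S"

text \<open>A change of the clamped modulus is achieved on a subinterval whose interior the path
  spends strictly inside the ring. There the unclamped moduli at the ends differ at least as much,
  and \<open>acl\<close> on this subinterval charges only points in the ring, its two ends being
  null.\<close>

lemma ring_variation:
  fixes f :: "real \<Rightarrow> complex" and G :: "real \<Rightarrow> ennreal"
  assumes f: "continuous_on UNIV f" and [measurable]: "G \<in> borel_measurable borel"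
    and acl: "\<And>\<alpha> \<beta> a b. a \<in> {\<alpha>..\<beta>} \<Longrightarrow> b \<in> {\<alpha>..\<beta>} \<Longrightarrow> ennreal (cmod (f b - f a)) \<le> (\<integral>\<^sup>+x\<in>{\<alpha>..\<beta>}. G x \<partial>lborel)"
    and sS: "s \<le> S" and ab: "a \<in> {\<alpha>..\<beta>}" "b \<in> {\<alpha>..\<beta>}"
  shows "ennreal \<bar>clamp_norm s S (f b) - clamp_norm s S (f a)\<bar>
    \<le> (\<integral>\<^sup>+x\<in>{\<alpha>..\<beta>}. G x * indicator {w. s < cmod w \<and> cmod w < S} (f x) \<partial>lborel)"
proof -
  define \<psi> where "\<psi> x = clamp_norm s S (f x)" for x
  have cont: "continuous_on UNIV \<psi>"
    unfolding \<psi>_def clamp_norm_def by (intro continuous_intros f)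
  let ?I = "\<integral>\<^sup>+x\<in>{\<alpha>..\<beta>}. G x * indicator {w. s < cmod w \<and> cmod w < S} (f x) \<partial>lborel"
  \<comment> \<open>Here \<open>a'\<close> is the low and \<open>b'\<close> the high end of the
    crossing; either may be the left end \<open>l\<close>, so that decreasing crossings, obtained by
    reflection, are covered too.\<close>
  have key: "ennreal (\<psi> b - \<psi> a) \<le> ?I"
    if bounds: "\<alpha> \<le> l" "l < u" "u \<le> \<beta>" and pts: "(l = a' \<and> u = b') \<or> (l = b' \<and> u = a')"
      and ends: "\<psi> a' \<le> \<psi> a" "\<psi> b \<le> \<psi> b'" "\<psi> a < \<psi> b"
      and inner: "\<And>t. l < t \<Longrightarrow> t < u \<Longrightarrow> \<psi> a < \<psi> t \<and> \<psi> t < \<psi> b" for a b a' b' l u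
  proof -
    have range: "s \<le> \<psi> x" "\<psi> x \<le> S" for x
      using sS by (auto simp: \<psi>_def clamp_norm_def)
    have up: "\<psi> x \<le> cmod (f x)" if "s < \<psi> x" for x
      using that by (auto simp: \<psi>_def clamp_norm_def min_def max_def split: if_splits)
    have down: "cmod (f x) \<le> \<psi> x" if "\<psi> x < S" for x
      using that by (auto simp: \<psi>_def clamp_norm_def min_def max_def split: if_splits)
    have "\<psi> b \<le> cmod (f b')"
      using up[of b'] ends range(1)[of a] by linarith
    moreover have "cmod (f a') \<le> \<psi> a"
      using down[of a'] ends range(2)[of b] by linarith
    ultimately have "\<psi> b - \<psi> a \<le> cmod (f b' - f a')"
      using norm_triangle_ineq2[of "f b'" "f a'"] by linarith
    then have "ennreal (\<psi> b - \<psi> a) \<le> ennreal (cmod (f b' - f a'))"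
      by (rule ennreal_leI)
    also have "\<dots> \<le> (\<integral>\<^sup>+x\<in>{l..u}. G x \<partial>lborel)"
      using pts bounds by (intro acl) auto
    also have "\<dots> \<le> ?I"
    proof (rule nn_integral_mono_AE)
      have "AE x in lborel. x \<noteq> l \<and> x \<noteq> u"
        using AE_lborel_singleton[of l] AE_lborel_singleton[of u] by eventually_elim simp
      then show "AE x in lborel. G x * indicator {l..u} x \<le> G x * indicator {w. s < cmod w \<and> cmod w < S} (f x) * indicator {\<alpha>..\<beta>} x"
      proof eventually_elim
        case (elim x)
        show ?case
        proof (cases "x \<in> {l..u}")
          case True
          then have x: "l < x" "x < u" using elim by auto
          have "\<psi> a < \<psi> x" "\<psi> x < \<psi> b" using inner[OF x] by auto
          then have "s < cmod (f x)" "cmod (f x) < S"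
            using up[of x] down[of x] range[of a] range[of b] by linarith+
          then show ?thesis
            using True bounds by simp
        qed simp
      qed
    qed
    finally show ?thesis .
  qed
  have main: "ennreal (\<psi> b - \<psi> a) \<le> ?I" if lt: "\<psi> a < \<psi> b" and ab: "a \<in> {\<alpha>..\<beta>}" "b \<in> {\<alpha>..\<beta>}" for a b
  proof (cases a b rule: linorder_cases)
    case less
    obtain a' b' where c: "a \<le> a'" "a' < b'" "b' \<le> b" "\<psi> a' \<le> \<psi> a" "\<psi> b \<le> \<psi> b'"
      "\<And>t. a' < t \<Longrightarrow> t < b' \<Longrightarrow> \<psi> a < \<psi> t \<and> \<psi> t < \<psi> b"
      by (rule crossing_increasing[OF cont less lt]) (rule that)
    show ?thesis
      by (rule key[of a' b' a' b' a b]) (use c ab lt in auto)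
  next
    case greater
    have cont': "continuous_on UNIV (\<lambda>x. \<psi> (- x))"
      by (rule continuous_on_compose2[OF cont]) (auto intro!: continuous_intros)
    have "- a < - b" "\<psi> (- (- a)) < \<psi> (- (- b))" using greater lt by auto
    from crossing_increasing[OF cont' this]
    obtain a' b' where c: "- a \<le> a'" "a' < b'" "b' \<le> - b" "\<psi> (- a') \<le> \<psi> a" "\<psi> b \<le> \<psi> (- b')"
      "\<And>t. a' < t \<Longrightarrow> t < b' \<Longrightarrow> \<psi> a < \<psi> (- t) \<and> \<psi> (- t) < \<psi> b"
      unfolding minus_minus by metis
    have inner: "\<psi> a < \<psi> t \<and> \<psi> t < \<psi> b" if "- b' < t" "t < - a'" for t
      using c(6)[of "- t"] that by simp
    show ?thesis
      by (rule key[of "- b'" "- a'" "- a'" "- b'" a b]) (use c ab lt inner in auto)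
  qed (use lt in simp)
  show ?thesis
    using main[of a b] main[of b a] ab unfolding \<psi>_def[symmetric]
    by (cases "\<psi> a" "\<psi> b" rule: linorder_cases) auto
qed

section \<open>Squares about the origin and their images\<close>

definition square :: "real \<Rightarrow> complex set" where
  "square r = cbox (Complex (- r) (- r)) (Complex r r)"

lemma mem_square: "z \<in> square r \<longleftrightarrow> \<bar>Re z\<bar> \<le> r \<and> \<bar>Im z\<bar> \<le> r"
  by (auto simp: square_def in_cbox_complex_iff abs_le_iff)

lemma interior_square: "z \<in> interior (square r) \<longleftrightarrow> \<bar>Re z\<bar> < r \<and> \<bar>Im z\<bar> < r"
  by (auto simp: square_def interior_cbox in_box_complex_iff abs_less_iff)

lemma compact_square: "compact (square r)"
  by (simp add: square_def)

lemma square_sets [measurable]: "square r \<in> sets borel"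
  by (simp add: square_def)

lemma emeasure_square: "0 \<le> r \<Longrightarrow> emeasure lborel (square r) = ennreal (4 * r^2)"
  unfolding square_def by (subst emeasure_lborel_cbox) (auto simp: Basis_complex_def power2_eq_square)

lemma boundary_point_outside:
  assumes F: "continuous_on UNIV F" "inj F" and z1: "z1 \<in> interior (square r)"
  shows "\<exists>z\<in>square r - interior (square r). cmod (F z1) \<le> cmod (F z)"
proof (rule ccontr)
  assume n: "\<not> ?thesis"
  let ?B = "square r - interior (square r)"
  have r: "0 < r"
    using z1 by (auto simp: interior_square)
  have "compact ?B"
    by (intro compact_diff compact_square open_interior)
  moreover have "Complex r r \<in> ?B"
    using r by (simp add: mem_square interior_square)
  ultimately obtain zm where zm: "zm \<in> ?B" "\<And>z. z \<in> ?B \<Longrightarrow> cmod (F z) \<le> cmod (F zm)"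
    using continuous_attains_sup[of ?B "\<lambda>z. cmod (F z)"] continuous_on_subset[OF F(1), of ?B]
    by (metis continuous_on_norm empty_iff subset_UNIV)
  have "cmod (F z1 - 0) \<le> cmod (F zm)"
    by (rule max_principle[OF F compact_square]) (use zm z1 interior_subset in auto)
  with n zm(1) show False by auto
qed

text \<open>Otherwise the closed disc about 0 through \<open>F z2\<close> misses the image of the
  boundary. It is then split by the image of the interior and the complement of the image of the
  square, both open. Being connected and containing \<open>F 0 = 0\<close>, it lies in the image of
  the square, and so does \<open>F z2\<close>, against injectivity.\<close>

lemma boundary_point_inside:
  assumes F: "continuous_on UNIV F" "inj F" and F0: "F 0 = 0" and r: "0 < r" and z2: "z2 \<notin> square r"
  shows "\<exists>z\<in>square r - interior (square r). cmod (F z) \<le> cmod (F z2)"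
proof (rule ccontr)
  assume "\<not> ?thesis"
  then have n: "cmod (F z2) < cmod (F z)" if "z \<in> square r" "z \<notin> interior (square r)" for z
    using that by (auto simp: not_le)
  let ?B = "cball 0 (cmod (F z2))"
  let ?U = "F ` interior (square r)" and ?C = "F ` square r"
  have U: "open ?U"
    by (rule invariance_of_domain) (use F in \<open>auto intro: continuous_on_subset inj_on_subset\<close>)
  have C: "closed ?C"
    by (intro compact_imp_closed compact_continuous_image compact_square continuous_on_subset[OF F(1)]) auto
  have "?B \<subseteq> ?U \<union> - ?C"
    using n by force
  moreover have "?U \<inter> - ?C \<inter> ?B = {}"
    using interior_subset by blast
  moreover have "?U \<inter> ?B \<noteq> {}"
  proof -
    have "0 \<in> interior (square r)"
      using r by (simp add: interior_square)
    then have "0 \<in> ?U"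
      using F0 by (metis imageI)
    then show ?thesis by auto
  qed
  ultimately have "- ?C \<inter> ?B = {}"
    using connectedD[OF connected_cball U _ _ \<open>?B \<subseteq> ?U \<union> - ?C\<close>] C by (metis open_Compl)
  then have "F z2 \<in> ?C"
    by auto
  then show False
    using z2 F(2) by (auto dest: injD)
qed

lemma ennreal_abs_triangle: "ennreal \<bar>x - z\<bar> \<le> ennreal \<bar>x - y\<bar> + ennreal \<bar>y - z\<bar>"
  by (simp add: ennreal_plus[symmetric] del: ennreal_plus)

text \<open>For almost every \<open>r\<close> the clamped modulus rises from \<open>s\<close> to
  \<open>S\<close> along the boundary of the square. Two boundary points are compared via a common
  corner, which costs at most twice the sum over the four sides. Integrating over \<open>r\<close>,
  each side sweeps out at most the whole square, whence the factor 8.\<close>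

lemma length_estimate:
  fixes F p q :: "complex \<Rightarrow> complex"
  assumes F: "continuous_on UNIV F" and pq [measurable]: "p \<in> borel_measurable borel" "q \<in> borel_measurable borel"
    and acl: "AE y in lborel. horizontal_acl F (\<lambda>z. p z + q z) y" "AE x in lborel. vertical_acl F (\<lambda>z. \<i> * (p z - q z)) x"
    and \<rho>: "0 < \<rho>" "\<rho> < R" and sS: "s < S"
    and lo: "\<And>r. \<rho> < r \<Longrightarrow> r < R \<Longrightarrow> \<exists>z\<in>square r - interior (square r). cmod (F z) \<le> s"
    and hi: "\<And>r. \<rho> < r \<Longrightarrow> r < R \<Longrightarrow> \<exists>z\<in>square r - interior (square r). S \<le> cmod (F z)"
  shows "ennreal ((S - s) * (R - \<rho>)) \<le> 8 * (\<integral>\<^sup>+z\<in>square R. ennreal (cmod (p z) + cmod (q z)) * indicator {w. s < cmod w \<and> cmod w < S} (F z) \<partial>lborel)"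
proof -
  have Fm [measurable]: "F \<in> borel_measurable borel"
    by (rule borel_measurable_continuous_onI[OF F])
  define ind :: "complex \<Rightarrow> ennreal" where "ind = indicator {w. s < cmod w \<and> cmod w < S}"
  have indm [measurable]: "ind \<in> borel_measurable borel"
    unfolding ind_def by (intro borel_measurable_indicator) simp
  define W where "W z = ennreal (cmod (p z) + cmod (q z)) * ind (F z)" for z
  have Wm [measurable]: "W \<in> borel_measurable borel"
    unfolding W_def by measurable
  define H where "H y = (\<integral>\<^sup>+x. W (Complex x y) * indicator (square R) (Complex x y) \<partial>lborel)" for y
  define V where "V x = (\<integral>\<^sup>+y. W (Complex x y) * indicator (square R) (Complex x y) \<partial>lborel)" for x
  have [measurable]: "(\<lambda>p. W (Complex (snd p) (fst p)) * indicator (square R) (Complex (snd p) (fst p))) \<in> borel_measurable (borel \<Otimes>\<^sub>M borel)"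
     "(\<lambda>p. W (Complex (fst p) (snd p)) * indicator (square R) (Complex (fst p) (snd p))) \<in> borel_measurable (borel \<Otimes>\<^sub>M borel)"
    by measurable
  have [measurable]: "H \<in> borel_measurable borel" "V \<in> borel_measurable borel"
    unfolding H_def V_def by (intro lborel.borel_measurable_nn_integral, simp add: split_def)+
  let ?Q = "\<integral>\<^sup>+z\<in>square R. W z \<partial>lborel"
  have HQ: "(\<integral>\<^sup>+y. H y \<partial>lborel) = ?Q" and VQ: "(\<integral>\<^sup>+x. V x \<partial>lborel) = ?Q"
    unfolding H_def V_def by (subst nn_integral_complex(1), simp_all) (subst nn_integral_complex(2), simp_all)
  have refl: "(\<integral>\<^sup>+r. h (- r) \<partial>lborel) = (\<integral>\<^sup>+r. h r \<partial>lborel)" if "h \<in> borel_measurable borel" for h :: "real \<Rightarrow> ennreal"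
    using nn_integral_real_affine[of h "- 1" 0] that by simp
  \<comment> \<open>Opposite sides lie on lines at \<open>r\<close> and \<open>- r\<close>; the
    exceptional set has to be avoided by both.\<close>
  have AErefl: "AE r in lborel. P (- r)" if "AE r in lborel. P r" for P :: "real \<Rightarrow> bool"
  proof -
    have "AE r in distr lborel borel uminus. P r"
      using that by (simp only: lborel_distr_uminus)
    then show ?thesis
      by (rule AE_distrD[rotated]) simp
  qed
  have gxW: "cmod (p z + q z) \<le> cmod (p z) + cmod (q z)" "cmod (\<i> * (p z - q z)) \<le> cmod (p z) + cmod (q z)" for z
    using norm_triangle_ineq[of "p z" "q z"] norm_triangle_ineq4[of "p z" "q z"] by (simp_all add: norm_mult)
  define \<psi> where "\<psi> z = clamp_norm s S (F z)" for z
  have fc: "continuous_on UNIV (\<lambda>x. F (Complex x y))" "continuous_on UNIV (\<lambda>y. F (Complex x y))" for x y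
    unfolding Complex_eq by (auto intro!: continuous_on_compose2[OF F] continuous_intros)
  have varH: "ennreal \<bar>\<psi> (Complex b y) - \<psi> (Complex a y)\<bar> \<le> H y"
    if "horizontal_acl F (\<lambda>z. p z + q z) y" "\<bar>a\<bar> \<le> r" "\<bar>b\<bar> \<le> r" "\<bar>y\<bar> \<le> r" "r < R" for a b y r
  proof -
    have "ennreal \<bar>\<psi> (Complex b y) - \<psi> (Complex a y)\<bar> \<le> (\<integral>\<^sup>+x\<in>{- r..r}. ennreal (cmod (p (Complex x y) + q (Complex x y))) * ind (F (Complex x y)) \<partial>lborel)"
      unfolding \<psi>_def ind_def
    proof (rule ring_variation[OF fc(1)])
      show "ennreal (cmod (F (Complex b y) - F (Complex a y))) \<le> (\<integral>\<^sup>+x\<in>{\<alpha>..\<beta>}. ennreal (cmod (p (Complex x y) + q (Complex x y))) \<partial>lborel)"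
        if "a \<in> {\<alpha>..\<beta>}" "b \<in> {\<alpha>..\<beta>}" for \<alpha> \<beta> a b
        using \<open>horizontal_acl _ _ y\<close>[unfolded horizontal_acl_def, rule_format, OF that, of 0] by simp
    qed (use that sS in \<open>auto simp: abs_le_iff\<close>)
    also have "\<dots> \<le> H y"
      unfolding H_def W_def using gxW(1) that
      by (intro nn_integral_mono) (auto simp: indicator_def mem_square abs_le_iff simp del: ennreal_plus intro!: mult_right_mono ennreal_leI)
    finally show ?thesis .
  qed
  have varV: "ennreal \<bar>\<psi> (Complex x b) - \<psi> (Complex x a)\<bar> \<le> V x"
    if "vertical_acl F (\<lambda>z. \<i> * (p z - q z)) x" "\<bar>a\<bar> \<le> r" "\<bar>b\<bar> \<le> r" "\<bar>x\<bar> \<le> r" "r < R" for a b x r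
  proof -
    have "ennreal \<bar>\<psi> (Complex x b) - \<psi> (Complex x a)\<bar> \<le> (\<integral>\<^sup>+y\<in>{- r..r}. ennreal (cmod (\<i> * (p (Complex x y) - q (Complex x y)))) * ind (F (Complex x y)) \<partial>lborel)"
      unfolding \<psi>_def ind_def
    proof (rule ring_variation[OF fc(2)])
      show "ennreal (cmod (F (Complex x b) - F (Complex x a))) \<le> (\<integral>\<^sup>+y\<in>{\<alpha>..\<beta>}. ennreal (cmod (\<i> * (p (Complex x y) - q (Complex x y)))) \<partial>lborel)"
        if "a \<in> {\<alpha>..\<beta>}" "b \<in> {\<alpha>..\<beta>}" for \<alpha> \<beta> a b
        using \<open>vertical_acl _ _ x\<close>[unfolded vertical_acl_def, rule_format, OF that, of 0] by simp
    qed (use that sS in \<open>auto simp: abs_le_iff\<close>)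
    also have "\<dots> \<le> V x"
      unfolding V_def W_def using gxW(2) that
      by (intro nn_integral_mono) (auto simp: indicator_def mem_square abs_le_iff simp del: ennreal_plus intro!: mult_right_mono ennreal_leI)
    finally show ?thesis .
  qed
  have "AE r in lborel. ennreal (S - s) * indicator {\<rho><..<R} r \<le> 2 * (H r + H (- r) + V r + V (- r))"
    using acl(1) AErefl[OF acl(1)] acl(2) AErefl[OF acl(2)]
  proof eventually_elim
    case (elim r)
    show ?case
    proof (cases "r \<in> {\<rho><..<R}")
      case True
      then have r: "0 < r" "r < R" "\<rho> < r"
        using \<rho> by auto
      let ?T = "H r + H (- r) + V r + V (- r)"
      \<comment> \<open>Points of the bottom and the left side reach this corner along their own
        side, those of the top and the right side along one further side.\<close>
      let ?c = "Complex (- r) (- r)"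
      have corner: "ennreal \<bar>\<psi> z - \<psi> ?c\<bar> \<le> ?T" if z: "z \<in> square r - interior (square r)" for z
      proof -
        have zr: "\<bar>Re z\<bar> \<le> r" "\<bar>Im z\<bar> \<le> r"
          using z by (auto simp: mem_square)
        have "Im z = - r \<or> Re z = - r \<or> Im z = r \<or> Re z = r"
          using z zr by (auto simp: interior_square)
        then consider "z = Complex (Re z) (- r)" | "z = Complex (- r) (Im z)" | "z = Complex (Re z) r" | "z = Complex r (Im z)"
          by (metis complex_surj)
        then show ?thesis
        proof cases
          case 1
          have "ennreal \<bar>\<psi> z - \<psi> ?c\<bar> \<le> H (- r)"
            using varH[OF elim(2), of "- r" r "Re z"] zr r 1 by simp
          then show ?thesis
            by (rule order_trans) (simp add: add.assoc add_increasing add_increasing2)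
        next
          case 2
          have "ennreal \<bar>\<psi> z - \<psi> ?c\<bar> \<le> V (- r)"
            using varV[OF elim(4), of "- r" r "Im z"] zr r 2 by simp
          then show ?thesis
            by (rule order_trans) (simp add: add_increasing)
        next
          case 3
          have "ennreal \<bar>\<psi> z - \<psi> (Complex (- r) r)\<bar> \<le> H r"
            using varH[OF elim(1), of "- r" r "Re z"] zr r 3 by simp
          moreover have "ennreal \<bar>\<psi> (Complex (- r) r) - \<psi> ?c\<bar> \<le> V (- r)"
            using varV[OF elim(4), of "- r" r r] r by simp
          ultimately have "ennreal \<bar>\<psi> z - \<psi> ?c\<bar> \<le> H r + V (- r)"
            using ennreal_abs_triangle[of "\<psi> z" "\<psi> ?c" "\<psi> (Complex (- r) r)"] by (meson add_mono order_trans)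
          then show ?thesis
            by (rule order_trans) (simp add: add.assoc add_increasing add_left_mono)
        next
          case 4
          have "ennreal \<bar>\<psi> z - \<psi> (Complex r (- r))\<bar> \<le> V r"
            using varV[OF elim(3), of "- r" r "Im z"] zr r 4 by simp
          moreover have "ennreal \<bar>\<psi> (Complex r (- r)) - \<psi> ?c\<bar> \<le> H (- r)"
            using varH[OF elim(2), of "- r" r r] r by simp
          ultimately have "ennreal \<bar>\<psi> z - \<psi> ?c\<bar> \<le> V r + H (- r)"
            using ennreal_abs_triangle[of "\<psi> z" "\<psi> ?c" "\<psi> (Complex r (- r))"] by (meson add_mono order_trans)
          also have "\<dots> = 0 + H (- r) + V r + 0"
            by (simp add: add.commute)
          also have "\<dots> \<le> ?T"
            by (intro add_mono) auto
          finally show ?thesis .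
        qed
      qed
      obtain z where z: "z \<in> square r - interior (square r)" "cmod (F z) \<le> s"
        using lo r by blast
      obtain w where w: "w \<in> square r - interior (square r)" "S \<le> cmod (F w)"
        using hi r by blast
      have "\<psi> z = s" "\<psi> w = S"
        using z(2) w(2) sS by (auto simp: \<psi>_def clamp_norm_def)
      then have "ennreal (S - s) = ennreal \<bar>\<psi> w - \<psi> z\<bar>"
        using sS by simp
      also have "\<dots> \<le> ennreal \<bar>\<psi> w - \<psi> ?c\<bar> + ennreal \<bar>\<psi> z - \<psi> ?c\<bar>"
        using ennreal_abs_triangle[of "\<psi> w" "\<psi> z" "\<psi> ?c"] by (simp add: abs_minus_commute)
      also have "\<dots> \<le> ?T + ?T"
        by (intro add_mono corner z w)
      finally show ?thesis
        using True by (simp only: indicator_simps mult_1_right mult_2)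
    qed simp
  qed
  then have "(\<integral>\<^sup>+r. ennreal (S - s) * indicator {\<rho><..<R} r \<partial>lborel) \<le> (\<integral>\<^sup>+r. 2 * (H r + H (- r) + V r + V (- r)) \<partial>lborel)"
    by (rule nn_integral_mono_AE)
  also have "\<dots> = 2 * ((\<integral>\<^sup>+r. H r \<partial>lborel) + (\<integral>\<^sup>+r. H (- r) \<partial>lborel) + (\<integral>\<^sup>+r. V r \<partial>lborel) + (\<integral>\<^sup>+r. V (- r) \<partial>lborel))"
    by (subst nn_integral_cmult, measurable) (simp add: nn_integral_add)
  also have "\<dots> = 2 * (?Q + ?Q + ?Q + ?Q)"
    by (simp add: refl HQ VQ)
  also have "\<dots> = 8 * ?Q"
  proof -
    have "2 * (x + x + x + x) = 8 * x" for x :: ennreal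
    proof -
      have "(8::ennreal) = 2 * (2 * 2)" by simp
      then show ?thesis
        by (simp only: mult_2 add.assoc distrib_right)
    qed
    then show ?thesis .
  qed
  finally show ?thesis
    using \<rho> sS unfolding W_def ind_def by (simp add: nn_integral_cmult_indicator ennreal_mult)
qed

text \<open>Let \<open>A\<close> be the part of the square mapped into the ring and \<open>c\<close>
  the left side of the length estimate. Since the square of \<open>W\<close> is at most
  \<open>K\<close> times the Jacobian, and the Jacobian integrates to at most \<open>4 * S^2\<close>
  over \<open>A\<close>, one gets \<open>c \<le> 4 * \<mu> * area + 16 * K * S^2 / \<mu>\<close>.
  With \<open>\<mu> = 32 * K * S^2 / c\<close> the area of \<open>A\<close> is at least
  \<open>c / (8 * \<mu>)\<close>.\<close>

lemma ring_area:
  assumes qc: "quasiconformal_on K UNIV F" and \<rho>: "0 < \<rho>" "\<rho> < R" and sS: "0 < s" "s < S"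
    and lo: "\<And>r. \<rho> < r \<Longrightarrow> r < R \<Longrightarrow> \<exists>z\<in>square r - interior (square r). cmod (F z) \<le> s"
    and hi: "\<And>r. \<rho> < r \<Longrightarrow> r < R \<Longrightarrow> \<exists>z\<in>square r - interior (square r). S \<le> cmod (F z)"
  shows "ennreal (((S - s) * (R - \<rho>))^2 / (256 * K * S^2)) \<le> emeasure lborel (square R \<inter> {z. s < cmod (F z) \<and> cmod (F z) < S})"
proof -
  have K: "1 \<le> K"
    using qc by (simp add: quasiconformal_on_def)
  obtain G where "homeomorphism UNIV (F ` UNIV) F G"
    using qc by (auto simp: quasiconformal_on_def)
  then have F: "continuous_on UNIV F" "inj F"
    by (auto simp: homeomorphism_def intro: inj_on_inverseI)
  have Fm [measurable]: "F \<in> borel_measurable borel"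
    by (rule borel_measurable_continuous_onI[OF F(1)])
  obtain p q where pq [measurable]: "p \<in> borel_measurable borel" "q \<in> borel_measurable borel"
    and acl: "AE y in lborel. horizontal_acl F (\<lambda>z. p z + q z) y" "AE x in lborel. vertical_acl F (\<lambda>z. \<i> * (p z - q z)) x"
    and der: "AE z in lborel. (F has_derivative (\<lambda>h. p z * h + q z * cnj h)) (at z)"
    and dil: "AE z in lborel. cmod (q z) < cmod (p z) \<and> cmod (p z) + cmod (q z) \<le> K * (cmod (p z) - cmod (q z))"
    by (rule quasiconformal_regular[OF qc]) (rule that)
  define A where "A = square R \<inter> {z. s < cmod (F z) \<and> cmod (F z) < S}"
  have A [measurable]: "A \<in> sets borel"
    unfolding A_def by measurable
  define c where "c = (S - s) * (R - \<rho>)"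
  have c: "c > 0"
    using \<rho> sS by (simp add: c_def)
  define \<mu> where "\<mu> = 32 * K * S^2 / c"
  have \<mu>: "\<mu> > 0"
    using K sS c by (simp add: \<mu>_def)
  define W where "W z = cmod (p z) + cmod (q z)" for z
  have Wm [measurable]: "W \<in> borel_measurable borel"
    unfolding W_def by measurable
  define good where "good z \<longleftrightarrow> (F has_derivative (\<lambda>h. p z * h + q z * cnj h)) (at z) \<and>
      cmod (q z) < cmod (p z) \<and> cmod (p z) + cmod (q z) \<le> K * (cmod (p z) - cmod (q z))" for z
  have "AE z in lborel. good z"
    using der dil by eventually_elim (simp add: good_def)
  \<comment> \<open>The area inequality asks for differentiability at every point, so a Borel null
    set containing all exceptional points is cut out of \<open>A\<close>.\<close>
  then obtain N where N: "N \<in> null_sets lborel" and good: "{z \<in> space lborel. \<not> good z} \<subseteq> N"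
    unfolding eventually_ae_filter by blast
  have Nm [measurable]: "N \<in> sets borel"
    using N by auto
  have good': "(F has_derivative (\<lambda>h. p z * h + q z * cnj h)) (at z)" "cmod (q z) < cmod (p z)"
    "cmod (p z) + cmod (q z) \<le> K * (cmod (p z) - cmod (q z))" if "z \<notin> N" for z
  proof -
    have "good z"
      using good that by auto
    then show "(F has_derivative (\<lambda>h. p z * h + q z * cnj h)) (at z)" "cmod (q z) < cmod (p z)"
      "cmod (p z) + cmod (q z) \<le> K * (cmod (p z) - cmod (q z))"
      by (simp_all add: good_def)
  qed
  have area: "(\<integral>\<^sup>+z\<in>A - N. ennreal ((cmod (p z))^2 - (cmod (q z))^2) \<partial>lborel) \<le> ennreal (4 * S^2)"
    by (rule area_inequality[OF F(2) pq]) (use good' sS in \<open>auto simp: A_def\<close>)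
  have W2: "(W z)^2 \<le> K * ((cmod (p z))^2 - (cmod (q z))^2)" if "z \<notin> N" for z
  proof -
    have "(cmod (p z) + cmod (q z)) * (cmod (p z) + cmod (q z)) \<le> K * (cmod (p z) - cmod (q z)) * (cmod (p z) + cmod (q z))"
      using good'(3)[OF that] by (intro mult_right_mono) auto
    then show ?thesis
      by (simp add: W_def power2_eq_square algebra_simps)
  qed
  \<comment> \<open>replaces the Cauchy-Schwarz inequality; \<open>\<mu>\<close> is chosen so that the second term contributes \<open>c / 2\<close>\<close>
  have amgm: "W z \<le> \<mu> / 2 + K / (2 * \<mu>) * ((cmod (p z))^2 - (cmod (q z))^2)" if "z \<notin> N" for z
  proof -
    have "0 \<le> (\<mu> - W z)^2"
      by simp
    then have "2 * \<mu> * W z \<le> \<mu>^2 + (W z)^2"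
      by (simp add: power2_eq_square algebra_simps)
    also have "\<dots> \<le> \<mu>^2 + K * ((cmod (p z))^2 - (cmod (q z))^2)"
      using W2[OF that] by simp
    finally have "W z \<le> (\<mu>^2 + K * ((cmod (p z))^2 - (cmod (q z))^2)) / (2 * \<mu>)"
      using \<mu> by (simp add: pos_le_divide_eq mult.commute)
    also have "\<dots> = \<mu> / 2 + K / (2 * \<mu>) * ((cmod (p z))^2 - (cmod (q z))^2)"
      using \<mu> by (simp add: power2_eq_square field_simps)
    finally show ?thesis .
  qed
  have Afin: "emeasure lborel A < \<infinity>"
  proof -
    have "emeasure lborel A \<le> emeasure lborel (square R)"
      by (intro emeasure_mono) (auto simp: A_def)
    also have "\<dots> < \<infinity>"
      using emeasure_compact_finite[OF compact_square] by simp
    finally show ?thesis .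
  qed
  have "ennreal c \<le> 8 * (\<integral>\<^sup>+z\<in>square R. ennreal (cmod (p z) + cmod (q z)) * indicator {w. s < cmod w \<and> cmod w < S} (F z) \<partial>lborel)"
    unfolding c_def by (rule length_estimate[OF F(1) pq acl \<rho> sS(2) lo hi])
  also have "(\<integral>\<^sup>+z\<in>square R. ennreal (cmod (p z) + cmod (q z)) * indicator {w. s < cmod w \<and> cmod w < S} (F z) \<partial>lborel)
     = (\<integral>\<^sup>+z\<in>A. ennreal (W z) \<partial>lborel)"
    unfolding W_def A_def by (intro nn_integral_cong) (auto simp: indicator_def)
  also have "(\<integral>\<^sup>+z\<in>A. ennreal (W z) \<partial>lborel) \<le> (\<integral>\<^sup>+z. ennreal (\<mu> / 2) * indicator A z + ennreal (K / (2 * \<mu>)) * (ennreal ((cmod (p z))^2 - (cmod (q z))^2) * indicator (A - N) z) \<partial>lborel)"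
  proof (rule nn_integral_mono_AE)
    have "AE z in lborel. z \<notin> N"
      using N by (rule AE_not_in)
    then show "AE z in lborel. ennreal (W z) * indicator A z \<le> ennreal (\<mu> / 2) * indicator A z + ennreal (K / (2 * \<mu>)) * (ennreal ((cmod (p z))^2 - (cmod (q z))^2) * indicator (A - N) z)"
    proof eventually_elim
      case (elim z)
      have nn: "0 \<le> (cmod (p z))^2 - (cmod (q z))^2"
        using good'(2)[OF elim] by (simp add: power_mono)
      have "ennreal (W z) \<le> ennreal (\<mu> / 2 + K / (2 * \<mu>) * ((cmod (p z))^2 - (cmod (q z))^2))"
        by (rule ennreal_leI[OF amgm[OF elim]])
      also have "\<dots> = ennreal (\<mu> / 2) + ennreal (K / (2 * \<mu>)) * ennreal ((cmod (p z))^2 - (cmod (q z))^2)"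
      proof -
        have "ennreal (a + k * d) = ennreal a + ennreal k * ennreal d" if "0 \<le> a" "0 \<le> k" "0 \<le> d" for a k d :: real
          using that by (simp add: ennreal_mult)
        from this[of "\<mu> / 2" "K / (2 * \<mu>)", OF _ _ nn] show ?thesis
          using K \<mu> by simp
      qed
      finally show ?case
        using elim by (simp add: indicator_def)
    qed
  qed
  also have "\<dots> = ennreal (\<mu> / 2) * emeasure lborel A + ennreal (K / (2 * \<mu>)) * (\<integral>\<^sup>+z\<in>A - N. ennreal ((cmod (p z))^2 - (cmod (q z))^2) \<partial>lborel)"
    by (subst nn_integral_add) (simp_all add: nn_integral_cmult)
  also have "\<dots> \<le> ennreal (\<mu> / 2) * emeasure lborel A + ennreal (K / (2 * \<mu>)) * ennreal (4 * S^2)"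
    by (intro add_left_mono mult_left_mono area) auto
  also have "\<dots> = ennreal (\<mu> / 2 * measure lborel A + K / (2 * \<mu>) * (4 * S^2))"
    using Afin \<mu> K by (simp add: emeasure_eq_ennreal_measure ennreal_mult[symmetric] ennreal_plus[symmetric] less_top del: ennreal_plus)
  finally have "ennreal c \<le> 8 * ennreal (\<mu> / 2 * measure lborel A + K / (2 * \<mu>) * (4 * S^2))"
    by (simp add: mult_left_mono)
  also have "\<dots> = ennreal (8 * (\<mu> / 2 * measure lborel A + K / (2 * \<mu>) * (4 * S^2)))"
    using \<mu> K by (subst ennreal_mult) auto
  finally have "c \<le> 8 * (\<mu> / 2 * measure lborel A + K / (2 * \<mu>) * (4 * S^2))"
    using \<mu> K by (subst (asm) ennreal_le_iff) auto
  moreover have "8 * (K / (2 * \<mu>) * (4 * S^2)) = c / 2"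
    using K sS c by (simp add: \<mu>_def field_simps)
  ultimately have "c / 2 \<le> 4 * \<mu> * measure lborel A"
    by (simp add: algebra_simps)
  then have "c / (8 * \<mu>) \<le> measure lborel A"
    using \<mu> by (simp add: pos_divide_le_eq mult.commute mult.left_commute)
  moreover have "c / (8 * \<mu>) = c^2 / (256 * K * S^2)"
    using c by (simp add: \<mu>_def power2_eq_square)
  ultimately have "ennreal (c^2 / (256 * K * S^2)) \<le> ennreal (measure lborel A)"
    by (intro ennreal_leI) simp
  also have "\<dots> = emeasure lborel A"
    using Afin by (simp add: emeasure_eq_ennreal_measure less_top)
  finally show ?thesis
    by (simp add: c_def A_def)
qed

section \<open>Counting rings\<close>

text \<open>If \<open>F 0\<close> were nonzero, the logarithms of the moduli, which are the integers
  \<open>\<sigma> n\<close>, would converge as \<open>n\<close> tends to minus infinity. Convergent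
  integers are eventually constant, against injectivity of \<open>\<sigma>\<close>.\<close>

lemma quasiconformal_fixes_0:
  fixes F :: "complex \<Rightarrow> complex"
  assumes F: "continuous_on UNIV F" and \<sigma>: "bij \<sigma>" "\<And>n::int. F (exp (of_int n)) = exp (of_int (\<sigma> n))"
  shows "F 0 = 0"
proof (rule ccontr)
  assume n: "F 0 \<noteq> 0"
  have tend: "((\<lambda>n::int. exp (of_int n) :: complex) \<longlongrightarrow> 0) at_bot"
    by (rule exp_int_tendsto_0) (rule filterlim_ident)
  have "isCont F 0"
    using F by (simp add: continuous_on_eq_continuous_at)
  from isCont_tendsto_compose[OF this tend]
  have "((\<lambda>n::int. F (exp (of_int n))) \<longlongrightarrow> F 0) at_bot" .
  then have "((\<lambda>n. ln (cmod (F (exp (of_int n))))) \<longlongrightarrow> ln (cmod (F 0))) at_bot"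
    using n by (intro tendsto_ln tendsto_norm) auto
  then have lim: "((\<lambda>n. real_of_int (\<sigma> n)) \<longlongrightarrow> ln (cmod (F 0))) at_bot"
    by (simp add: \<sigma> norm_exp_eq_Re)
  have "\<forall>\<^sub>F n in at_bot. dist (real_of_int (\<sigma> n)) (ln (cmod (F 0))) < 1/2"
    using lim unfolding tendsto_iff by (metis half_gt_zero_iff zero_less_one)
  then obtain M where M: "\<And>n. n < M \<Longrightarrow> dist (real_of_int (\<sigma> n)) (ln (cmod (F 0))) < 1/2"
    unfolding eventually_at_bot_dense by blast
  have "\<bar>real_of_int (\<sigma> (M - 1)) - of_int (\<sigma> (M - 2))\<bar> < 1"
    using M[of "M - 1"] M[of "M - 2"] unfolding dist_real_def by linarith
  then have "\<sigma> (M - 1) = \<sigma> (M - 2)"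
    by linarith
  then show False
    using \<sigma>(1) by (auto simp: bij_def dest: injD)
qed

lemma quasiconformal_imp_almost_increasing:
  assumes qc: "quasiconformal_on K UNIV F" and \<sigma>: "bij \<sigma>" "\<And>n::int. F (exp (of_int n)) = exp (of_int (\<sigma> n))"
  shows "almost_increasing \<lceil>1024 * K * exp 2 ^ 2 / (exp 1 - 1) ^ 4\<rceil> \<sigma>"
  unfolding almost_increasing_def
proof (intro allI impI)
  fix m k :: int assume mk: "m < k"
  have K: "1 \<le> K"
    using qc by (simp add: quasiconformal_on_def)
  obtain G where "homeomorphism UNIV (F ` UNIV) F G"
    using qc by (auto simp: quasiconformal_on_def)
  then have F: "continuous_on UNIV F" "inj F"
    by (auto simp: homeomorphism_def intro: inj_on_inverseI)
  have F0: "F 0 = 0"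
    by (rule quasiconformal_fixes_0[OF F(1) \<sigma>])
  have Fm [measurable]: "F \<in> borel_measurable borel"
    by (rule borel_measurable_continuous_onI[OF F(1)])
  define \<rho> where "\<rho> = exp (real_of_int m)"
  define R where "R = exp 1 * \<rho>"
  have e1: "(1::real) < exp 1" by simp
  have \<rho>: "0 < \<rho>" "\<rho> < R"
    using e1 by (simp_all add: \<rho>_def R_def)
  define A where "A j = square R \<inter> {z. exp (real_of_int j) < cmod (F z) \<and> cmod (F z) < exp (real_of_int j + 1)}" for j :: int
  \<comment> \<open>The bound of \<open>ring_area\<close> for inner radius \<open>exp j\<close> and
    outer radius \<open>exp (j + 1)\<close>, in which \<open>exp j\<close> cancels. Dividing the
    area \<open>4 * R^2\<close> of the square by it yields the constant in the statement; there
    \<open>\<rho>\<close> cancels as well, so only \<open>K\<close> remains.\<close>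
  define a where "a = (exp 1 - 1) ^ 4 * \<rho>^2 / (256 * K * exp 2)"
  have a: "a > 0"
    using e1 K \<rho> by (simp add: a_def)
  have Fe: "cmod (F (exp (of_int n))) = exp (real_of_int (\<sigma> n))" for n
    by (simp add: \<sigma> norm_exp_eq_Re)
  have Aj: "ennreal a \<le> emeasure lborel (A j)" if j: "j \<in> {\<sigma> k..<\<sigma> m}" for j
  proof -
    let ?s = "exp (real_of_int j)"
    have "ennreal (((exp 1 * ?s - ?s) * (R - \<rho>))^2 / (256 * K * (exp 1 * ?s)^2)) \<le> emeasure lborel (square R \<inter> {z. ?s < cmod (F z) \<and> cmod (F z) < exp 1 * ?s})"
    proof (rule ring_area[OF qc \<rho>])
      fix r assume r: "\<rho> < r" "r < R"
      have r0: "0 < r" using r \<rho> by simp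
      \<comment> \<open>Since \<open>exp m < r < exp (m + 1) \<le> exp k\<close>, the square has
        \<open>exp m\<close> inside and \<open>exp k\<close> outside. Their images lie beyond the
        outer and within the inner circle of the ring, in this reversed order, and so force boundary
        points on both sides of the ring.\<close>
      have "exp (of_int m) \<in> interior (square r)"
        using r r0 by (simp add: interior_square exp_int_eq \<rho>_def)
      from boundary_point_outside[OF F this] obtain z where z: "z \<in> square r - interior (square r)" "exp (real_of_int (\<sigma> m)) \<le> cmod (F z)"
        unfolding Fe by blast
      have "exp 1 * ?s = exp (real_of_int (j + 1))"
        by (simp add: exp_add)
      also have "\<dots> \<le> exp (real_of_int (\<sigma> m))"
        using j unfolding exp_le_cancel_iff of_int_le_iff by simp
      finally show "\<exists>z\<in>square r - interior (square r). exp 1 * ?s \<le> cmod (F z)"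
        using z by force
      have "R = exp (real_of_int (m + 1))"
        by (simp add: R_def \<rho>_def exp_add)
      also have "\<dots> \<le> exp (real_of_int k)"
        using mk unfolding exp_le_cancel_iff of_int_le_iff by simp
      finally have "exp (of_int k) \<notin> square r"
        using r by (simp add: mem_square exp_int_eq)
      from boundary_point_inside[OF F F0 r0 this] obtain z where z: "z \<in> square r - interior (square r)" "cmod (F z) \<le> exp (real_of_int (\<sigma> k))"
        unfolding Fe by blast
      have "exp (real_of_int (\<sigma> k)) \<le> ?s"
        using j by simp
      then show "\<exists>z\<in>square r - interior (square r). cmod (F z) \<le> ?s"
        by (intro bexI[OF _ z(1)]) (use z(2) in linarith)
    qed (use e1 in auto)
    moreover have "((exp 1 * ?s - ?s) * (R - \<rho>))^2 / (256 * K * (exp 1 * ?s)^2) = a"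
    proof -
      have "(exp 1 * ?s - ?s) * (R - \<rho>) = ?s * ((exp 1 - 1)^2 * \<rho>)"
        by (simp add: R_def power2_eq_square algebra_simps)
      moreover have "256 * K * (exp 1 * ?s)^2 = ?s^2 * (256 * K * exp 2)"
        by (simp add: power_mult_distrib exp_double[of 1, simplified])
      ultimately have "((exp 1 * ?s - ?s) * (R - \<rho>))^2 / (256 * K * (exp 1 * ?s)^2) = (?s^2 * ((exp 1 - 1)^2 * \<rho>)^2) / (?s^2 * (256 * K * exp 2))"
        by (simp only: power_mult_distrib)
      also have "\<dots> = ((exp 1 - 1)^2 * \<rho>)^2 / (256 * K * exp 2)"
        by simp
      also have "\<dots> = a"
        by (simp add: a_def power_mult_distrib flip: power_mult)
      finally show ?thesis .
    qed
    ultimately show ?thesis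
      by (simp add: A_def exp_add mult.commute)
  qed
  have Am: "A j \<in> sets lborel" for j
    unfolding A_def by measurable
  have disj: "disjoint_family_on A {\<sigma> k..<\<sigma> m}"
  proof -
    have "i = j" if "z \<in> A i" "z \<in> A j" for i j z
    proof -
      have b: "exp (real_of_int i) < cmod (F z)" "cmod (F z) < exp (real_of_int i + 1)"
        "exp (real_of_int j) < cmod (F z)" "cmod (F z) < exp (real_of_int j + 1)"
        using that by (simp_all add: A_def)
      from less_trans[OF b(1,4)] less_trans[OF b(3,2)] show ?thesis by simp
    qed
    then show ?thesis
      unfolding disjoint_family_on_def by blast
  qed
  have "ennreal (real (card {\<sigma> k..<\<sigma> m}) * a) = (\<Sum>j\<in>{\<sigma> k..<\<sigma> m}. ennreal a)"
    using a by (simp add: ennreal_mult ennreal_of_nat_eq_real_of_nat)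
  also have "\<dots> \<le> (\<Sum>j\<in>{\<sigma> k..<\<sigma> m}. emeasure lborel (A j))"
    by (intro sum_mono Aj)
  also have "\<dots> = emeasure lborel (\<Union>j\<in>{\<sigma> k..<\<sigma> m}. A j)"
    by (rule sum_emeasure) (use Am disj in auto)
  also have "\<dots> \<le> emeasure lborel (square R)"
    by (intro emeasure_mono) (auto simp: A_def)
  also have "\<dots> = ennreal (4 * R^2)"
    using \<rho> by (intro emeasure_square) simp
  finally have "real (card {\<sigma> k..<\<sigma> m}) * a \<le> 4 * R^2"
    by simp
  then have "real (card {\<sigma> k..<\<sigma> m}) \<le> 4 * R^2 / a"
    using a by (simp add: pos_le_divide_eq)
  also have "4 * R^2 / a = 1024 * K * exp 2 ^ 2 / (exp 1 - 1) ^ 4"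
  proof -
    have "R^2 = exp 2 * \<rho>^2"
      by (simp add: R_def power_mult_distrib exp_double[of 1, simplified])
    then show ?thesis
      using \<rho> by (simp add: a_def power2_eq_square)
  qed
  finally have "real (nat (\<sigma> m - \<sigma> k)) \<le> 1024 * K * exp 2 ^ 2 / (exp 1 - 1) ^ 4"
    by simp
  then show "\<sigma> m \<le> \<sigma> k + \<lceil>1024 * K * exp 2 ^ 2 / (exp 1 - 1) ^ 4\<rceil>"
    by linarith
qed

section \<open>The quantitative equivalences\<close>

lemma quantitatively_implies_trans:
  assumes "quantitatively_implies X A P B Q" "quantitatively_implies X B Q C R"
  shows "quantitatively_implies X A P C R"
  using assms unfolding quantitatively_implies_def by meson

lemma quasisymmetric_iff_three_point:
  "quantitatively_equivalent {f. bij_betw f E E}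
     {\<eta>. half_line_homeomorphism \<eta>} (\<lambda>\<eta> f. quasisymmetric_on \<eta> E f)
     {L. 1 \<le> L} (\<lambda>L f. vanishing_three_point L f)"
  unfolding quantitatively_equivalent_def quantitatively_implies_def
proof (intro conjI ballI)
  fix \<eta> assume "\<eta> \<in> {\<eta>. half_line_homeomorphism \<eta>}"
  then show "\<exists>L\<in>{L. 1 \<le> L}. \<forall>f\<in>{f. bij_betw f E E}. quasisymmetric_on \<eta> E f \<longrightarrow> vanishing_three_point L f"
    using quasisymmetric_imp_vanishing_three_point by (intro bexI[of _ "max 1 (\<eta> 1)"]) auto
next
  fix L :: real assume L: "L \<in> {L. 1 \<le> L}"
  define c :: real where "c = exp (2 * of_int (2 * \<lceil>ln L\<rceil> + 2)) / (1 - exp (-1))^2"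
  have "c > 0"
    by (simp add: c_def)
  then have "half_line_homeomorphism (\<lambda>s. c * s)"
    by (rule linear_half_line_homeomorphism)
  moreover have "quasisymmetric_on (\<lambda>s. c * s) E f" if "bij_betw f E E" "vanishing_three_point L f" for f
    using vanishing_three_point_imp_quasisymmetric[of L f] that L by (simp add: c_def)
  ultimately show "\<exists>\<eta>\<in>{\<eta>. half_line_homeomorphism \<eta>}. \<forall>f\<in>{f. bij_betw f E E}. vanishing_three_point L f \<longrightarrow> quasisymmetric_on \<eta> E f"
    by blast
qed

lemma three_point_iff_quasiconformal:
  "quantitatively_equivalent {f. bij_betw f E E}
     {L. 1 \<le> L} (\<lambda>L f. vanishing_three_point L f)
     {K. 1 \<le> K} (\<lambda>K f. quasiconformal_extension K f)"
  unfolding quantitatively_equivalent_def quantitatively_implies_def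
proof (intro conjI ballI)
  fix L :: real assume "L \<in> {L. 1 \<le> L}"
  then have L: "1 \<le> L" by simp
  define C where "C = 2 * \<lceil>ln L\<rceil> + 2"
  have lnL: "0 \<le> \<lceil>ln L\<rceil>"
    using ln_ge_zero[OF L] by linarith
  then have "0 \<le> C"
    by (simp add: C_def)
  from bounded_displacement_extension[OF this] obtain K where K: "1 \<le> K"
    "\<And>\<tau> t. bij \<tau> \<Longrightarrow> (\<And>n. \<bar>\<tau> n - n\<bar> \<le> C) \<Longrightarrow>
       \<exists>F. quasiconformal_on K UNIV F \<and> (\<forall>n. F (exp (of_int n)) = exp (of_int (\<tau> n + t)))"
    by blast
  have "quasiconformal_extension K f" if f: "bij_betw f E E" and v: "vanishing_three_point L f" for f
  proof -
    obtain \<sigma> where \<sigma>: "bij \<sigma>" "\<And>n. f (exp (of_int n)) = exp (of_int (\<sigma> n))"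
      using bij_E_permutation[OF f] by blast
    have "\<bar>\<sigma> n - n - \<sigma> 0\<bar> \<le> C" for n
      unfolding C_def
      by (rule almost_increasing_displacement[OF \<sigma>(1) three_point_imp_almost_increasing[OF L v \<sigma>] lnL])
    then have disp: "\<bar>(\<sigma> n - \<sigma> 0) - n\<bar> \<le> C" for n
      by (simp add: algebra_simps)
    \<comment> \<open>The displacement is bounded only after subtracting \<open>\<sigma> 0\<close>,
      which is itself unbounded over all \<open>f\<close>. It is returned as the shift
      \<open>t\<close> of the extension lemma, whose \<open>K\<close> does not depend on it.\<close>
    have "bij ((\<lambda>x. x - \<sigma> 0) \<circ> \<sigma>)"
      by (rule bij_comp[OF \<sigma>(1)]) (rule bij_diff_right)
    then have "bij (\<lambda>n. \<sigma> n - \<sigma> 0)"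
      by (simp add: o_def)
    from K(2)[OF this disp, of "\<sigma> 0"] obtain F where "quasiconformal_on K UNIV F" "\<And>n. F (exp (of_int n)) = exp (of_int (\<sigma> n))"
      by auto
    then show ?thesis
      unfolding quasiconformal_extension_def E_def using \<sigma>(2) by auto
  qed
  then show "\<exists>K\<in>{K. 1 \<le> K}. \<forall>f\<in>{f. bij_betw f E E}. vanishing_three_point L f \<longrightarrow> quasiconformal_extension K f"
    using K(1) by blast
next
  fix K :: real assume K: "K \<in> {K. 1 \<le> K}"
  define C where "C = \<lceil>1024 * K * exp 2 ^ 2 / (exp 1 - 1) ^ 4\<rceil>"
  have C: "0 \<le> C"
  proof -
    have "0 \<le> 1024 * K * exp 2 ^ 2 / (exp 1 - 1) ^ 4"
      using K by auto
    then show ?thesis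
      unfolding C_def by linarith
  qed
  define L where "L = exp (of_int C) / (1 - exp (-1 :: real))"
  have "1 \<le> L"
  proof -
    have "(1 :: real) - exp (-1) \<le> exp (of_int C)"
      using one_le_exp_iff[of "real_of_int C"] C exp_gt_zero[of "-1::real"] by linarith
    then show ?thesis
      by (simp add: L_def)
  qed
  moreover have "vanishing_three_point L f" if f: "bij_betw f E E" and q: "quasiconformal_extension K f" for f
  proof -
    obtain \<sigma> where \<sigma>: "bij \<sigma>" "\<And>n. f (exp (of_int n)) = exp (of_int (\<sigma> n))"
      using bij_E_permutation[OF f] by blast
    obtain F where F: "quasiconformal_on K UNIV F" "\<And>z. z \<in> E \<Longrightarrow> F z = f z"
      using q by (auto simp: quasiconformal_extension_def)
    have "F (exp (of_int n)) = exp (of_int (\<sigma> n))" for n :: int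
      using F(2) \<sigma>(2) by (simp add: E_def)
    from quasiconformal_imp_almost_increasing[OF F(1) \<sigma>(1) this]
    show ?thesis
      unfolding L_def by (intro almost_increasing_imp_vanishing_three_point[OF \<sigma>]) (use C in \<open>simp_all add: C_def\<close>)
  qed
  ultimately show "\<exists>L\<in>{L. 1 \<le> L}. \<forall>f\<in>{f. bij_betw f E E}. quasiconformal_extension K f \<longrightarrow> vanishing_three_point L f"
    by blast
qed

theorem theorem4p9:
  shows "quantitatively_equivalent {f. bij_betw f E E}
           {\<eta>. half_line_homeomorphism \<eta>} (\<lambda>\<eta> f. quasisymmetric_on \<eta> E f)
           {L. 1 \<le> L} (\<lambda>L f. vanishing_three_point L f) \<and>
         quantitatively_equivalent {f. bij_betw f E E}
           {L. 1 \<le> L} (\<lambda>L f. vanishing_three_point L f)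
           {K. 1 \<le> K} (\<lambda>K f. quasiconformal_extension K f) \<and>
         quantitatively_equivalent {f. bij_betw f E E}
           {\<eta>. half_line_homeomorphism \<eta>} (\<lambda>\<eta> f. quasisymmetric_on \<eta> E f)
           {K. 1 \<le> K} (\<lambda>K f. quasiconformal_extension K f)"
  using quasisymmetric_iff_three_point three_point_iff_quasiconformal
  unfolding quantitatively_equivalent_def by (blast intro: quantitatively_implies_trans)

end
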